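(* Let $B,L>0$, $D=(0,L)\times(0,B)\subset\mathbb{R}^2$, $a=\frac{\pi^2}{B^2}+\frac{\pi^2}{L^2}$, and let $\gamma>0$ be such that $$b=\gamma\Big\{\frac{\pi^2}{B^2}+\frac{\pi^2}{L^2}\Big\}^{-1}<1;\qquad\text{put }\theta=1-b>0.$$ Let $u_0:D\to\mathbb{R}$ satisfy $$u_0\in H^4(D),\qquad \partial_x^5u_0\in L^2(D),$$ $$u_0(0,y)=u_{0x}(0,y)=u_0(L,y)=u_{0x}(L,y)=u_{0xx}(L,y)=0,$$ $$u_0(x,0)=u_0(x,B)=u_{0yy}(x,0)=u_{0yy}(x,B)=0,$$ $$J_w=\int_D\big[|\Delta^2u_0|^2+|\Delta u_0|^2+u_0^2u_{0x}^2+|\partial_x^5u_0|^2\big]\,dx\,dy<\infty.$$ Then every regular solution $u$ of the problem $$u_t+\Delta^2u+\gamma\Delta u+\Delta u_x+uu_x-\partial_x^5u=0\quad\text{in }D\times(0,\infty),$$ $$u|_{\partial D}=0,\quad u_{yy}(x,0,t)=u_{yy}(x,B,t)=0,\quad u_x(0,y,t)=u_x(L,y,t)=u_{xx}(L,y,t)=0,$$ $$u(x,y,0)=u_0(x,y),\quad (x,y)\in D,$$ satisfies, for all $t\ge 0$, $$\|u\|^2(t)\le\|u_0\|^2e^{-\chi t},\qquad \chi=2a^2\theta.$$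
   Context: Functions are real valued, $\Delta=\partial_x^2+\partial_y^2$, subscripts denote partial derivatives, $H^k(D)$ is the usual $L^2$-based Sobolev space, and $\|u\|(t)=\|u(\cdot,\cdot,t)\|_{L^2(D)}$. A regular solution is a function such that for every $T>0$: $u\in L^\infty(0,T;H^2(D))\cap L^2(0,T;H^4(D))$, $\partial_x^5u\in L^2(0,T;L^2(D))$, $u_t\in L^\infty(0,T;L^2(D))\cap L^2(0,T;H^2(D))$, the equation holds a.e. in $D\times(0,T)$, the boundary conditions hold in the sense of traces for a.e. $t$, and the initial condition holds in $L^2(D)$. *)

theory Defs
  imports "HOL-Analysis.Analysis"
begin

section \<open>Smooth functions and weak derivatives\<close>

definition dir_deriv :: "'a::euclidean_space \<Rightarrow> ('a \<Rightarrow> real) \<Rightarrow> 'a \<Rightarrow> real" where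
  "dir_deriv e f x = frechet_derivative f (at x) e"

text \<open>\<open>foldr dir_deriv [e\<^sub>1, \<dots>, e\<^sub>m] f\<close> is the iterated classical derivative of \<open>f\<close> along
  \<open>e\<^sub>1, \<dots>, e\<^sub>m\<close>. A function is \<open>C\<^sup>\<infinity>\<close> iff all of these are differentiable everywhere
  (continuity of each of them follows).\<close>

definition smooth :: "('a::euclidean_space \<Rightarrow> real) \<Rightarrow> bool" where
  "smooth f \<longleftrightarrow> (\<forall>ds. \<forall>x. foldr dir_deriv ds f differentiable (at x))"

definition test_function :: "'a::euclidean_space set \<Rightarrow> ('a \<Rightarrow> real) \<Rightarrow> bool" where
  "test_function \<Omega> \<phi> \<longleftrightarrow> smooth \<phi> \<and> (\<exists>K. compact K \<and> K \<subseteq> \<Omega> \<and> (\<forall>x. x \<notin> K \<longrightarrow> \<phi> x = 0))"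

definition locally_integrable :: "'a::euclidean_space set \<Rightarrow> ('a \<Rightarrow> real) \<Rightarrow> bool" where
  "locally_integrable \<Omega> f \<longleftrightarrow> (\<forall>K. compact K \<and> K \<subseteq> \<Omega> \<longrightarrow> set_integrable lebesgue K f)"

definition has_weak_deriv ::
    "'a::euclidean_space list \<Rightarrow> 'a set \<Rightarrow> ('a \<Rightarrow> real) \<Rightarrow> ('a \<Rightarrow> real) \<Rightarrow> bool" where
  "has_weak_deriv ds \<Omega> f g \<longleftrightarrow>
     locally_integrable \<Omega> f \<and> locally_integrable \<Omega> g \<and>
     (\<forall>\<phi>. test_function \<Omega> \<phi> \<longrightarrow>
        (LINT x:\<Omega>|lebesgue. f x * foldr dir_deriv ds \<phi> x)
          = (- 1) ^ length ds * (LINT x:\<Omega>|lebesgue. g x * \<phi> x))"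

text \<open>Weak derivatives are unique almost everywhere only, so \<open>weak_deriv\<close> picks a representative;
  below it occurs only under integrals, in almost-everywhere statements, and inside notions that
  do not depend on the representative.\<close>

definition weak_deriv ::
    "'a::euclidean_space list \<Rightarrow> 'a set \<Rightarrow> ('a \<Rightarrow> real) \<Rightarrow> 'a \<Rightarrow> real" where
  "weak_deriv ds \<Omega> f = (SOME g. has_weak_deriv ds \<Omega> f g)"


section \<open>Sobolev spaces on planar domains\<close>

definition L2_fun :: "'a::euclidean_space set \<Rightarrow> ('a \<Rightarrow> real) \<Rightarrow> bool" where
  "L2_fun \<Omega> f \<longleftrightarrow> set_borel_measurable lebesgue \<Omega> f \<and> set_integrable lebesgue \<Omega> (\<lambda>x. (f x)\<^sup>2)"

definition norm_L2 :: "'a::euclidean_space set \<Rightarrow> ('a \<Rightarrow> real) \<Rightarrow> real" where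
  "norm_L2 \<Omega> f = sqrt (LINT x:\<Omega>|lebesgue. (f x)\<^sup>2)"

text \<open>The directions of the mixed derivative of order \<open>i\<close> in \<open>x\<close> and \<open>j\<close> in \<open>y\<close>.\<close>

definition dirs :: "nat \<Rightarrow> nat \<Rightarrow> (real \<times> real) list" where
  "dirs i j = replicate i (1, 0) @ replicate j (0, 1)"

abbreviation wd ::
    "nat \<Rightarrow> nat \<Rightarrow> (real \<times> real) set \<Rightarrow> (real \<times> real \<Rightarrow> real) \<Rightarrow> real \<times> real \<Rightarrow> real" where
  "wd i j \<equiv> weak_deriv (dirs i j)"

definition lap :: "(real \<times> real) set \<Rightarrow> (real \<times> real \<Rightarrow> real) \<Rightarrow> real \<times> real \<Rightarrow> real" where
  "lap \<Omega> f = (\<lambda>p. wd 2 0 \<Omega> f p + wd 0 2 \<Omega> f p)"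

definition L2_weak_deriv ::
    "nat \<Rightarrow> nat \<Rightarrow> (real \<times> real) set \<Rightarrow> (real \<times> real \<Rightarrow> real) \<Rightarrow> bool" where
  "L2_weak_deriv i j \<Omega> f \<longleftrightarrow> (\<exists>g. has_weak_deriv (dirs i j) \<Omega> f g \<and> L2_fun \<Omega> g)"

definition sobolev :: "nat \<Rightarrow> (real \<times> real) set \<Rightarrow> (real \<times> real \<Rightarrow> real) set" where
  "sobolev k \<Omega> = {f. \<forall>i j. i + j \<le> k \<longrightarrow> L2_weak_deriv i j \<Omega> f}"

definition sobolev_norm :: "nat \<Rightarrow> (real \<times> real) set \<Rightarrow> (real \<times> real \<Rightarrow> real) \<Rightarrow> real" where
  "sobolev_norm k \<Omega> f = sqrt (\<Sum>i\<le>k. \<Sum>j\<le>k - i. (norm_L2 \<Omega> (wd i j \<Omega> f))\<^sup>2)"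

text \<open>\<open>has_trace \<Omega> \<sigma> l f g\<close>: the function \<open>f \<in> H\<^sup>1(\<Omega>)\<close> has trace \<open>g\<close> on the boundary segment
  \<open>{\<sigma> s | 0 < s < l}\<close>, where \<open>\<sigma>\<close> is parametrised by arc length. This is the extension by
  continuity, from functions smooth up to the boundary to \<open>H\<^sup>1(\<Omega>)\<close>, of the restriction map.\<close>

definition has_trace ::
    "(real \<times> real) set \<Rightarrow> (real \<Rightarrow> real \<times> real) \<Rightarrow> real \<Rightarrow> (real \<times> real \<Rightarrow> real) \<Rightarrow> (real \<Rightarrow> real)
      \<Rightarrow> bool" where
  "has_trace \<Omega> \<sigma> l f g \<longleftrightarrow>
     f \<in> sobolev 1 \<Omega> \<and> L2_fun {0<..<l} g \<and>
     (\<exists>\<phi>. (\<forall>n::nat. smooth (\<phi> n)) \<and>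
        (\<lambda>n. sobolev_norm 1 \<Omega> (\<lambda>p. \<phi> n p - f p)) \<longlonglongrightarrow> 0 \<and>
        (\<lambda>n. norm_L2 {0<..<l} (\<lambda>s. \<phi> n (\<sigma> s) - g s)) \<longlonglongrightarrow> 0)"


section \<open>Bochner spaces over \<open>(0,T)\<close> with values in \<open>H\<^sup>k(\<Omega>)\<close>\<close>

text \<open>Strong measurability: pointwise almost everywhere limit, in the norm of \<open>H\<^sup>k(\<Omega>)\<close>, of
  measurable functions with finitely many values. Note that \<open>k = 0\<close> gives \<open>L\<^sup>2(\<Omega>)\<close>.\<close>

definition strongly_measurable ::
    "nat \<Rightarrow> (real \<times> real) set \<Rightarrow> real \<Rightarrow> (real \<Rightarrow> real \<times> real \<Rightarrow> real) \<Rightarrow> bool" where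
  "strongly_measurable k \<Omega> T u \<longleftrightarrow>
     (AE t in lebesgue. t \<in> {0<..<T} \<longrightarrow> u t \<in> sobolev k \<Omega>) \<and>
     (\<exists>s. (\<forall>n::nat. finite (s n ` {0<..<T}) \<and> s n ` {0<..<T} \<subseteq> sobolev k \<Omega> \<and>
                    (\<forall>w. {t \<in> {0<..<T}. s n t = w} \<in> sets lebesgue)) \<and>
          (AE t in lebesgue. t \<in> {0<..<T} \<longrightarrow>
             (\<lambda>n. sobolev_norm k \<Omega> (\<lambda>p. s n t p - u t p)) \<longlonglongrightarrow> 0))"

definition bochner_L2 ::
    "nat \<Rightarrow> (real \<times> real) set \<Rightarrow> real \<Rightarrow> (real \<Rightarrow> real \<times> real \<Rightarrow> real) set" where
  "bochner_L2 k \<Omega> T =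
     {u. strongly_measurable k \<Omega> T u \<and>
         set_integrable lebesgue {0<..<T} (\<lambda>t. (sobolev_norm k \<Omega> (u t))\<^sup>2)}"

definition bochner_Linf ::
    "nat \<Rightarrow> (real \<times> real) set \<Rightarrow> real \<Rightarrow> (real \<Rightarrow> real \<times> real \<Rightarrow> real) set" where
  "bochner_Linf k \<Omega> T =
     {u. strongly_measurable k \<Omega> T u \<and>
         (\<exists>C. AE t in lebesgue. t \<in> {0<..<T} \<longrightarrow> sobolev_norm k \<Omega> (u t) \<le> C)}"


section \<open>The initial-boundary value problem\<close>

definition rect :: "real \<Rightarrow> real \<Rightarrow> (real \<times> real) set" where
  "rect L B = {0<..<L} \<times> {0<..<B}"

definition zero_at_x :: "real \<Rightarrow> real \<Rightarrow> real \<Rightarrow> (real \<times> real \<Rightarrow> real) \<Rightarrow> bool" where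
  "zero_at_x L B c f \<longleftrightarrow> has_trace (rect L B) (\<lambda>y. (c, y)) B f (\<lambda>_. 0)"

definition zero_at_y :: "real \<Rightarrow> real \<Rightarrow> real \<Rightarrow> (real \<times> real \<Rightarrow> real) \<Rightarrow> bool" where
  "zero_at_y L B c f \<longleftrightarrow> has_trace (rect L B) (\<lambda>x. (x, c)) L f (\<lambda>_. 0)"

definition boundary_conditions :: "real \<Rightarrow> real \<Rightarrow> (real \<times> real \<Rightarrow> real) \<Rightarrow> bool" where
  "boundary_conditions L B f \<longleftrightarrow>
     zero_at_x L B 0 f \<and> zero_at_x L B L f \<and> zero_at_y L B 0 f \<and> zero_at_y L B B f \<and>
     zero_at_y L B 0 (wd 0 2 (rect L B) f) \<and> zero_at_y L B B (wd 0 2 (rect L B) f) \<and>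
     zero_at_x L B 0 (wd 1 0 (rect L B) f) \<and> zero_at_x L B L (wd 1 0 (rect L B) f) \<and>
     zero_at_x L B L (wd 2 0 (rect L B) f)"

definition J_w :: "real \<Rightarrow> real \<Rightarrow> (real \<times> real \<Rightarrow> real) \<Rightarrow> ennreal" where
  "J_w L B f = (let D = rect L B in
     \<integral>\<^sup>+p\<in>D. ennreal (\<bar>lap D (lap D f) p\<bar>\<^sup>2 + \<bar>lap D f p\<bar>\<^sup>2
                    + (f p)\<^sup>2 * (wd 1 0 D f p)\<^sup>2 + \<bar>wd 5 0 D f p\<bar>\<^sup>2) \<partial>lebesgue)"

text \<open>In \<open>regular_solution\<close>, \<open>u t\<close> is the function \<open>u(\<cdot>,\<cdot>,t)\<close>, and \<open>v\<close> is \<open>u\<^sub>t\<close>, the weak derivative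
  of \<open>u\<close> in the last variable on the space-time cylinder.

  Since \<open>u, u\<^sub>t \<in> L\<^sup>\<infinity>(0,T;L\<^sup>2)\<close>, the class of \<open>u\<close> has a representative that is continuous from
  \<open>[0,\<infinity>)\<close> to \<open>L\<^sup>2\<close>; the initial condition and the values \<open>\<parallel>u\<parallel>(t)\<close> at individual times refer to it.
  This is the role of the continuity clause.

  The equation is required almost everywhere in \<open>D \<times> (0,T)\<close>. It is written as an iterated statement
  because the spatial derivatives are derivatives of \<open>u(\<cdot>,\<cdot>,t)\<close>, each determined only up to a null
  set of \<open>D\<close> that depends on \<open>t\<close>; for jointly measurable versions the two forms agree by Fubini.\<close>

definition regular_solution ::
    "real \<Rightarrow> real \<Rightarrow> real \<Rightarrow> (real \<times> real \<Rightarrow> real) \<Rightarrow> (real \<Rightarrow> real \<times> real \<Rightarrow> real) \<Rightarrow> bool" where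
  "regular_solution L B \<gamma> u0 u \<longleftrightarrow> (let D = rect L B in
     (\<forall>t\<ge>0. L2_fun D (u t)) \<and>
     (\<forall>s\<ge>0. ((\<lambda>t. norm_L2 D (\<lambda>p. u t p - u s p)) \<longlongrightarrow> 0) (at s within {0..})) \<and>
     (AE p in lebesgue. p \<in> D \<longrightarrow> u 0 p = u0 p) \<and>
     (\<exists>v. has_weak_deriv [((0, 0), 1)] (D \<times> {0<..}) (\<lambda>(p, t). u t p) (\<lambda>(p, t). v t p) \<and>
        (\<forall>T>0.
           u \<in> bochner_Linf 2 D T \<and> u \<in> bochner_L2 4 D T \<and>
           (AE t in lebesgue. t \<in> {0<..<T} \<longrightarrow> L2_weak_deriv 5 0 D (u t)) \<and>
           (\<lambda>t. wd 5 0 D (u t)) \<in> bochner_L2 0 D T \<and>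
           v \<in> bochner_Linf 0 D T \<and> v \<in> bochner_L2 2 D T \<and>
           (AE t in lebesgue. t \<in> {0<..<T} \<longrightarrow>
              (AE p in lebesgue. p \<in> D \<longrightarrow>
                 v t p + lap D (lap D (u t)) p + \<gamma> * lap D (u t) p + lap D (wd 1 0 D (u t)) p
                   + u t p * wd 1 0 D (u t) p - wd 5 0 D (u t) p = 0)) \<and>
           (AE t in lebesgue. t \<in> {0<..<T} \<longrightarrow> boundary_conditions L B (u t)))))"

end

theory Submission
  imports Defs
begin

text \<open>Testing the equation with \<open>u\<close> gives, for almost every time,
  \<open>d/dt |u|\<^sup>2 + 2 |\<Delta>u|\<^sup>2 - 2\<gamma> |\<nabla>u|\<^sup>2 \<le> 0\<close>: by the boundary conditions the terms \<open>\<Delta>u\<^sub>x\<close> and \<open>u u\<^sub>x\<close> do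
  not contribute, and the fifth derivative contributes the integral of \<open>u\<^sub>x\<^sub>x(0,y)\<^sup>2\<close> with the good
  sign. Wirtinger's inequality in both variables gives \<open>a |u|\<^sup>2 \<le> |\<nabla>u|\<^sup>2\<close>, hence \<open>a |\<nabla>u|\<^sup>2 \<le> |\<Delta>u|\<^sup>2\<close>
  and \<open>a\<^sup>2 |u|\<^sup>2 \<le> |\<Delta>u|\<^sup>2\<close>, and the decay follows as in Gronwall's lemma.

  The integrations by parts are carried out on lines: a function with an integrable weak derivative
  in one variable is absolutely continuous on almost every line in that direction, and a zero trace
  becomes a zero boundary value of this representative. The same fact in the time variable yields the
  energy identity for \<open>|u(t)|\<^sup>2\<close>. Integrability of \<open>u\<^sup>2 u\<^sub>x\<close> needs no Sobolev embedding, since the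
  equation itself shows that \<open>u u\<^sub>x\<close> is square integrable.\<close>


section \<open>Smooth functions\<close>

lemma smooth_differentiable: "smooth f \<Longrightarrow> f differentiable (at x)"
  unfolding smooth_def by (metis foldr.simps(1) id_apply)

lemma smooth_dir_deriv: "smooth f \<Longrightarrow> smooth (dir_deriv e f)"
proof -
  assume f: "smooth f"
  have "foldr dir_deriv ds (dir_deriv e f) = foldr dir_deriv (ds @ [e]) f" for ds by simp
  then show ?thesis using f unfolding smooth_def by presburger
qed

lemma smooth_foldr: "smooth f \<Longrightarrow> smooth (foldr dir_deriv ds f)"
  by (induction ds) (auto intro: smooth_dir_deriv)

lemma smooth_coinduct:
  assumes "f \<in> S" "\<And>f x. f \<in> S \<Longrightarrow> f differentiable (at x)" "\<And>f e. f \<in> S \<Longrightarrow> dir_deriv e f \<in> S"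
  shows "smooth f"
proof -
  have "foldr dir_deriv ds f \<in> S" for ds by (induction ds) (auto simp: assms)
  then show ?thesis unfolding smooth_def using assms(2) by blast
qed

lemma dir_deriv_eqI: "(f has_derivative f') (at x) \<Longrightarrow> dir_deriv e f x = f' e"
  unfolding dir_deriv_def using frechet_derivative_at by metis

lemma smooth_has_derivative: "smooth f \<Longrightarrow> (f has_derivative (\<lambda>e. dir_deriv e f x)) (at x)"
  using smooth_differentiable[of f x] unfolding dir_deriv_def frechet_derivative_works by simp

lemma smooth_continuous_on: "smooth f \<Longrightarrow> continuous_on A f"
  by (meson differentiable_imp_continuous_on differentiable_at_imp_differentiable_on smooth_differentiable)

lemma smooth_borel_measurable: "smooth f \<Longrightarrow> f \<in> borel_measurable borel"
  by (simp add: borel_measurable_continuous_onI smooth_continuous_on)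

lemma
  assumes "smooth f" and h: "\<And>x. (h has_derivative A) (at x)"
  shows smooth_compose_affine: "smooth (\<lambda>x. f (h x))"
    and dir_deriv_compose_affine: "dir_deriv e (\<lambda>x. f (h x)) = (\<lambda>x. dir_deriv (A e) f (h x))"
proof -
  have d: "((\<lambda>x. f (h x)) has_derivative (\<lambda>e. dir_deriv (A e) f (h x))) (at x)" if "smooth f" for f x
    using has_derivative_compose[OF h smooth_has_derivative[OF that]] by simp
  have e: "dir_deriv e (\<lambda>x. f (h x)) = (\<lambda>x. dir_deriv (A e) f (h x))" if "smooth f" for f e
    using dir_deriv_eqI[OF d[OF that]] by auto
  show "dir_deriv e (\<lambda>x. f (h x)) = (\<lambda>x. dir_deriv (A e) f (h x))" by (rule e[OF assms(1)])
  show "smooth (\<lambda>x. f (h x))"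
  proof (rule smooth_coinduct[where S = "{\<lambda>x. f (h x) | f. smooth f}"])
    show "(\<lambda>x. f (h x)) \<in> {\<lambda>x. f (h x) |f. smooth f}" using assms(1) by auto
    show "F differentiable at x" if "F \<in> {\<lambda>x. f (h x) |f. smooth f}" for F x
      using that d by (auto simp: differentiable_def)
    show "dir_deriv e F \<in> {\<lambda>x. f (h x) |f. smooth f}" if F: "F \<in> {\<lambda>x. f (h x) |f. smooth f}" for F e
    proof -
      obtain f where "F = (\<lambda>x. f (h x))" "smooth f" using F by auto
      then show ?thesis using e[of f e] smooth_dir_deriv by blast
    qed
  qed
qed

lemma dir_deriv_const: "dir_deriv e (\<lambda>x. c) = (\<lambda>x. 0)"
  by (intro ext dir_deriv_eqI) (rule has_derivative_const)

lemma smooth_const: "smooth (\<lambda>x. c)"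
  by (rule smooth_coinduct[where S = "{\<lambda>x. c |c. True}"]) (auto simp: dir_deriv_const)

lemma dir_deriv_add:
  assumes "smooth f" "smooth g"
  shows "dir_deriv e (\<lambda>x. f x + g x) = (\<lambda>x. dir_deriv e f x + dir_deriv e g x)"
  by (intro ext dir_deriv_eqI) (intro has_derivative_add smooth_has_derivative assms)

lemma smooth_add:
  assumes "smooth f" "smooth g" shows "smooth (\<lambda>x. f x + g x)"
proof (rule smooth_coinduct[where S = "{\<lambda>x. f x + g x |f g. smooth f \<and> smooth g}"])
  show "(\<lambda>x. f x + g x) \<in> {\<lambda>x. f x + g x |f g. smooth f \<and> smooth g}" using assms by blast
next
  fix F x assume "F \<in> {\<lambda>x. f x + g x |f g. smooth f \<and> smooth g}"
  then show "F differentiable at x" using differentiable_add smooth_differentiable by blast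
next
  fix F e assume "F \<in> {\<lambda>x. f x + g x |f g. smooth f \<and> smooth g}"
  then obtain f g where "smooth f" "smooth g" "F = (\<lambda>x. f x + g x)" by auto
  then show "dir_deriv e F \<in> {\<lambda>x. f x + g x |f g. smooth f \<and> smooth g}"
    using dir_deriv_add smooth_dir_deriv by blast
qed

lemma dir_deriv_mult:
  assumes "smooth f" "smooth g"
  shows "dir_deriv e (\<lambda>x. f x * g x) = (\<lambda>x. f x * dir_deriv e g x + dir_deriv e f x * g x)"
  by (intro ext dir_deriv_eqI) (intro has_derivative_mult smooth_has_derivative assms)

inductive product_sum :: "('a::euclidean_space \<Rightarrow> real) \<Rightarrow> bool" where
  mult: "smooth f \<Longrightarrow> smooth g \<Longrightarrow> product_sum (\<lambda>x. f x * g x)"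
| add: "product_sum f \<Longrightarrow> product_sum g \<Longrightarrow> product_sum (\<lambda>x. f x + g x)"

lemma product_sum_dir_deriv:
  "product_sum f \<Longrightarrow> (\<forall>x. f differentiable (at x)) \<and> product_sum (dir_deriv e f)"
proof (induction rule: product_sum.induct)
  case (mult f g)
  then show ?case
    using product_sum.add[OF product_sum.mult product_sum.mult, of f "dir_deriv e g" "dir_deriv e f" g]
    using differentiable_mult[OF smooth_differentiable smooth_differentiable, of f g]
    by (simp add: dir_deriv_mult smooth_dir_deriv)
next
  case (add f g)
  have "dir_deriv e (\<lambda>x. f x + g x) = (\<lambda>x. dir_deriv e f x + dir_deriv e g x)"
  proof
    fix x
    show "dir_deriv e (\<lambda>x. f x + g x) x = dir_deriv e f x + dir_deriv e g x"
      using add.IH dir_deriv_eqI[OF has_derivative_add[of f _ "at x" g]]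
      by (simp add: dir_deriv_def frechet_derivative_works)
  qed
  then show ?case using add by (auto intro: product_sum.add)
qed

lemma smooth_mult: "smooth f \<Longrightarrow> smooth g \<Longrightarrow> smooth (\<lambda>x. f x * g x)"
  by (rule smooth_coinduct[where S = "Collect product_sum"])
     (use product_sum_dir_deriv in \<open>auto intro: product_sum.mult\<close>)

lemma smooth_prod:
  "finite I \<Longrightarrow> (\<And>i. i \<in> I \<Longrightarrow> smooth (f i)) \<Longrightarrow> smooth (\<lambda>x. \<Prod>i\<in>I. f i x)"
  by (induction rule: finite_induct) (auto intro: smooth_mult smooth_const)

lemma smooth_has_line_derivative:
  assumes "smooth f"
  shows "((\<lambda>t. f (x + t *\<^sub>R e)) has_real_derivative dir_deriv e f (x + t *\<^sub>R e)) (at t)"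
proof -
  have "((\<lambda>t. x + t *\<^sub>R e) has_derivative (\<lambda>t. t *\<^sub>R e)) (at t)"
    by (auto intro!: derivative_eq_intros)
  from has_derivative_compose[OF this smooth_has_derivative[OF assms]]
  have d: "((\<lambda>t. f (x + t *\<^sub>R e)) has_derivative (\<lambda>s. dir_deriv (s *\<^sub>R e) f (x + t *\<^sub>R e))) (at t)" .
  have "dir_deriv (s *\<^sub>R e) f y = dir_deriv e f y * s" for s y
    using linear_scale[OF has_derivative_linear[OF smooth_has_derivative[OF assms]]] by simp
  then show ?thesis using d by (simp add: has_field_derivative_def)
qed

lemma smooth_has_real_derivative:
  "smooth f \<Longrightarrow> (f has_real_derivative dir_deriv 1 f x) (at x)"
  using smooth_has_line_derivative[of f 0 1 x] by simp

lemma smooth_real_sequence: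
  assumes "\<And>n x. (F n has_real_derivative F (Suc n) x) (at x)"
  shows "smooth (F 0)"
proof (rule smooth_coinduct[where S = "{\<lambda>x. c * F n x |c n. True}"])
  show "F 0 \<in> {\<lambda>x. c * F n x |c n. True}"
    by (intro CollectI exI[of _ 1] exI[of _ 0]) auto
next
  fix G x assume "G \<in> {\<lambda>x. c * F n x |c n. True}"
  then show "G differentiable at x"
    using DERIV_cmult[OF assms] by (auto simp: differentiable_def has_field_derivative_def)
next
  fix G e assume "G \<in> {\<lambda>x. c * F n x |c n. True}"
  then obtain c n where G: "G = (\<lambda>x. c * F n x)" by auto
  have "dir_deriv e G = (\<lambda>x. (e * c) * F (Suc n) x)"
  proof
    fix x
    have "(G has_derivative (\<lambda>h. (c * F (Suc n) x) * h)) (at x)"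
      unfolding G using DERIV_cmult[OF assms, of c] by (simp add: has_field_derivative_def)
    from dir_deriv_eqI[OF this] show "dir_deriv e G x = (e * c) * F (Suc n) x" by simp
  qed
  then show "dir_deriv e G \<in> {\<lambda>x. c * F n x |c n. True}" by auto
qed

lemma second_difference:
  assumes f: "smooth f" and t: "0 < t"
  shows "\<exists>r s. 0 < r \<and> r < t \<and> 0 < s \<and> s < t \<and>
    f (x + t *\<^sub>R e + t *\<^sub>R e') - f (x + t *\<^sub>R e) - f (x + t *\<^sub>R e') + f x
      = t * t * dir_deriv e' (dir_deriv e f) (x + r *\<^sub>R e + s *\<^sub>R e')"
proof -
  let ?h = "\<lambda>r. f ((x + t *\<^sub>R e') + r *\<^sub>R e) - f (x + r *\<^sub>R e)"
  have "\<exists>r>0. r < t \<and> ?h t - ?h 0 = (t - 0) *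
      (dir_deriv e f ((x + t *\<^sub>R e') + r *\<^sub>R e) - dir_deriv e f (x + r *\<^sub>R e))"
    using t by (intro MVT2) (auto intro!: DERIV_diff smooth_has_line_derivative f)
  then obtain r where r: "0 < r" "r < t"
    and h: "?h t - ?h 0 = t * (dir_deriv e f ((x + t *\<^sub>R e') + r *\<^sub>R e) - dir_deriv e f (x + r *\<^sub>R e))"
    by auto
  let ?k = "\<lambda>s. dir_deriv e f ((x + r *\<^sub>R e) + s *\<^sub>R e')"
  have "\<exists>s>0. s < t \<and> ?k t - ?k 0 = (t - 0) * dir_deriv e' (dir_deriv e f) ((x + r *\<^sub>R e) + s *\<^sub>R e')"
    using t by (intro MVT2) (auto intro!: smooth_has_line_derivative smooth_dir_deriv f)
  then obtain s where s: "0 < s" "s < t"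
    and k: "?k t - ?k 0 = t * dir_deriv e' (dir_deriv e f) ((x + r *\<^sub>R e) + s *\<^sub>R e')" by auto
  have "?h t - ?h 0 = t * (?k t - ?k 0)"
    unfolding h by (simp add: algebra_simps)
  then show ?thesis using r s unfolding k by (intro exI[of _ r] exI[of _ s]) (auto simp: algebra_simps)
qed

lemma dir_deriv_commute:
  assumes f: "smooth f"
  shows "dir_deriv e (dir_deriv e' f) = dir_deriv e' (dir_deriv e f)"
proof
  fix x
  have lim: "\<exists>T. (\<forall>n. T n = (f (x + (1 / real (Suc n)) *\<^sub>R e + (1 / real (Suc n)) *\<^sub>R e')
        - f (x + (1 / real (Suc n)) *\<^sub>R e) - f (x + (1 / real (Suc n)) *\<^sub>R e') + f x) 
        / (1 / real (Suc n) * (1 / real (Suc n))))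
      \<and> T \<longlonglongrightarrow> dir_deriv e' (dir_deriv e f) x" for e e'
  proof -
    let ?t = "\<lambda>n::nat. 1 / real (Suc n)"
    have "\<forall>n. \<exists>r s. 0 < r \<and> r < ?t n \<and> 0 < s \<and> s < ?t n \<and>
      f (x + ?t n *\<^sub>R e + ?t n *\<^sub>R e') - f (x + ?t n *\<^sub>R e) - f (x + ?t n *\<^sub>R e') + f x
        = ?t n * ?t n * dir_deriv e' (dir_deriv e f) (x + r *\<^sub>R e + s *\<^sub>R e')"
      by (intro allI second_difference f) auto
    then obtain r s where rs: "\<And>n. 0 < r n" "\<And>n. r n < ?t n" "\<And>n. 0 < s n" "\<And>n. s n < ?t n"
      "\<And>n. f (x + ?t n *\<^sub>R e + ?t n *\<^sub>R e') - f (x + ?t n *\<^sub>R e) - f (x + ?t n *\<^sub>R e') + f x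
        = ?t n * ?t n * dir_deriv e' (dir_deriv e f) (x + r n *\<^sub>R e + s n *\<^sub>R e')"
      by metis
    have t0: "?t \<longlonglongrightarrow> 0" using LIMSEQ_inverse_real_of_nat by (simp add: inverse_eq_divide)
    have r0: "r \<longlonglongrightarrow> 0" "s \<longlonglongrightarrow> 0"
      by (rule real_tendsto_sandwich[OF _ _ tendsto_const t0];
          use rs(1-4) in \<open>auto intro!: always_eventually less_imp_le\<close>)+
    have "isCont (dir_deriv e' (dir_deriv e f)) x"
      using smooth_continuous_on[OF smooth_dir_deriv[OF smooth_dir_deriv[OF f]], of UNIV]
      by (simp add: continuous_on_eq_continuous_at)
    moreover have "(\<lambda>n. x + r n *\<^sub>R e + s n *\<^sub>R e') \<longlonglongrightarrow> x"
      by (rule tendsto_eq_intros r0 refl | simp)+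
    ultimately have "(\<lambda>n. dir_deriv e' (dir_deriv e f) (x + r n *\<^sub>R e + s n *\<^sub>R e'))
        \<longlonglongrightarrow> dir_deriv e' (dir_deriv e f) x"
      by (rule isCont_tendsto_compose)
    then show ?thesis
      by (intro exI[of _ "\<lambda>n. dir_deriv e' (dir_deriv e f) (x + r n *\<^sub>R e + s n *\<^sub>R e')"] conjI allI)
         (subst rs(5), simp)
  qed
  obtain T where T: "\<And>n. T n = (f (x + (1 / real (Suc n)) *\<^sub>R e + (1 / real (Suc n)) *\<^sub>R e')
        - f (x + (1 / real (Suc n)) *\<^sub>R e) - f (x + (1 / real (Suc n)) *\<^sub>R e') + f x) 
        / (1 / real (Suc n) * (1 / real (Suc n)))" "T \<longlonglongrightarrow> dir_deriv e' (dir_deriv e f) x"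
    using lim[of e e'] by auto
  obtain S where S: "\<And>n. S n = (f (x + (1 / real (Suc n)) *\<^sub>R e' + (1 / real (Suc n)) *\<^sub>R e)
        - f (x + (1 / real (Suc n)) *\<^sub>R e') - f (x + (1 / real (Suc n)) *\<^sub>R e) + f x) 
        / (1 / real (Suc n) * (1 / real (Suc n)))" "S \<longlonglongrightarrow> dir_deriv e (dir_deriv e' f) x"
    using lim[of e' e] by auto
  have "S = T" unfolding fun_eq_iff S(1) T(1) by (simp add: algebra_simps)
  then show "dir_deriv e (dir_deriv e' f) x = dir_deriv e' (dir_deriv e f) x"
    using S(2) T(2) LIMSEQ_unique by blast
qed

lemma foldr_dir_deriv_commute:
  assumes "smooth f"
  shows "foldr dir_deriv ds (dir_deriv e f) = dir_deriv e (foldr dir_deriv ds f)"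
  by (induction ds) (auto simp: dir_deriv_commute smooth_foldr assms)

lemma foldr_dir_deriv_dirs_append:
  assumes f: "smooth f"
  shows "foldr dir_deriv (dirs i j @ dirs k l) f = foldr dir_deriv (dirs (i + k) (j + l)) f"
proof -
  have x: "foldr dir_deriv ds (foldr dir_deriv (replicate k e) g)
      = foldr dir_deriv (replicate k e) (foldr dir_deriv ds g)" if "smooth g" for ds e g
  proof (induction k)
    case (Suc k)
    then show ?case
      using foldr_dir_deriv_commute[OF smooth_foldr[OF that], of ds e "replicate k e"] by simp
  qed simp
  have "foldr dir_deriv (dirs i j @ dirs k l) f = foldr dir_deriv (replicate i (1,0))
    (foldr dir_deriv (replicate j (0,1)) (foldr dir_deriv (replicate k (1,0)) (foldr dir_deriv (replicate l (0,1)) f)))"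
    by (simp add: dirs_def)
  also have "\<dots> = foldr dir_deriv (replicate i (1,0) @ replicate k (1,0)) (foldr dir_deriv (replicate j (0,1) @ replicate l (0,1)) f)"
    by (simp add: x smooth_foldr f del: foldr_replicate)
  also have "\<dots> = foldr dir_deriv (dirs (i + k) (j + l)) f"
    by (simp add: dirs_def replicate_add)
  finally show ?thesis .
qed

section \<open>Test functions\<close>

definition flat_poly :: "real poly \<Rightarrow> real \<Rightarrow> real" where
  "flat_poly P x = (if x > 0 then poly P (inverse x) * exp (- inverse x) else 0)"

lemma poly_mult_exp_tendsto_0: "((\<lambda>y. poly P y * exp (- y)) \<longlongrightarrow> (0::real)) at_top"
proof (induction P)
  case (pCons a P)
  have "((\<lambda>y. poly P y * y * exp (- y)) \<longlongrightarrow> (0::real)) at_top"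
  proof -
    have "poly P y * y * exp (- y) = (\<Sum>i\<le>degree P. coeff P i * (y ^ Suc i / exp y))" for y
      by (simp add: poly_altdef sum_distrib_left sum_distrib_right exp_minus divide_inverse algebra_simps)
    moreover have "((\<lambda>y. \<Sum>i\<le>degree P. coeff P i * (y ^ Suc i / exp y)) \<longlongrightarrow> (\<Sum>i\<le>degree P. coeff P i * 0)) at_top"
      by (intro tendsto_sum tendsto_mult tendsto_const tendsto_power_div_exp_0)
    ultimately show ?thesis by simp
  qed
  moreover have "((\<lambda>y. a * exp (- y)) \<longlongrightarrow> a * 0) at_top"
    using tendsto_power_div_exp_0[of 0] by (intro tendsto_mult tendsto_const) (simp add: exp_minus divide_inverse)
  ultimately have "((\<lambda>y. a * exp (- y) + poly P y * y * exp (- y)) \<longlongrightarrow> a * 0 + 0) at_top"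
    by (intro tendsto_add)
  then show ?case by (simp add: algebra_simps)
qed simp

lemma flat_poly_has_derivative:
  "(flat_poly P has_real_derivative flat_poly ([:0, 0, 1:] * (P - pderiv P)) x) (at x)"
proof -
  consider "x > 0" | "x < 0" | "x = 0" by linarith
  then show ?thesis
  proof cases
    case 1
    have "((\<lambda>x. poly P (inverse x) * exp (- inverse x)) has_real_derivative
        flat_poly ([:0, 0, 1:] * (P - pderiv P)) x) (at x)"
      using 1 by (auto intro!: derivative_eq_intros DERIV_chain2[OF poly_DERIV]
          simp: flat_poly_def algebra_simps power2_eq_square)
    moreover have "eventually (\<lambda>y. y > 0) (nhds x)" using 1
      by (intro eventually_nhds_in_open[of "{0<..}", simplified]) auto
    then have "eventually (\<lambda>y. flat_poly P y = poly P (inverse y) * exp (- inverse y)) (nhds x)"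
      by eventually_elim (simp add: flat_poly_def)
    ultimately show ?thesis by (subst DERIV_cong_ev[OF refl _ refl]) auto
  next
    case 2
    have "eventually (\<lambda>y. y < 0) (nhds x)" using 2
      by (intro eventually_nhds_in_open[of "{..<0}", simplified]) auto
    then have "eventually (\<lambda>y. flat_poly P y = 0) (nhds x)"
      by eventually_elim (simp add: flat_poly_def)
    then show ?thesis using 2 by (subst DERIV_cong_ev[OF refl _ refl]) (auto simp: flat_poly_def)
  next
    case 3
    have "((\<lambda>h. flat_poly P h / h) \<longlongrightarrow> 0) (at_right 0)"
    proof (rule Lim_transform_eventually)
      show "((\<lambda>h. poly (pCons 0 P) (inverse h) * exp (- inverse h)) \<longlongrightarrow> 0) (at_right 0)"
        by (rule filterlim_compose[OF poly_mult_exp_tendsto_0 filterlim_inverse_at_top_right])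
      show "\<forall>\<^sub>F h in at_right 0. poly (pCons 0 P) (inverse h) * exp (- inverse h) = flat_poly P h / h"
        by (auto simp: eventually_at_filter flat_poly_def divide_inverse algebra_simps)
    qed
    moreover have "((\<lambda>h. flat_poly P h / h) \<longlongrightarrow> 0) (at_left 0)"
      by (rule Lim_transform_eventually[OF tendsto_const]) (auto simp: eventually_at_filter flat_poly_def)
    ultimately show ?thesis using 3
      by (simp add: DERIV_def filterlim_at_split flat_poly_def)
  qed
qed

definition flat :: "real \<Rightarrow> real" where "flat = flat_poly [:1:]"

lemma flat_eq: "flat x = (if x > 0 then exp (- inverse x) else 0)"
  by (simp add: flat_def flat_poly_def)

lemma smooth_flat: "smooth flat"
proof -
  define F where "F n = flat_poly (((\<lambda>P. [:0, 0, 1:] * (P - pderiv P)) ^^ n) [:1:])" for n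
  have "smooth (F 0)"
    by (rule smooth_real_sequence) (simp add: F_def flat_poly_has_derivative del: mult_pCons_left)
  then show ?thesis by (simp add: F_def flat_def)
qed

definition box_bump :: "nat \<Rightarrow> 'a::euclidean_space \<Rightarrow> 'a \<Rightarrow> 'a \<Rightarrow> real" where
  "box_bump n a b q = (\<Prod>i\<in>Basis. flat (real (Suc n) * (q \<bullet> i - a \<bullet> i) - 1) * flat (real (Suc n) * (b \<bullet> i - q \<bullet> i) - 1))"

lemma smooth_box_bump: "smooth (box_bump n a b)"
  unfolding box_bump_def
proof (intro smooth_prod smooth_mult)
  fix i :: 'a
  show "smooth (\<lambda>x. flat (real (Suc n) * (x \<bullet> i - a \<bullet> i) - 1))"
    by (rule smooth_compose_affine[OF smooth_flat, where A = "\<lambda>x. real (Suc n) * (x \<bullet> i)"])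
       (auto intro!: derivative_eq_intros)
  show "smooth (\<lambda>x. flat (real (Suc n) * (b \<bullet> i - x \<bullet> i) - 1))"
    by (rule smooth_compose_affine[OF smooth_flat, where A = "\<lambda>x. - real (Suc n) * (x \<bullet> i)"])
       (auto intro!: derivative_eq_intros simp: algebra_simps)
qed simp

lemma flat_bounds: "0 \<le> flat x" "flat x \<le> 1"
  by (auto simp: flat_eq)

lemma box_bump_bounds: "0 \<le> box_bump n a b q" "box_bump n a b q \<le> 1"
  unfolding box_bump_def
  by (auto intro!: prod_nonneg prod_le_1 mult_nonneg_nonneg mult_le_one flat_bounds)

lemma test_function_box_bump:
  assumes "box a b \<subseteq> \<Omega>"
  shows "test_function \<Omega> (box_bump n a b)"
  unfolding test_function_def
proof (intro conjI smooth_box_bump exI[of _ "cbox (a + (1 / real (Suc n)) *\<^sub>R One) (b - (1 / real (Suc n)) *\<^sub>R One)"] allI impI)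
  let ?K = "cbox (a + (1 / real (Suc n)) *\<^sub>R One) (b - (1 / real (Suc n)) *\<^sub>R One)"
  show "compact ?K" by simp
  have "?K \<subseteq> box a b"
  proof
    fix x assume x: "x \<in> ?K"
    show "x \<in> box a b"
      unfolding mem_box
    proof
      fix i :: 'a assume "i \<in> Basis"
      then have "a \<bullet> i + 1 / real (Suc n) \<le> x \<bullet> i" "x \<bullet> i \<le> b \<bullet> i - 1 / real (Suc n)"
        using x by (auto simp: mem_box inner_simps)
      moreover have "1 / real (Suc n) > 0" by simp
      ultimately show "a \<bullet> i < x \<bullet> i \<and> x \<bullet> i < b \<bullet> i" by linarith
    qed
  qed
  then show "?K \<subseteq> \<Omega>" using assms by auto
  fix x assume "x \<notin> ?K"
  then obtain i where i: "i \<in> Basis" "x \<bullet> i < a \<bullet> i + 1 / real (Suc n) \<or> b \<bullet> i - 1 / real (Suc n) < x \<bullet> i"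
    by (auto simp: mem_box inner_simps not_le)
  then have "real (Suc n) * (x \<bullet> i - a \<bullet> i) - 1 \<le> 0 \<or> real (Suc n) * (b \<bullet> i - x \<bullet> i) - 1 \<le> 0"
    by (auto simp: field_simps)
  then show "box_bump n a b x = 0" unfolding box_bump_def using i
    by (intro prod_zero) (auto simp: flat_eq intro!: bexI[of _ i])
qed

lemma box_bump_tendsto: "(\<lambda>n. box_bump n a b q) \<longlonglongrightarrow> indicator (box a b) q"
proof -
  have fl: "(\<lambda>n. flat (real (Suc n) * x - 1)) \<longlonglongrightarrow> indicator {0<..} x" for x
  proof (cases "x > 0")
    case True
    have t: "filterlim (\<lambda>n. real (Suc n) * x - 1) at_top sequentially"
      unfolding filterlim_at_top
    proof
      fix Z
      obtain N where "Z + 1 < real N * x" using reals_Archimedean3[OF True] by blast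
      then have "Z \<le> real (Suc n) * x - 1" if "n \<ge> N" for n
        using mult_right_mono[of "real N" "real (Suc n)" x] that True by linarith
      then show "\<forall>\<^sub>F n in sequentially. Z \<le> real (Suc n) * x - 1"
        unfolding eventually_sequentially by blast
    qed
    have "((\<lambda>n. exp (- inverse (real (Suc n) * x - 1))) \<longlonglongrightarrow> exp (- 0))"
      by (intro tendsto_intros filterlim_compose[OF tendsto_inverse_0_at_top t] filterlim_ident)
    moreover have "eventually (\<lambda>n. real (Suc n) * x - 1 > 0) sequentially"
      using t by (metis filterlim_at_top_dense)
    then have "eventually (\<lambda>n. exp (- inverse (real (Suc n) * x - 1)) = flat (real (Suc n) * x - 1)) sequentially"
      by eventually_elim (simp add: flat_eq)
    ultimately show ?thesis using True by (simp add: tendsto_cong)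
  next
    case False
    then have "flat (real (Suc n) * x - 1) = 0" for n
      using mult_nonneg_nonpos[of "real (Suc n)" x] by (simp add: flat_eq)
    then show ?thesis using False by simp
  qed
  have "(\<lambda>n. box_bump n a b q) \<longlonglongrightarrow> (\<Prod>i\<in>Basis. indicator {0<..} (q \<bullet> i - a \<bullet> i) * indicator {0<..} (b \<bullet> i - q \<bullet> i))"
    unfolding box_bump_def by (intro tendsto_prod tendsto_mult fl)
  also have "(\<Prod>i\<in>Basis. indicator {0<..} (q \<bullet> i - a \<bullet> i) * indicator {0<..} (b \<bullet> i - q \<bullet> i)) = (indicator (box a b) q :: real)"
  proof (cases "q \<in> box a b")
    case False
    then obtain i where "i \<in> Basis" "\<not> (a \<bullet> i < q \<bullet> i \<and> q \<bullet> i < b \<bullet> i)" by (auto simp: mem_box)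
    then show ?thesis using False by (auto intro!: prod_zero bexI[of _ i])
  qed (auto simp: mem_box intro!: prod.neutral)
  finally show ?thesis .
qed

lemma
  assumes "smooth \<phi>" "smooth \<psi>"
  shows smooth_tensor: "smooth (\<lambda>(x, y). \<phi> x * \<psi> y)"
    and dir_deriv_tensor: "dir_deriv (e, e') (\<lambda>(x, y). \<phi> x * \<psi> y)
      = (\<lambda>(x, y). \<phi> x * dir_deriv e' \<psi> y + dir_deriv e \<phi> x * \<psi> y)"
proof -
  have f: "(fst has_derivative fst) (at x)" and s: "(snd has_derivative snd) (at x)" for x :: "'a \<times> 'b"
    by (auto intro: bounded_linear_imp_has_derivative bounded_linear_fst bounded_linear_snd)
  show "smooth (\<lambda>(x, y). \<phi> x * \<psi> y)"
    unfolding split_def by (intro smooth_mult smooth_compose_affine[OF _ f] smooth_compose_affine[OF _ s] assms)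
  show "dir_deriv (e, e') (\<lambda>(x, y). \<phi> x * \<psi> y)
      = (\<lambda>(x, y). \<phi> x * dir_deriv e' \<psi> y + dir_deriv e \<phi> x * \<psi> y)"
    unfolding split_def
    by (subst dir_deriv_mult) (auto intro!: assms smooth_compose_affine[OF _ f] smooth_compose_affine[OF _ s]
        simp: dir_deriv_compose_affine[OF _ f] dir_deriv_compose_affine[OF _ s] assms)
qed

lemma test_function_tensor:
  assumes "test_function A \<phi>" "test_function B \<psi>"
  shows "test_function (A \<times> B) (\<lambda>(x, y). \<phi> x * \<psi> y)"
proof -
  obtain K K' where "compact K" "K \<subseteq> A" "\<And>x. x \<notin> K \<Longrightarrow> \<phi> x = 0"
    and "compact K'" "K' \<subseteq> B" "\<And>x. x \<notin> K' \<Longrightarrow> \<psi> x = 0"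
    using assms unfolding test_function_def by metis
  then show ?thesis using assms unfolding test_function_def
    by (intro conjI smooth_tensor exI[of _ "K \<times> K'"]) (auto intro: compact_Times)
qed

lemma test_function_mono: "test_function A \<phi> \<Longrightarrow> A \<subseteq> B \<Longrightarrow> test_function B \<phi>"
  unfolding test_function_def by blast

lemma dir_deriv_eq_0_outside:
  assumes "closed K" "\<And>x. x \<notin> K \<Longrightarrow> \<phi> x = 0" "x \<notin> K"
  shows "dir_deriv e \<phi> x = 0"
proof (rule dir_deriv_eqI[THEN trans])
  show "(\<phi> has_derivative (\<lambda>h. 0)) (at x)"
    by (rule has_derivative_transform_within_open[where s = "- K" and f = "\<lambda>x. 0"]) (use assms in auto)
qed simp

lemma test_function_dir_deriv:
  assumes "test_function \<Omega> \<phi>" shows "test_function \<Omega> (dir_deriv e \<phi>)"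
proof -
  obtain K where "compact K" "K \<subseteq> \<Omega>" "\<And>x. x \<notin> K \<Longrightarrow> \<phi> x = 0"
    using assms unfolding test_function_def by metis
  then show ?thesis
    using assms dir_deriv_eq_0_outside[of K \<phi>] compact_imp_closed
    unfolding test_function_def by (metis smooth_dir_deriv)
qed

lemma test_function_foldr_dir_deriv:
  "test_function \<Omega> \<phi> \<Longrightarrow> test_function \<Omega> (foldr dir_deriv ds \<phi>)"
  by (induction ds) (auto intro: test_function_dir_deriv)

lemma test_function_continuous_on: "test_function \<Omega> \<phi> \<Longrightarrow> continuous_on A \<phi>"
  unfolding test_function_def by (auto intro: smooth_continuous_on)

lemma test_function_borel_measurable: "test_function \<Omega> \<phi> \<Longrightarrow> \<phi> \<in> borel_measurable borel"
  unfolding test_function_def by (auto intro: smooth_borel_measurable)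

lemma test_function_bounded:
  assumes "test_function \<Omega> \<phi>" shows "\<exists>C. \<forall>x. \<bar>\<phi> x\<bar> \<le> C"
proof -
  obtain K where K: "compact K" "\<And>x. x \<notin> K \<Longrightarrow> \<phi> x = 0"
    using assms unfolding test_function_def by metis
  have "bounded (\<phi> ` K)"
    by (intro compact_imp_bounded compact_continuous_image test_function_continuous_on[OF assms] K)
  then obtain C where "\<And>x. x \<in> K \<Longrightarrow> \<bar>\<phi> x\<bar> \<le> C" by (auto simp: bounded_iff)
  then show ?thesis using K by (intro exI[of _ "max C 0"]) (metis abs_0 max.cobounded2 max.coboundedI1)
qed

lemma test_function_outside: "test_function \<Omega> \<phi> \<Longrightarrow> x \<notin> \<Omega> \<Longrightarrow> \<phi> x = 0"
  unfolding test_function_def by auto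

lemma test_function_primitive:
  fixes \<eta> :: "real \<Rightarrow> real"
  assumes \<eta>: "test_function {a<..<b} \<eta>" and 0: "(LINT s|lborel. \<eta> s) = 0"
  shows "\<exists>\<phi>. test_function {a<..<b} \<phi> \<and> dir_deriv 1 \<phi> = \<eta>"
proof (cases "a < b")
  case False
  then have "\<eta> = (\<lambda>x. 0)" using test_function_outside[OF \<eta>] by auto
  then show ?thesis
    by (intro exI[of _ "\<lambda>x. 0"]) (auto simp: test_function_def smooth_const dir_deriv_const)
next
  case ab: True
  obtain K where K: "compact K" "K \<subseteq> {a<..<b}" "\<And>x. x \<notin> K \<Longrightarrow> \<eta> x = 0"
    using \<eta> unfolding test_function_def by metis
  obtain c d where cd: "a < c" "c \<le> d" "d < b" "K \<subseteq> {c..d}"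
  proof (cases "K = {}")
    case True
    show ?thesis using that[of "(a+b)/2" "(a+b)/2"] ab True by auto
  next
    case False
    obtain c where c: "c \<in> K" "\<And>x. x \<in> K \<Longrightarrow> c \<le> x" using compact_attains_inf[OF K(1) False] by auto
    obtain d where d: "d \<in> K" "\<And>x. x \<in> K \<Longrightarrow> x \<le> d" using compact_attains_sup[OF K(1) False] by auto
    have "c \<le> d" using c d by auto
    then show ?thesis using that[of c d] c d K(2) by (auto simp: subset_iff)
  qed
  have \<eta>0: "\<eta> x = 0" if "x < c \<or> d < x" for x
    using that K(3)[of x] cd(4) by (meson atLeastAtMost_iff not_le subset_iff)
  have "continuous_on UNIV \<eta>" by (rule test_function_continuous_on[OF \<eta>])
  then obtain F where F: "\<And>x. (F has_vector_derivative \<eta> x) (at x)"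
    using einterval_antiderivative[of "-\<infinity>" \<infinity> \<eta>] by (auto simp: continuous_on_eq_continuous_at)
  then have F: "(F has_real_derivative \<eta> x) (at x)" for x
    by (simp add: has_real_derivative_iff_has_vector_derivative)
  have "(LINT s|lborel. \<eta> s * indicator {a..b} s) = F b - F a"
    using ab F test_function_continuous_on[OF \<eta>, of UNIV]
    by (intro integral_FTC_Icc_real) (auto simp: continuous_on_eq_continuous_at)
  moreover have "\<eta> s * indicator {a..b} s = \<eta> s" for s
    using test_function_outside[OF \<eta>, of s] by (auto split: split_indicator)
  ultimately have Fab: "F b = F a" using 0 by simp
  define \<phi> where "\<phi> x = F x - F a" for x
  define G where "G n = (case n of 0 \<Rightarrow> \<phi> | Suc n \<Rightarrow> (dir_deriv 1 ^^ n) \<eta>)" for n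
  have sm: "smooth ((dir_deriv 1 ^^ n) \<eta>)" for n
    by (induction n) (use \<eta> in \<open>auto intro: smooth_dir_deriv simp: test_function_def\<close>)
  have \<phi>': "(\<phi> has_real_derivative \<eta> x) (at x)" for x
    unfolding \<phi>_def using DERIV_diff[OF F DERIV_const] by simp
  have "smooth (G 0)"
  proof (rule smooth_real_sequence)
    fix n x show "(G n has_real_derivative G (Suc n) x) (at x)"
      using smooth_has_real_derivative[OF sm] \<phi>' by (cases n) (auto simp: G_def)
  qed
  then have "smooth \<phi>" by (simp add: G_def)
  have flat: "\<phi> x = \<phi> y" if xy: "x \<le> y" and z: "\<And>z. x < z \<Longrightarrow> z < y \<Longrightarrow> \<eta> z = 0" for x y
  proof (cases "x = y")
    case False
    then have "\<exists>z>x. z < y \<and> \<phi> y - \<phi> x = (y - x) * \<eta> z"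
      using xy \<phi>' by (intro MVT2) auto
    then show ?thesis using z by auto
  qed simp
  have "\<phi> x = 0" if "x \<notin> {c..d}" for x
  proof -
    have "\<phi> a = 0" "\<phi> b = 0" using Fab by (auto simp: \<phi>_def)
    then show ?thesis using that cd \<eta>0 flat[of x a] flat[of a x] flat[of x b] flat[of b x]
      by (smt (verit) atLeastAtMost_iff)
  qed
  then have "test_function {a<..<b} \<phi>"
    unfolding test_function_def using \<open>smooth \<phi>\<close> cd by (intro conjI exI[of _ "{c..d}"]) auto
  moreover have "dir_deriv 1 \<phi> = \<eta>"
    using dir_deriv_eqI[OF \<phi>'[unfolded has_field_derivative_def], of 1] by auto
  ultimately show ?thesis by blast
qed

section \<open>Absolutely continuous functions on the line\<close>

definition prim :: "(real \<Rightarrow> real) \<Rightarrow> real \<Rightarrow> real" where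
  "prim F x = (LINT s|lborel. (if s \<le> x then F s else 0))"

definition ac :: "(real \<Rightarrow> real) \<Rightarrow> (real \<Rightarrow> real) \<Rightarrow> real \<Rightarrow> bool" where
  "ac f F \<alpha> \<longleftrightarrow> integrable lborel F \<and> (\<forall>x. f x = \<alpha> + prim F x)"

lemma integrable_truncate:
  fixes F :: "real \<Rightarrow> real"
  assumes "integrable lborel F" shows "integrable lborel (\<lambda>s. if s \<le> x then F s else 0)"
proof -
  have "(\<lambda>s. if s \<le> x then F s else 0) = (\<lambda>s. indicator {..x} s *\<^sub>R F s)" by auto
  then show ?thesis using integrable_mult_indicator[of "{..x}" lborel F] assms by simp
qed

lemma prim_borel_measurable [measurable]:
  assumes [measurable]: "F \<in> borel_measurable borel"
  shows "prim F \<in> borel_measurable borel"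
  unfolding prim_def by measurable

lemma abs_prim_le:
  assumes "integrable lborel F" shows "\<bar>prim F x\<bar> \<le> (LINT s|lborel. \<bar>F s\<bar>)"
proof -
  have "\<bar>prim F x\<bar> \<le> (LINT s|lborel. \<bar>if s \<le> x then F s else 0\<bar>)"
    unfolding prim_def by (rule integral_abs_bound)
  also have "\<dots> \<le> (LINT s|lborel. \<bar>F s\<bar>)"
    by (rule integral_mono) (use assms integrable_truncate[OF assms] in auto)
  finally show ?thesis .
qed

lemma prim_cong_AE:
  assumes "AE s in lborel. F s = G s" "F \<in> borel_measurable borel" "G \<in> borel_measurable borel"
  shows "prim F x = prim G x"
  unfolding prim_def by (rule integral_cong_AE) (use assms in auto)

lemma prim_diff:
  "integrable lborel F \<Longrightarrow> integrable lborel G \<Longrightarrow> prim (\<lambda>s. F s - G s) x = prim F x - prim G x"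
  unfolding prim_def
  by (subst Bochner_Integration.integral_diff[symmetric]) (auto intro!: integrable_truncate Bochner_Integration.integral_cong)

lemma prim_le_support: "(\<And>s. s \<notin> {a<..<b} \<Longrightarrow> F s = 0) \<Longrightarrow> x \<le> a \<Longrightarrow> prim F x = 0"
  unfolding prim_def by (intro integral_eq_zero_AE always_eventually) auto

lemma prim_ge_support: "(\<And>s. s \<notin> {a<..<b} \<Longrightarrow> F s = 0) \<Longrightarrow> b \<le> x \<Longrightarrow> prim F x = (LINT s|lborel. F s)"
  unfolding prim_def by (intro Bochner_Integration.integral_cong) auto

lemma integrable_tensor:
  fixes F :: "'a::euclidean_space \<Rightarrow> real" and G :: "'b::euclidean_space \<Rightarrow> real"
  assumes F: "integrable lborel F" and G: "integrable lborel G"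
  shows "integrable lborel (\<lambda>(s, t). F s * G t)"
proof -
  have [measurable]: "F \<in> borel_measurable borel" "G \<in> borel_measurable borel" using F G by auto
  have "integrable (lborel \<Otimes>\<^sub>M lborel) (\<lambda>(s, t). F s * G t)"
    by (rule lborel_pair.Fubini_integrable) (use F G in \<open>auto simp: abs_mult\<close>)
  then show ?thesis by (simp add: lborel_prod)
qed

lemma integral_mult_prim:
  assumes F: "integrable lborel F" and G: "integrable lborel G"
  shows "(LINT s|lborel. F s * prim G s) + (LINT s|lborel. prim F s * G s)
    = (LINT s|lborel. F s) * (LINT s|lborel. G s)"
proof -
  have [measurable]: "F \<in> borel_measurable borel" "G \<in> borel_measurable borel" using F G by auto
  have FG: "integrable (lborel \<Otimes>\<^sub>M lborel) (\<lambda>(s, t). F s * G t)"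
    using integrable_tensor[OF F G] by (simp add: lborel_prod)
  have I1: "integrable (lborel \<Otimes>\<^sub>M lborel) (\<lambda>(s, t). if t \<le> s then F s * G t else 0)"
    by (rule Bochner_Integration.integrable_bound[OF FG]) auto
  have I2: "integrable (lborel \<Otimes>\<^sub>M lborel) (\<lambda>(s, t). if s \<le> t then F s * G t else 0)"
    by (rule Bochner_Integration.integrable_bound[OF FG]) auto
  let ?A = "\<lambda>s. LINT t|lborel. (if t \<le> s then F s * G t else 0)"
  let ?B = "\<lambda>s. LINT t|lborel. (if s \<le> t then F s * G t else 0)"
  have A: "F s * prim G s = ?A s" for s
  proof -
    have "?A s = (LINT t|lborel. F s * (if t \<le> s then G t else 0))"
      by (rule Bochner_Integration.integral_cong) auto
    then show ?thesis by (simp add: prim_def)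
  qed
  have "(LINT t|lborel. prim F t * G t) = (LINT t|lborel. LINT s|lborel. (if s \<le> t then F s * G t else 0))"
  proof (rule Bochner_Integration.integral_cong)
    fix t
    have "(LINT s|lborel. (if s \<le> t then F s * G t else 0)) = (LINT s|lborel. (if s \<le> t then F s else 0) * G t)"
      by (rule Bochner_Integration.integral_cong) auto
    then show "prim F t * G t = (LINT s|lborel. (if s \<le> t then F s * G t else 0))" by (simp add: prim_def)
  qed simp
  also have "\<dots> = (LINT s|lborel. ?B s)"
    by (rule lborel_pair.Fubini_integral[OF I2])
  finally have B: "(LINT t|lborel. prim F t * G t) = (LINT s|lborel. ?B s)" .
  have "?A s + ?B s = F s * (LINT t|lborel. G t)" for s
  proof -
    have i: "integrable lborel (\<lambda>t. F s * G t)" using G by simp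
    have "?A s + ?B s = (LINT t|lborel. (if t \<le> s then F s * G t else 0) + (if s \<le> t then F s * G t else 0))"
      by (subst Bochner_Integration.integral_add) (auto intro!: Bochner_Integration.integrable_bound[OF i])
    also have "\<dots> = (LINT t|lborel. F s * G t)"
    proof (rule integral_cong_AE)
      show "AE t in lborel. (if t \<le> s then F s * G t else 0) + (if s \<le> t then F s * G t else 0) = F s * G t"
        using AE_lborel_singleton[of s] by eventually_elim auto
    qed auto
    finally show ?thesis by simp
  qed
  moreover have "integrable lborel ?A" "integrable lborel ?B"
    using lborel_pair.integrable_fst'[OF I1] lborel_pair.integrable_fst'[OF I2] by simp_all
  ultimately show ?thesis
    unfolding A B by (subst Bochner_Integration.integral_add[symmetric]) auto
qed

lemma ac_integrable: "ac f F \<alpha> \<Longrightarrow> integrable lborel F"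
  by (simp add: ac_def)

lemma ac_borel_measurable: "ac f F \<alpha> \<Longrightarrow> f \<in> borel_measurable borel"
proof -
  assume "ac f F \<alpha>"
  then have "f = (\<lambda>x. \<alpha> + prim F x)" and [measurable]: "F \<in> borel_measurable borel" by (auto simp: ac_def)
  then show ?thesis by simp
qed

lemma ac_bounded: "ac f F \<alpha> \<Longrightarrow> \<bar>f x\<bar> \<le> \<bar>\<alpha>\<bar> + (LINT s|lborel. \<bar>F s\<bar>)"
  using abs_prim_le[of F x] unfolding ac_def by (smt (verit))

lemma integrable_mult_ac:
  assumes "integrable lborel G" "ac f F \<alpha>"
  shows "integrable lborel (\<lambda>s. f s * G s)"
proof (rule Bochner_Integration.integrable_bound)
  let ?C = "\<bar>\<alpha>\<bar> + (LINT s|lborel. \<bar>F s\<bar>)"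
  show "integrable lborel (\<lambda>s. ?C * \<bar>G s\<bar>)" using assms by simp
  show "(\<lambda>s. f s * G s) \<in> borel_measurable lborel" using assms ac_borel_measurable[OF assms(2)] by simp
  show "AE s in lborel. norm (f s * G s) \<le> norm (?C * \<bar>G s\<bar>)"
    using order_trans[OF ac_bounded[OF assms(2)] abs_ge_self] by (auto simp: abs_mult intro!: mult_right_mono)
qed

lemma ac_mult:
  assumes f: "ac f F \<alpha>" and g: "ac g G \<beta>"
  shows "ac (\<lambda>x. f x * g x) (\<lambda>x. F x * g x + f x * G x) (\<alpha> * \<beta>)"
  unfolding ac_def
proof (intro conjI allI)
  have F: "integrable lborel F" and G: "integrable lborel G" using f g by (auto simp: ac_def)
  have i: "integrable lborel (\<lambda>x. F x * g x)" "integrable lborel (\<lambda>x. f x * G x)"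
    using integrable_mult_ac[OF F g] integrable_mult_ac[OF G f] by (simp_all add: mult.commute)
  then show "integrable lborel (\<lambda>x. F x * g x + f x * G x)" by simp
  fix x
  define F' where "F' s = (if s \<le> x then F s else 0)" for s
  define G' where "G' s = (if s \<le> x then G s else 0)" for s
  have F': "integrable lborel F'" and G': "integrable lborel G'"
    unfolding F'_def G'_def by (auto intro!: integrable_truncate F G)
  have p: "prim F' s = prim F s" "prim G' s = prim G s" if "s \<le> x" for s
    using that unfolding prim_def F'_def G'_def by (auto intro!: Bochner_Integration.integral_cong)
  have int: "(LINT s|lborel. F' s) = prim F x" "(LINT s|lborel. G' s) = prim G x"
    by (simp_all add: F'_def G'_def prim_def)
  have ac': "ac (prim F') F' 0" "ac (prim G') G' 0" using F' G' by (auto simp: ac_def)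
  have i': "integrable lborel (\<lambda>s. F' s * prim G' s)" "integrable lborel (\<lambda>s. prim F' s * G' s)"
    using integrable_mult_ac[OF F' ac'(2)] integrable_mult_ac[OF G' ac'(1)] by (simp_all add: mult.commute)
  have "prim (\<lambda>x. F x * g x + f x * G x) x
     = (LINT s|lborel. (\<beta> * F' s + \<alpha> * G' s) + (F' s * prim G' s + prim F' s * G' s))"
    unfolding prim_def[of "\<lambda>x. F x * g x + f x * G x"]
    by (rule Bochner_Integration.integral_cong) (use f g p in \<open>auto simp: F'_def G'_def ac_def algebra_simps\<close>)
  also have "\<dots> = \<beta> * prim F x + \<alpha> * prim G x + prim F x * prim G x"
    using F' G' i' by (simp add: int integral_mult_prim[OF F' G'])
  finally show "f x * g x = \<alpha> * \<beta> + prim (\<lambda>x. F x * g x + f x * G x) x"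
    using f g by (simp add: ac_def algebra_simps)
qed

lemma ac_le_support: "ac f F \<alpha> \<Longrightarrow> (\<And>s. s \<notin> {a<..<b} \<Longrightarrow> F s = 0) \<Longrightarrow> x \<le> a \<Longrightarrow> f x = \<alpha>"
  using prim_le_support[of a b F x] by (simp add: ac_def)

lemma ac_ge_support:
  "ac f F \<alpha> \<Longrightarrow> (\<And>s. s \<notin> {a<..<b} \<Longrightarrow> F s = 0) \<Longrightarrow> b \<le> x \<Longrightarrow> f x = \<alpha> + (LINT s|lborel. F s)"
  using prim_ge_support[of a b F x] by (simp add: ac_def)

lemma ac_C1:
  assumes ab: "a \<le> b" and q: "\<And>x. a \<le> x \<Longrightarrow> x \<le> b \<Longrightarrow> (q has_real_derivative q' x) (at x)"
    and q': "continuous_on {a..b} q'"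
  shows "\<exists>p. ac p (\<lambda>x. if x \<in> {a<..<b} then q' x else 0) (q a) \<and> (\<forall>x\<in>{a..b}. p x = q x)"
proof (intro exI conjI ballI)
  let ?Q = "\<lambda>x. if x \<in> {a<..<b} then q' x else 0"
  have bi: "set_integrable lborel {a..b} q'" by (rule borel_integrable_atLeastAtMost'[OF q'])
  then have "integrable lborel (\<lambda>x. indicator {a<..<b} x *\<^sub>R (indicator {a..b} x *\<^sub>R q' x))"
    unfolding set_integrable_def by (rule integrable_mult_indicator[rotated]) auto
  moreover have "indicator {a<..<b} x *\<^sub>R (indicator {a..b} x *\<^sub>R q' x) = ?Q x" for x by (auto split: split_indicator)
  ultimately have i: "integrable lborel ?Q" by simp
  then show "ac (\<lambda>x. q a + prim ?Q x) ?Q (q a)" by (simp add: ac_def)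
  fix x assume x: "x \<in> {a..b}"
  have "(LINT s:{a..x}|lborel. q' s) = integral {a..x} q'"
    using x by (intro set_borel_integral_eq_integral set_integrable_subset[OF bi]) auto
  also have "\<dots> = q x - q a"
    using x q by (intro integral_unique fundamental_theorem_of_calculus)
      (auto simp: has_real_derivative_iff_has_vector_derivative intro: has_vector_derivative_at_within)
  also have "(LINT s:{a..x}|lborel. q' s) = prim ?Q x"
    unfolding prim_def set_lebesgue_integral_def
  proof (rule integral_cong_AE)
    show "(\<lambda>s. indicator {a..x} s *\<^sub>R q' s) \<in> borel_measurable lborel"
      using set_integrable_subset[OF bi, of "{a..x}"] x unfolding set_integrable_def by auto
    show "(\<lambda>s. if s \<le> x then ?Q s else 0) \<in> borel_measurable lborel"
      using integrable_truncate[OF i, of x] by (rule borel_measurable_integrable)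
    show "AE s in lborel. indicator {a..x} s *\<^sub>R q' s = (if s \<le> x then ?Q s else 0)"
      using AE_lborel_singleton[of a] AE_lborel_singleton[of b]
      by eventually_elim (use x in \<open>auto split: split_indicator\<close>)
  qed
  finally show "q a + prim ?Q x = q x" by simp
qed

text \<open>When \<open>F\<close> vanishes outside \<open>{a<..<b}\<close>, the boundary values of \<open>f\<close> are \<open>\<alpha>\<close> at \<open>a\<close>
  and \<open>\<alpha> + integral F\<close> at \<open>b\<close>.\<close>

lemma ac_integral_mult:
  assumes "ac f F \<alpha>" "ac g G \<beta>" "\<And>s. s \<notin> {a<..<b} \<Longrightarrow> F s = 0" "\<And>s. s \<notin> {a<..<b} \<Longrightarrow> G s = 0"
  shows "(LINT s|lborel. F s * g s + f s * G s) = (\<alpha> + (LINT s|lborel. F s)) * (\<beta> + (LINT s|lborel. G s)) - \<alpha> * \<beta>"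
proof -
  have "f (max a b) * g (max a b) = \<alpha> * \<beta> + (LINT s|lborel. F s * g s + f s * G s)"
    by (rule ac_ge_support[OF ac_mult[OF assms(1,2)], where a = a and b = b]) (use assms in auto)
  then show ?thesis
    using ac_ge_support[OF assms(1), of a b "max a b"] ac_ge_support[OF assms(2), of a b "max a b"] assms(3,4)
    by auto
qed

lemma ac_integral_deriv_mult_self:
  assumes f: "ac f F \<alpha>" and F: "\<And>s. s \<notin> {a<..<b} \<Longrightarrow> F s = 0" and b: "\<alpha> + (LINT s|lborel. F s) = 0"
  shows "(LINT s|lborel. F s * f s) \<le> 0"
proof -
  have "integrable lborel (\<lambda>s. F s * f s)"
    using integrable_mult_ac[OF ac_integrable[OF f] f] by (simp add: mult.commute)
  then have "2 * (LINT s|lborel. F s * f s) = (LINT s|lborel. F s * f s + f s * F s)"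
    by (simp add: mult.commute)
  also have "\<dots> = - (\<alpha> * \<alpha>)"
    using ac_integral_mult[OF f f F F] b by auto
  finally have "2 * (LINT s|lborel. F s * f s) = - (\<alpha> * \<alpha>)" .
  then show ?thesis using zero_le_square[of \<alpha>] by linarith
qed

lemma ac_integral_square_mult_deriv:
  assumes f: "ac f F 0" and F: "\<And>s. s \<notin> {a<..<b} \<Longrightarrow> F s = 0" and b: "(LINT s|lborel. F s) = 0"
  shows "(LINT s|lborel. f s * f s * F s) = 0"
proof -
  have "(LINT s|lborel. (F s * f s + f s * F s) * f s + (f s * f s) * F s) =
      (0 * 0 + (LINT s|lborel. F s * f s + f s * F s)) * (0 + (LINT s|lborel. F s)) - 0 * 0 * 0"
    by (rule ac_integral_mult[OF ac_mult[OF f f] f, where a = a and b = b]) (use F in auto)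
  also have "(\<lambda>s. (F s * f s + f s * F s) * f s + (f s * f s) * F s) = (\<lambda>s. 3 * (f s * f s * F s))"
    by (auto simp: algebra_simps)
  finally show ?thesis using b by simp
qed

lemma wirtinger:
  assumes L: "0 < L" and f: "ac f F 0" and F: "\<And>s. s \<notin> {0<..<L} \<Longrightarrow> F s = 0"
    and b: "(LINT s|lborel. F s) = 0" and F2: "integrable lborel (\<lambda>s. (F s)\<^sup>2)"
  shows "(pi / L)\<^sup>2 * (LINT s|lborel. (f s)\<^sup>2) \<le> (LINT s|lborel. (F s)\<^sup>2)"
proof -
  have f0: "f s = 0" if "s \<notin> {0<..<L}" for s
    using that ac_le_support[OF f F, of 0 L s] ac_ge_support[OF f F, of 0 L s] b by (cases "s \<le> 0") auto
  have fi: "integrable lborel f"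
  proof (rule Bochner_Integration.integrable_bound)
    let ?C = "LINT s|lborel. \<bar>F s\<bar>"
    show "integrable lborel (\<lambda>s. ?C * indicator {0<..<L} s)"
      by (use L in \<open>auto intro!: integrable_real_indicator simp: emeasure_lborel_Ioo\<close>)
    show "f \<in> borel_measurable lborel" using ac_borel_measurable[OF f] by simp
    show "AE s in lborel. norm (f s) \<le> norm (?C * indicator {0<..<L} s)"
      using order_trans[OF ac_bounded[OF f] abs_ge_self] f0 by (auto split: split_indicator)
  qed
  have f2: "integrable lborel (\<lambda>s. (f s)\<^sup>2)"
    using integrable_mult_ac[OF fi f] by (simp add: power2_eq_square)
  \<comment> \<open>Completing the square with the multiplier \<open>q = m tan (m (x - L/2))\<close>, which satisfies the
    Riccati equation \<open>q' = m\<^sup>2 + q\<^sup>2\<close> and is regular up to the boundary for \<open>m < pi / L\<close>.\<close>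
  have main: "m\<^sup>2 * (LINT s|lborel. (f s)\<^sup>2) \<le> (LINT s|lborel. (F s)\<^sup>2)" if m: "0 < m" "m < pi / L" for m
  proof -
    define q where "q x = m * tan (m * (x - L / 2))" for x
    define q' where "q' x = m\<^sup>2 + (q x)\<^sup>2" for x
    have cos: "cos (m * (x - L / 2)) \<noteq> 0" if x: "0 \<le> x" "x \<le> L" for x
    proof -
      have "\<bar>x - L / 2\<bar> \<le> L / 2" using x by (auto simp: abs_if)
      then have "\<bar>m * (x - L / 2)\<bar> \<le> m * (L / 2)"
        using m unfolding abs_mult by simp
      also have "\<dots> < pi / L * (L / 2)" using m L by (intro mult_strict_right_mono) auto
      also have "\<dots> = pi / 2" using L by simp
      finally have "0 < cos (m * (x - L / 2))" by (intro cos_gt_zero_pi) (simp_all only: abs_less_iff, linarith)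
      then show ?thesis by simp
    qed
    have dq: "(q has_real_derivative q' x) (at x)" if x: "0 \<le> x" "x \<le> L" for x
    proof -
      have "((\<lambda>x. m * tan (m * (x - L / 2))) has_real_derivative m * (inverse ((cos (m * (x - L / 2)))\<^sup>2) * m)) (at x)"
        by (rule derivative_eq_intros cos x refl | simp add: cos[OF x])+
      moreover have "m * (inverse ((cos (m * (x - L / 2)))\<^sup>2) * m) = q' x"
      proof -
        have "inverse ((cos (m * (x - L / 2)))\<^sup>2) = 1 + (tan (m * (x - L / 2)))\<^sup>2"
          using tan_sec[OF cos[OF x]] by (simp add: power_inverse)
        then show ?thesis unfolding q'_def q_def by (simp add: power2_eq_square algebra_simps)
      qed
      ultimately show ?thesis by (simp add: q_def[abs_def])
    qed
    have "continuous_on {0..L} q" using dq by (intro DERIV_continuous_on[of _ _ q']) (auto intro: DERIV_subset)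
    then have "continuous_on {0..L} q'" unfolding q'_def by (intro continuous_intros)
    then obtain p where p: "ac p (\<lambda>x. if x \<in> {0<..<L} then q' x else 0) (q 0)" and pq: "\<And>x. x \<in> {0..L} \<Longrightarrow> p x = q x"
      using ac_C1[of 0 L q q'] dq L by auto
    let ?Q = "\<lambda>x. if x \<in> {0<..<L} then q' x else 0"
    let ?H = "\<lambda>s. (F s * f s + f s * F s) * p s + (f s * f s) * ?Q s"
    have z: "(LINT s|lborel. ?H s) = (0 * 0 + (LINT s|lborel. F s * f s + f s * F s)) * (q 0 + (LINT s|lborel. ?Q s)) - 0 * 0 * q 0"
      by (rule ac_integral_mult[OF ac_mult[OF f f] p, where a = 0 and b = L]) (use F in auto)
    have z': "(LINT s|lborel. F s * f s + f s * F s) = 0"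
      using ac_integral_mult[OF f f F F] b by auto
    have Hi: "integrable lborel ?H" using ac_integrable[OF ac_mult[OF ac_mult[OF f f] p]] .
    have "0 \<le> (LINT s|lborel. (F s)\<^sup>2 - m\<^sup>2 * (f s)\<^sup>2 + ?H s)"
    proof (rule Bochner_Integration.integral_nonneg)
      fix s
      show "0 \<le> (F s)\<^sup>2 - m\<^sup>2 * (f s)\<^sup>2 + ?H s"
      proof (cases "s \<in> {0<..<L}")
        case True
        then have "(F s)\<^sup>2 - m\<^sup>2 * (f s)\<^sup>2 + ?H s = (F s + f s * q s)\<^sup>2"
          using pq[of s] by (simp add: q'_def power2_eq_square algebra_simps)
        then show ?thesis by simp
      next
        case False then show ?thesis using f0[of s] by auto
      qed
    qed
    also have "\<dots> = (LINT s|lborel. (F s)\<^sup>2) - m\<^sup>2 * (LINT s|lborel. (f s)\<^sup>2) + (LINT s|lborel. ?H s)"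
      using F2 f2 Hi by simp
    finally show ?thesis using z z' by simp
  qed
  have "((\<lambda>m. m\<^sup>2 * (LINT s|lborel. (f s)\<^sup>2)) \<longlongrightarrow> (pi / L)\<^sup>2 * (LINT s|lborel. (f s)\<^sup>2)) (at_left (pi / L))"
    by (intro tendsto_intros)
  moreover have "eventually (\<lambda>m. m\<^sup>2 * (LINT s|lborel. (f s)\<^sup>2) \<le> (LINT s|lborel. (F s)\<^sup>2)) (at_left (pi / L))"
    using eventually_at_left_real[of 0 "pi / L"] L by (auto elim!: eventually_mono intro: main)
  ultimately show ?thesis
    by (intro tendsto_upperbound) auto
qed

section \<open>Integration over products\<close>

lemma borel_measurable_fst [measurable (raw)]:
  fixes f :: "'c \<Rightarrow> 'a::{second_countable_topology} \<times> 'b::{second_countable_topology}"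
  shows "f \<in> borel_measurable M \<Longrightarrow> (\<lambda>x. fst (f x)) \<in> borel_measurable M"
  by (rule measurable_compose[OF _ borel_measurable_continuous_onI]) (auto intro: continuous_intros)

lemma borel_measurable_snd [measurable (raw)]:
  fixes f :: "'c \<Rightarrow> 'a::{second_countable_topology} \<times> 'b::{second_countable_topology}"
  shows "f \<in> borel_measurable M \<Longrightarrow> (\<lambda>x. snd (f x)) \<in> borel_measurable M"
  by (rule measurable_compose[OF _ borel_measurable_continuous_onI]) (auto intro: continuous_intros)

lemma
  fixes K :: "'a::euclidean_space \<times> 'b::euclidean_space \<Rightarrow> real"
  assumes K: "integrable lborel K"
  shows integral_fst_lborel: "(LINT x|lborel. LINT y|lborel. K (x, y)) = integral\<^sup>L lborel K"
    and integral_snd_lborel: "(LINT y|lborel. LINT x|lborel. K (x, y)) = integral\<^sup>L lborel K"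
    and integrable_fst_lborel: "integrable lborel (\<lambda>x. LINT y|lborel. K (x, y))"
    and integrable_snd_lborel: "integrable lborel (\<lambda>y. LINT x|lborel. K (x, y))"
    and AE_integrable_fst_lborel: "AE x in lborel. integrable lborel (\<lambda>y. K (x, y))"
    and AE_integrable_snd_lborel: "AE y in lborel. integrable lborel (\<lambda>x. K (x, y))"
proof -
  have K': "integrable (lborel \<Otimes>\<^sub>M lborel) (\<lambda>(x, y). K (x, y))" using K by (simp add: lborel_prod)
  show "(LINT x|lborel. LINT y|lborel. K (x, y)) = integral\<^sup>L lborel K"
    using lborel_pair.integral_fst'[OF K'] by (simp add: lborel_prod)
  show "(LINT y|lborel. LINT x|lborel. K (x, y)) = integral\<^sup>L lborel K"
    using lborel_pair.integral_snd[OF K'] by (simp add: lborel_prod)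
  show "integrable lborel (\<lambda>x. LINT y|lborel. K (x, y))" using lborel_pair.integrable_fst'[OF K'] by simp
  show "integrable lborel (\<lambda>y. LINT x|lborel. K (x, y))" using lborel_pair.integrable_snd[OF K'] by simp
  show "AE x in lborel. integrable lborel (\<lambda>y. K (x, y))" using lborel_pair.AE_integrable_fst'[OF K'] by simp
  show "AE y in lborel. integrable lborel (\<lambda>x. K (x, y))" using lborel_pair.AE_integrable_snd[OF K'] by simp
qed

lemma
  fixes K :: "'a::euclidean_space \<times> 'b::euclidean_space \<Rightarrow> real"
  shows integrable_swap_lborel: "integrable lborel K \<Longrightarrow> integrable lborel (\<lambda>p. K (prod.swap p))"
    and integral_swap_lborel: "K \<in> borel_measurable borel \<Longrightarrow> (LINT p|lborel. K (prod.swap p)) = integral\<^sup>L lborel K"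
proof -
  have s: "(\<lambda>p. K (prod.swap p)) = (\<lambda>(x, y). K (y, x))" by auto
  show "integrable lborel K \<Longrightarrow> integrable lborel (\<lambda>p. K (prod.swap p))"
    using lborel_pair.integrable_product_swap[of K] unfolding s by (simp add: lborel_prod)
  show "K \<in> borel_measurable borel \<Longrightarrow> (LINT p|lborel. K (prod.swap p)) = integral\<^sup>L lborel K"
    using lborel_pair.integral_product_swap[of K] unfolding s by (simp add: lborel_prod)
qed

lemma AE_swap_lborel:
  assumes "AE p in (lborel :: ('a::euclidean_space \<times> 'b::euclidean_space) measure). Q p"
  shows "AE p in lborel. Q (prod.swap p)"
proof -
  obtain N where N: "{p. \<not> Q p} \<subseteq> N" "N \<in> null_sets lborel"
    using assms by (auto elim!: AE_E simp: null_sets_def)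
  have "emeasure lborel {p. prod.swap p \<in> N} = emeasure lborel N"
  proof -
    have n: "N \<in> sets (lborel \<Otimes>\<^sub>M lborel)" unfolding lborel_prod using N by auto
    have "emeasure (lborel \<Otimes>\<^sub>M lborel) N = emeasure (distr (lborel \<Otimes>\<^sub>M lborel) (lborel \<Otimes>\<^sub>M lborel) (\<lambda>(x, y). (y, x))) N"
      using lborel_pair.distr_pair_swap by metis
    also have "\<dots> = emeasure (lborel \<Otimes>\<^sub>M lborel) ((\<lambda>(x, y). (y, x)) -` N \<inter> space (lborel \<Otimes>\<^sub>M lborel))"
      by (rule emeasure_distr) (use n in auto)
    also have "((\<lambda>(x, y). (y, x)) -` N \<inter> space (lborel \<Otimes>\<^sub>M lborel)) = {p :: 'b \<times> 'a. prod.swap p \<in> N}"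
      by (auto simp: space_pair_measure)
    finally show ?thesis by (simp add: lborel_prod)
  qed
  moreover have "{p. prod.swap p \<in> N} \<in> sets lborel"
  proof -
    have "prod.swap \<in> borel_measurable (borel :: ('b \<times> 'a) measure)"
      by (intro borel_measurable_continuous_onI continuous_on_swap)
    then have "prod.swap -` N \<inter> space borel \<in> sets (borel :: ('b \<times> 'a) measure)"
      by (rule measurable_sets) (use N in auto)
    then show ?thesis by (simp add: vimage_def)
  qed
  ultimately have "{p. prod.swap p \<in> N} \<in> null_sets lborel"
    using null_setsD1[OF N(2)] by (intro null_setsI) auto
  then show ?thesis by (rule AE_I') (use N in auto)
qed

lemma AE_snd_lborel:
  assumes "AE p in (lborel :: ('a::euclidean_space \<times> 'b::euclidean_space) measure). Q p"
  shows "AE y in lborel. AE x in lborel. Q (x, y)"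
proof -
  have "AE p in lborel \<Otimes>\<^sub>M lborel. Q (prod.swap p)" unfolding lborel_prod by (rule AE_swap_lborel[OF assms])
  from lborel_pair.AE_pair[OF this] show ?thesis by simp
qed

lemma AE_lborel_sndI:
  assumes "AE y in lborel. Q y"
  shows "AE p in (lborel :: ('a::euclidean_space \<times> 'b::euclidean_space) measure). Q (snd p)"
proof -
  obtain N where N: "{y. \<not> Q y} \<subseteq> N" "N \<in> null_sets lborel"
    using assms by (auto elim!: AE_E simp: null_sets_def)
  have "emeasure (lborel \<Otimes>\<^sub>M lborel) ((UNIV :: 'a set) \<times> N) = emeasure lborel (UNIV :: 'a set) * emeasure lborel N"
    using N by (intro lborel.emeasure_pair_measure_Times) auto
  then have "emeasure lborel ((UNIV :: 'a set) \<times> N) = 0" using null_setsD1[OF N(2)] by (simp add: lborel_prod)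
  moreover have "(UNIV :: 'a set) \<times> N \<in> sets (lborel \<Otimes>\<^sub>M lborel)" using N by (intro pair_measureI) auto
  ultimately have "(UNIV :: 'a set) \<times> N \<in> null_sets lborel" unfolding lborel_prod by auto
  then show ?thesis by (rule AE_I') (use N in auto)
qed

lemma integrable_mult_bounded:
  fixes K \<phi> :: "'a::euclidean_space \<Rightarrow> real"
  assumes "integrable lborel K" "\<phi> \<in> borel_measurable borel" "\<And>x. \<bar>\<phi> x\<bar> \<le> C"
  shows "integrable lborel (\<lambda>x. K x * \<phi> x)"
proof (rule Bochner_Integration.integrable_bound)
  show "integrable lborel (\<lambda>x. C * K x)" using assms by simp
  show "(\<lambda>x. K x * \<phi> x) \<in> borel_measurable lborel" using assms by simp
  have "\<bar>\<phi> x\<bar> * \<bar>K x\<bar> \<le> \<bar>C\<bar> * \<bar>K x\<bar>" for x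
    using order_trans[OF assms(3) abs_ge_self] by (intro mult_right_mono) auto
  then show "AE x in lborel. norm (K x * \<phi> x) \<le> norm (C * K x)"
    by (intro AE_I2) (simp add: abs_mult mult.commute)
qed

lemma integrable_mult_test_function:
  "integrable lborel K \<Longrightarrow> test_function \<Omega> \<phi> \<Longrightarrow> integrable lborel (\<lambda>x. K x * \<phi> x)"
  using test_function_bounded[of \<Omega> \<phi>] test_function_borel_measurable integrable_mult_bounded by blast

lemma integrable_mult_tensor_test_function:
  assumes "integrable lborel K" "test_function A \<phi>" "test_function B \<psi>"
  shows "integrable lborel (\<lambda>p. K p * (\<phi> (fst p) * \<psi> (snd p)))"
  using integrable_mult_test_function[OF assms(1) test_function_tensor[OF assms(2,3)]]
  by (simp add: split_def)

lemma test_function_integrable: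
  assumes \<phi>: "test_function (box a b) \<phi>" shows "integrable lborel \<phi>"
proof -
  have "integrable lborel (\<lambda>x. indicator (box a b) x * \<phi> x)"
    by (rule integrable_mult_test_function[OF _ \<phi>])
       (auto intro!: integrable_real_indicator emeasure_lborel_box_finite)
  moreover have "indicator (box a b) x * \<phi> x = \<phi> x" for x
    using test_function_outside[OF \<phi>] by (auto split: split_indicator)
  ultimately show ?thesis by simp
qed

section \<open>The fundamental lemma of the calculus of variations\<close>

lemma AE_eq_0_if_box_integrals_0:
  fixes h :: "'a::euclidean_space \<Rightarrow> real"
  assumes h: "integrable lborel h" and box: "\<And>a b. (LINT x|lborel. indicator (box a b) x * h x) = 0"
  shows "AE x in lborel. h x = 0"
proof -
  let ?E = "range (\<lambda>(a, b). box a b::'a set)"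
  have hi: "integrable lborel (\<lambda>x. indicator A x * h x)" if "A \<in> sets borel" for A
    using integrable_mult_indicator[of A lborel h] that h by simp
  have univ: "(LINT x|lborel. h x) = 0"
  proof -
    let ?B = "\<lambda>n::nat. box (- (real n *\<^sub>R One)) (real n *\<^sub>R One) :: 'a set"
    have "(\<lambda>n. LINT x|lborel. indicator (?B n) x * h x) \<longlonglongrightarrow> (LINT x|lborel. h x)"
    proof (rule integral_dominated_convergence[where w = "\<lambda>x. \<bar>h x\<bar>"])
      show "AE x in lborel. (\<lambda>n. indicator (?B n) x * h x) \<longlonglongrightarrow> h x"
      proof (rule AE_I2)
        fix x
        obtain N where N: "x \<in> ?B N" using UN_box_eq_UNIV by blast
        have "x \<in> ?B n" if "n \<ge> N" for n
        proof -
          have "?B N \<subseteq> ?B n" using that by (intro subset_box_imp) (auto simp: inner_simps)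
          then show ?thesis using N by auto
        qed
        then have "eventually (\<lambda>n. h x = indicator (?B n) x * h x) sequentially"
          by (auto simp: eventually_sequentially intro!: exI[of _ N])
        then show "(\<lambda>n. indicator (?B n) x * h x) \<longlonglongrightarrow> h x" by (rule Lim_transform_eventually[rotated]) simp
      qed
    qed (use h in \<open>auto split: split_indicator\<close>)
    then show ?thesis by (simp add: box LIMSEQ_const_iff)
  qed
  have "(LINT x|lborel. indicator A x * h x) = 0" if "A \<in> sets borel" for A
  proof -
    have "Int_stable ?E" by (auto simp: Int_stable_def box_Int_box)
    moreover have "?E \<subseteq> Pow UNIV" by auto
    moreover have "A \<in> sigma_sets UNIV ?E" using that by (simp add: borel_eq_box)
    ultimately show ?thesis
    proof (induction rule: sigma_sets_induct_disjoint)
      case (basic A) then show ?case using box by auto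
    next
      case empty then show ?case by simp
    next
      case (compl A)
      then have A: "A \<in> sets borel" by (simp add: borel_eq_box)
      have "(LINT x|lborel. indicator (UNIV - A) x * h x) = (LINT x|lborel. h x - indicator A x * h x)"
        by (rule Bochner_Integration.integral_cong) (auto split: split_indicator)
      then show ?case using h hi[OF A] compl univ by simp
    next
      case (union A)
      then have A: "\<And>i. A i \<in> sets lborel" by (simp add: borel_eq_box image_subset_iff)
      have "(LINT x:(\<Union>i. A i)|lborel. h x) = (\<Sum>i. LINT x:A i|lborel. h x)"
        by (rule lebesgue_integral_countable_add)
           (use A union h hi in \<open>auto simp: set_integrable_def disjoint_family_on_def disjnt_def\<close>)
      then show ?case using union by (simp add: set_lebesgue_integral_def)
    qed
  qed
  then show ?thesis
    by (intro sigma_finite_measure.density_zero[OF sigma_finite_lborel h]) (simp add: set_lebesgue_integral_def)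
qed

lemma fundamental_lemma:
  fixes h :: "'a::euclidean_space \<times> 'b::euclidean_space \<Rightarrow> real"
  assumes h: "integrable lborel h" and h0: "\<And>p. p \<notin> box a b \<times> box c d \<Longrightarrow> h p = 0"
    and test: "\<And>\<phi> \<psi>. test_function (box a b) \<phi> \<Longrightarrow> test_function (box c d) \<psi> \<Longrightarrow>
      (LINT p|lborel. h p * (\<phi> (fst p) * \<psi> (snd p))) = 0"
  shows "AE p in lborel. h p = 0"
proof (rule AE_eq_0_if_box_integrals_0[OF h])
  fix x y :: "'a \<times> 'b"
  obtain a' b' where ab: "box (fst x) (fst y) \<inter> box a b = box a' b'" by (auto simp: box_Int_box)
  obtain c' d' where cd: "box (snd x) (snd y) \<inter> box c d = box c' d'" by (auto simp: box_Int_box)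
  have hm[measurable]: "h \<in> borel_measurable borel" using h by auto
  have "(\<lambda>n. LINT p|lborel. h p * (box_bump n a' b' (fst p) * box_bump n c' d' (snd p)))
      \<longlonglongrightarrow> (LINT p|lborel. h p * (indicator (box a' b') (fst p) * indicator (box c' d') (snd p)))"
  proof (rule integral_dominated_convergence[where w = "\<lambda>x. \<bar>h x\<bar>"])
    have [measurable]: "box_bump n x y \<in> borel_measurable borel" for n and x y :: 'a
      by (rule smooth_borel_measurable[OF smooth_box_bump])
    have [measurable]: "box_bump n x y \<in> borel_measurable borel" for n and x y :: 'b
      by (rule smooth_borel_measurable[OF smooth_box_bump])
    show "(\<lambda>p. h p * (indicator (box a' b') (fst p) * indicator (box c' d') (snd p))) \<in> borel_measurable lborel"
      by measurable
    show "(\<lambda>p. h p * (box_bump n a' b' (fst p) * box_bump n c' d' (snd p))) \<in> borel_measurable lborel" for n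
      by measurable
    show "AE p in lborel. (\<lambda>n. h p * (box_bump n a' b' (fst p) * box_bump n c' d' (snd p)))
       \<longlonglongrightarrow> h p * (indicator (box a' b') (fst p) * indicator (box c' d') (snd p))"
      by (intro AE_I2 tendsto_mult tendsto_const box_bump_tendsto)
    show "AE p in lborel. norm (h p * (box_bump n a' b' (fst p) * box_bump n c' d' (snd p))) \<le> \<bar>h p\<bar>" for n
      by (auto simp: abs_mult abs_of_nonneg box_bump_bounds intro!: mult_left_le mult_le_one)
  qed (use h in auto)
  moreover have "(LINT p|lborel. h p * (box_bump n a' b' (fst p) * box_bump n c' d' (snd p))) = 0" for n
    using ab cd by (intro test test_function_box_bump) auto
  ultimately have "(LINT p|lborel. h p * (indicator (box a' b') (fst p) * indicator (box c' d') (snd p))) = 0"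
    by (simp add: LIMSEQ_const_iff)
  moreover have "h p * (indicator (box a' b') (fst p) * indicator (box c' d') (snd p)) = indicator (box x y) p * h p" for p
    using h0[of p] unfolding ab[symmetric] cd[symmetric] box_prod[of x y]
    by (cases p) (auto split: split_indicator)
  ultimately show "(LINT p|lborel. indicator (box x y) p * h p) = 0" by simp
qed

lemma test_function_integral_1:
  assumes "0 < (L::real)"
  shows "\<exists>k. test_function {0<..<L} k \<and> (LINT s|lborel. k s) = 1"
proof -
  have "(\<lambda>n. LINT s|lborel. box_bump n 0 L s) \<longlonglongrightarrow> (LINT s|lborel. indicator (box 0 L) s)"
  proof (rule integral_dominated_convergence[where w = "indicator (box 0 L)"])
    show "AE s in lborel. norm (box_bump n 0 L s) \<le> indicator (box 0 L) s" for n
      using test_function_outside[OF test_function_box_bump[OF order_refl], of _ 0 L n] box_bump_bounds[of n 0 L]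
      by (auto split: split_indicator)
    show "AE s in lborel. (\<lambda>n. box_bump n 0 L s) \<longlonglongrightarrow> indicator (box 0 L) s"
      by (intro AE_I2 box_bump_tendsto)
    show "integrable lborel (indicator (box 0 L) :: real \<Rightarrow> real)"
      by (intro integrable_real_indicator emeasure_lborel_box_finite) auto
  qed (use smooth_borel_measurable[OF smooth_box_bump] in auto)
  moreover have "(LINT s|lborel. indicator (box 0 L) s) = L" using assms by simp
  ultimately have "eventually (\<lambda>n. (LINT s|lborel. box_bump n 0 L s) > 0) sequentially"
    using assms by (intro order_tendstoD(1)) auto
  then obtain n where n: "(LINT s|lborel. box_bump n 0 L s) > 0" by (auto simp: eventually_sequentially)
  let ?m = "LINT s|lborel. box_bump n 0 L s"
  have t: "test_function {0<..<L} (box_bump n 0 L)" by (intro test_function_box_bump) simp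
  then have "test_function {0<..<L} (\<lambda>s. 1 / ?m * box_bump n 0 L s)"
    unfolding test_function_def using smooth_mult[OF smooth_const] by (metis mult_zero_right)
  then show ?thesis using n by (intro exI[of _ "\<lambda>s. 1 / ?m * box_bump n 0 L s"]) auto
qed

lemma test_function_diff_cmult:
  assumes "test_function \<Omega> f" "test_function \<Omega> g"
  shows "test_function \<Omega> (\<lambda>x. f x - c * g x)"
proof -
  obtain K K' where "compact K" "K \<subseteq> \<Omega>" "\<And>x. x \<notin> K \<Longrightarrow> f x = 0"
    and "compact K'" "K' \<subseteq> \<Omega>" "\<And>x. x \<notin> K' \<Longrightarrow> g x = 0"
    using assms unfolding test_function_def by metis
  moreover have "smooth (\<lambda>x. f x + (- c) * g x)"
    using assms by (intro smooth_add smooth_mult smooth_const) (auto simp: test_function_def)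
  ultimately show ?thesis unfolding test_function_def
    by (intro conjI exI[of _ "K \<union> K'"]) auto
qed

lemma ac_test_function:
  assumes L: "0 \<le> L" and \<phi>: "test_function {0<..<L} \<phi>"
  shows "ac \<phi> (dir_deriv 1 \<phi>) 0"
proof -
  have s: "smooth \<phi>" using \<phi> by (simp add: test_function_def)
  have z: "\<phi> x = 0" "dir_deriv 1 \<phi> x = 0" if "x \<notin> {0<..<L}" for x
    using that test_function_outside[OF \<phi>] test_function_outside[OF test_function_dir_deriv[OF \<phi>]] by auto
  obtain p where p: "ac p (\<lambda>x. if x \<in> {0<..<L} then dir_deriv 1 \<phi> x else 0) (\<phi> 0)" "\<And>x. x \<in> {0..L} \<Longrightarrow> p x = \<phi> x"
    using ac_C1[OF L smooth_has_real_derivative[OF s] smooth_continuous_on[OF smooth_dir_deriv[OF s]]] by blast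
  have d: "(\<lambda>x. if x \<in> {0<..<L} then dir_deriv 1 \<phi> x else 0) = dir_deriv 1 \<phi>" using z(2) by auto
  have p': "ac p (dir_deriv 1 \<phi>) 0" using p(1) z(1)[of 0] unfolding d by simp
  have "p x = \<phi> x" for x
  proof -
    consider "x \<le> 0" | "x \<in> {0..L}" | "L \<le> x" by fastforce
    then show ?thesis
    proof cases
      case 1 then show ?thesis using ac_le_support[OF p' z(2), of 0 L x] z(1)[of x] by auto
    next
      case 3
      then have "p x = p L" using ac_ge_support[OF p' z(2), of 0 L] by auto
      then show ?thesis using 3 p(2)[of L] L z(1)[of L] z(1)[of x] by auto
    qed (use p in auto)
  qed
  then have "p = \<phi>" by auto
  then show ?thesis using p' by simp
qed

lemma integrable_prim_slices:
  fixes K :: "real \<times> 'b::euclidean_space \<Rightarrow> real" and L :: real and z :: "real \<Rightarrow> real"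
  assumes L: "0 < L" and K: "integrable lborel K" and z[measurable]: "z \<in> borel_measurable borel"
  shows "integrable lborel (\<lambda>p. indicator {0<..<L} (fst p) * prim (\<lambda>r. K (r, snd p)) (z (fst p)))"
proof (rule Bochner_Integration.integrable_bound)
  have [measurable]: "K \<in> borel_measurable borel" using K by auto
  have "integrable lborel (indicator {0<..<L} :: real \<Rightarrow> real)"
    by (rule integrable_real_indicator) (use L in auto)
  then show "integrable lborel (\<lambda>(s, q). indicator {0<..<L} s * (LINT r|lborel. \<bar>K (r, q)\<bar>))"
    by (rule integrable_tensor) (use K integrable_snd_lborel[of "\<lambda>p. \<bar>K p\<bar>"] in auto)
  have "(\<lambda>p. indicator {0<..<L} (fst p) * prim (\<lambda>r. K (r, snd p)) (z (fst p))) \<in> borel_measurable borel"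
    unfolding prim_def borel_prod[symmetric] by measurable
  then show "(\<lambda>p. indicator {0<..<L} (fst p) * prim (\<lambda>r. K (r, snd p)) (z (fst p))) \<in> borel_measurable lborel"
    by simp
  have "AE p in lborel. integrable lborel (\<lambda>r. K (r, snd p))"
    by (rule AE_lborel_sndI[OF AE_integrable_snd_lborel[OF K]])
  then show "AE p in lborel. norm (indicator {0<..<L} (fst p) * prim (\<lambda>r. K (r, snd p)) (z (fst p)))
      \<le> norm (case p of (s, q) \<Rightarrow> indicator {0<..<L} s * (LINT r|lborel. \<bar>K (r, q)\<bar>))"
    by eventually_elim (auto simp: split_def abs_mult intro!: mult_left_mono abs_prim_le)
qed

text \<open>Du Bois-Reymond's argument: after subtracting a primitive of \<open>g\<close>, the function \<open>f\<close> has weak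
  derivative zero in the first variable, hence does not depend on it.\<close>

lemma weak_derivative_imp_ac:
  fixes f g :: "real \<times> 'b::euclidean_space \<Rightarrow> real"
  assumes L: "0 < L" and f: "integrable lborel f" and g: "integrable lborel g"
    and f0: "\<And>p. p \<notin> {0<..<L} \<times> box c d \<Longrightarrow> f p = 0" and g0: "\<And>p. p \<notin> {0<..<L} \<times> box c d \<Longrightarrow> g p = 0"
    and wd: "\<And>\<phi> \<psi>. test_function {0<..<L} \<phi> \<Longrightarrow> test_function (box c d) \<psi> \<Longrightarrow>
      (LINT p|lborel. f p * (dir_deriv 1 \<phi> (fst p) * \<psi> (snd p))) = - (LINT p|lborel. g p * (\<phi> (fst p) * \<psi> (snd p)))"
  shows "\<exists>C. integrable lborel C \<and>
    (AE p in lborel. fst p \<in> {0<..<L} \<longrightarrow> f p = C (snd p) + prim (\<lambda>r. g (r, snd p)) (fst p))"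
proof -
  have [measurable]: "f \<in> borel_measurable borel" "g \<in> borel_measurable borel" using f g by auto
  obtain k where k: "test_function {0<..<L} k" and k1: "(LINT s|lborel. k s) = 1"
    using test_function_integral_1[OF L] by auto
  have [measurable]: "k \<in> borel_measurable borel" by (rule test_function_borel_measurable[OF k])
  define P where "P p = indicator {0<..<L} (fst p) * prim (\<lambda>r. g (r, snd p)) (fst p)" for p
  have P: "integrable lborel P"
    unfolding P_def using integrable_prim_slices[OF L g, of "\<lambda>x. x"] by simp
  define F where "F p = f p - P p" for p
  have F: "integrable lborel F" unfolding F_def using f P by auto
  have F0: "F p = 0" if "p \<notin> {0<..<L} \<times> box c d" for p
  proof (cases "snd p \<in> box c d")
    case False
    then have "(\<lambda>r. g (r, snd p)) = (\<lambda>r. 0)" using g0 by auto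
    then show ?thesis using that f0[of p] by (simp add: F_def P_def prim_def)
  next
    case True
    then show ?thesis using that f0[of p] by (cases p) (auto simp: F_def P_def)
  qed
  define C where "C q = (LINT s|lborel. F (s, q) * k s)" for q
  obtain M where M: "\<And>s. \<bar>k s\<bar> \<le> M" using test_function_bounded[OF k] by auto
  have Fk: "integrable lborel (\<lambda>p. F p * k (fst p))"
    by (rule integrable_mult_bounded[OF F _ M]) simp
  have C: "integrable lborel C" unfolding C_def using integrable_snd_lborel[OF Fk] by simp
  have C0: "C q = 0" if "q \<notin> box c d" for q using that F0 by (simp add: C_def)
  define I :: "real \<Rightarrow> real" where "I s = indicator {0<..<L} s" for s
  define h where "h p = F p - I (fst p) * C (snd p)" for p
  have IC: "integrable lborel (\<lambda>p. I (fst p) * C (snd p))"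
    using integrable_tensor[of I C] C L by (simp add: I_def[abs_def] split_def)
  have h: "integrable lborel h" unfolding h_def using F IC by auto
  have Ftest: "(LINT p|lborel. F p * (dir_deriv 1 \<phi> (fst p) * \<psi> (snd p))) = 0"
    if \<phi>: "test_function {0<..<L} \<phi>" and \<psi>: "test_function (box c d) \<psi>" for \<phi> \<psi>
  proof -
    note \<phi>' = test_function_dir_deriv[OF \<phi>, of 1]
    have Pi: "integrable lborel (\<lambda>p. P p * (dir_deriv 1 \<phi> (fst p) * \<psi> (snd p)))"
      by (rule integrable_mult_tensor_test_function[OF P \<phi>' \<psi>])
    have gi: "integrable lborel (\<lambda>p. g p * (\<phi> (fst p) * \<psi> (snd p)))"
      by (rule integrable_mult_tensor_test_function[OF g \<phi> \<psi>])
    have "(LINT p|lborel. P p * (dir_deriv 1 \<phi> (fst p) * \<psi> (snd p))) + (LINT p|lborel. g p * (\<phi> (fst p) * \<psi> (snd p)))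
      = (LINT p|lborel. P p * (dir_deriv 1 \<phi> (fst p) * \<psi> (snd p)) + g p * (\<phi> (fst p) * \<psi> (snd p)))"
      using Pi gi by simp
    also have "\<dots> = (LINT q|lborel. LINT s|lborel. P (s, q) * (dir_deriv 1 \<phi> s * \<psi> q) + g (s, q) * (\<phi> s * \<psi> q))"
      using integral_snd_lborel[OF Bochner_Integration.integrable_add[OF Pi gi]] by simp
    also have "\<dots> = 0"
    proof (rule integral_eq_zero_AE)
      show "AE q in lborel. (LINT s|lborel. P (s, q) * (dir_deriv 1 \<phi> s * \<psi> q) + g (s, q) * (\<phi> s * \<psi> q)) = 0"
        using AE_integrable_snd_lborel[OF g]
      proof eventually_elim
        fix q assume q: "integrable lborel (\<lambda>s. g (s, q))"
        have "ac (prim (\<lambda>s. g (s, q))) (\<lambda>s. g (s, q)) 0" using q by (simp add: ac_def)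
        note ibp = ac_integral_mult[OF this ac_test_function[OF less_imp_le[OF L] \<phi>], of 0 L]
        have "g (s, q) = 0" if "s \<notin> {0<..<L}" for s using that by (intro g0) auto
        moreover have "dir_deriv 1 \<phi> s = 0" if "s \<notin> {0<..<L}" for s using test_function_outside[OF \<phi>' that] .
        ultimately have "(LINT s|lborel. g (s, q) * \<phi> s + prim (\<lambda>s. g (s, q)) s * dir_deriv 1 \<phi> s) =
            (LINT s|lborel. g (s, q)) * (LINT s|lborel. dir_deriv 1 \<phi> s)"
          using ibp by simp
        also have "(LINT s|lborel. dir_deriv 1 \<phi> s) = 0"
          using ac_ge_support[OF ac_test_function[OF less_imp_le[OF L] \<phi>], of 0 L L]
            test_function_outside[OF \<phi>'] test_function_outside[OF \<phi>, of L] by auto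
        finally have "(LINT s|lborel. \<psi> q * (g (s, q) * \<phi> s + prim (\<lambda>s. g (s, q)) s * dir_deriv 1 \<phi> s)) = 0" by simp
        also have "(\<lambda>s. \<psi> q * (g (s, q) * \<phi> s + prim (\<lambda>s. g (s, q)) s * dir_deriv 1 \<phi> s))
          = (\<lambda>s. P (s, q) * (dir_deriv 1 \<phi> s * \<psi> q) + g (s, q) * (\<phi> s * \<psi> q))"
          using test_function_outside[OF \<phi>'] by (auto simp: P_def algebra_simps split: split_indicator)
        finally show "(LINT s|lborel. P (s, q) * (dir_deriv 1 \<phi> s * \<psi> q) + g (s, q) * (\<phi> s * \<psi> q)) = 0" .
      qed
    qed
    finally have "(LINT p|lborel. P p * (dir_deriv 1 \<phi> (fst p) * \<psi> (snd p))) = - (LINT p|lborel. g p * (\<phi> (fst p) * \<psi> (snd p)))"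
      by linarith
    then show ?thesis using wd[OF \<phi> \<psi>] Pi integrable_mult_tensor_test_function[OF f \<phi>' \<psi>]
      by (simp add: F_def left_diff_distrib)
  qed
  have "AE p in lborel. h p = 0"
  proof (rule fundamental_lemma[OF h])
    show "h p = 0" if "p \<notin> box 0 L \<times> box c d" for p
      using that F0[of p] C0[of "snd p"] by (cases p) (auto simp: h_def I_def)
    fix \<eta> \<psi> assume \<eta>: "test_function (box 0 L) \<eta>" and \<psi>: "test_function (box c d) \<psi>"
    have \<eta>': "test_function {0<..<L} \<eta>" using \<eta> by simp
    let ?m = "LINT s|lborel. \<eta> s"
    have t: "test_function {0<..<L} (\<lambda>s. \<eta> s - ?m * k s)" by (rule test_function_diff_cmult[OF \<eta>' k])
    have ki: "integrable lborel k" and \<eta>i: "integrable lborel \<eta>"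
      using test_function_integrable[of 0 L k] k test_function_integrable[OF \<eta>] by auto
    have "(LINT s|lborel. \<eta> s - ?m * k s) = 0" using ki \<eta>i k1 by simp
    then obtain \<phi> where \<phi>: "test_function {0<..<L} \<phi>" "dir_deriv 1 \<phi> = (\<lambda>s. \<eta> s - ?m * k s)"
      using test_function_primitive[OF t] by auto
    have Fi: "integrable lborel (\<lambda>p. F p * (\<eta> (fst p) * \<psi> (snd p)))"
      by (rule integrable_mult_tensor_test_function[OF F \<eta> \<psi>])
    have ICi: "integrable lborel (\<lambda>p. (I (fst p) * C (snd p)) * (\<eta> (fst p) * \<psi> (snd p)))"
      by (rule integrable_mult_tensor_test_function[OF IC \<eta> \<psi>])
    have Fki: "integrable lborel (\<lambda>p. F p * (k (fst p) * \<psi> (snd p)))"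
      by (rule integrable_mult_tensor_test_function[OF F k \<psi>])
    have "0 = (LINT p|lborel. F p * ((\<eta> (fst p) - ?m * k (fst p)) * \<psi> (snd p)))"
      using Ftest[OF \<phi>(1) \<psi>] unfolding \<phi>(2) by simp
    also have "\<dots> = (LINT p|lborel. F p * (\<eta> (fst p) * \<psi> (snd p)) - ?m * (F p * (k (fst p) * \<psi> (snd p))))"
      by (simp add: algebra_simps)
    also have "\<dots> = (LINT p|lborel. F p * (\<eta> (fst p) * \<psi> (snd p))) - ?m * (LINT p|lborel. F p * (k (fst p) * \<psi> (snd p)))"
      using Fi Fki by simp
    finally have 1: "(LINT p|lborel. F p * (\<eta> (fst p) * \<psi> (snd p))) = ?m * (LINT p|lborel. F p * (k (fst p) * \<psi> (snd p)))"
      by simp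
    have 2: "(LINT p|lborel. F p * (k (fst p) * \<psi> (snd p))) = (LINT q|lborel. C q * \<psi> q)"
      unfolding integral_snd_lborel[OF Fki, symmetric] C_def by (simp add: mult.assoc[symmetric])
    have "(LINT p|lborel. (I (fst p) * C (snd p)) * (\<eta> (fst p) * \<psi> (snd p)))
        = (LINT q|lborel. LINT s|lborel. (C q * \<psi> q) * \<eta> s)"
      unfolding integral_snd_lborel[OF ICi, symmetric]
      by (intro Bochner_Integration.integral_cong) (use test_function_outside[OF \<eta>'] in \<open>auto simp: I_def split: split_indicator\<close>)
    also have "\<dots> = ?m * (LINT q|lborel. C q * \<psi> q)" by simp
    finally show "(LINT p|lborel. h p * (\<eta> (fst p) * \<psi> (snd p))) = 0"
      using 1 2 Fi ICi by (simp add: h_def left_diff_distrib)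
  qed
  then have "AE p in lborel. fst p \<in> {0<..<L} \<longrightarrow> f p = C (snd p) + prim (\<lambda>r. g (r, snd p)) (fst p)"
    by eventually_elim (auto simp: h_def F_def P_def I_def)
  then show ?thesis using C by blast
qed

section \<open>Borel versions\<close>

text \<open>\<open>borel_version \<Omega> f F\<close> trades a class of functions on \<open>\<Omega>\<close> for a Borel function on the
  whole space, so that Fubini's theorem for \<open>lborel\<close> applies.\<close>

definition borel_version :: "'a::euclidean_space set \<Rightarrow> ('a \<Rightarrow> real) \<Rightarrow> ('a \<Rightarrow> real) \<Rightarrow> bool" where
  "borel_version \<Omega> f F \<longleftrightarrow>
     F \<in> borel_measurable borel \<and> (\<forall>x. x \<notin> \<Omega> \<longrightarrow> F x = 0) \<and> (AE x in lborel. x \<in> \<Omega> \<longrightarrow> F x = f x)"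

lemma borel_measurable_lebesgue_AE:
  fixes f g :: "'a::euclidean_space \<Rightarrow> real"
  assumes g: "g \<in> borel_measurable borel" and fg: "AE x in lborel. f x = g x"
  shows "f \<in> borel_measurable lebesgue"
proof (rule measurableI)
  fix A :: "real set" assume A: "A \<in> sets borel"
  have "f -` A \<in> sets lebesgue"
  proof (rule completion.in_sets_AE)
    show "AE x in lebesgue. (x \<in> g -` A) = (x \<in> f -` A)"
      unfolding AE_completion_iff using fg by eventually_elim auto
    show "g -` A \<in> sets lebesgue" using measurable_sets[OF g A] by simp
  qed simp
  then show "f -` A \<inter> space lebesgue \<in> sets lebesgue" by simp
qed simp

lemma borel_version_borel_measurable: "borel_version \<Omega> f F \<Longrightarrow> F \<in> borel_measurable borel"
  by (simp add: borel_version_def)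

lemma borel_version_outside: "borel_version \<Omega> f F \<Longrightarrow> x \<notin> \<Omega> \<Longrightarrow> F x = 0"
  by (simp add: borel_version_def)

lemma borel_version_AE: "borel_version \<Omega> f F \<Longrightarrow> AE x in lborel. x \<in> \<Omega> \<longrightarrow> F x = f x"
  by (simp add: borel_version_def)

lemma borel_version_exists:
  fixes f :: "'a::euclidean_space \<Rightarrow> real"
  assumes \<Omega>: "\<Omega> \<in> sets borel" and f: "set_borel_measurable lebesgue \<Omega> f"
  shows "\<exists>F. borel_version \<Omega> f F"
proof -
  obtain g where g: "g \<in> borel_measurable lborel" "AE x in lborel. indicator \<Omega> x *\<^sub>R f x = g x"
    using completion_ex_borel_measurable_real[of "\<lambda>x. indicator \<Omega> x *\<^sub>R f x" lborel] f
    unfolding set_borel_measurable_def by auto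
  have "borel_version \<Omega> f (\<lambda>x. indicator \<Omega> x * g x)"
    unfolding borel_version_def
  proof (intro conjI)
    show "(\<lambda>x. indicator \<Omega> x * g x) \<in> borel_measurable borel" using g \<Omega> by simp
    show "AE x in lborel. x \<in> \<Omega> \<longrightarrow> indicator \<Omega> x * g x = f x"
      using g(2) by eventually_elim auto
  qed simp
  then show ?thesis by blast
qed

lemma borel_version_AE_indicator:
  "borel_version \<Omega> f F \<Longrightarrow> AE x in lborel. indicator \<Omega> x *\<^sub>R f x = F x"
  using borel_version_AE[of \<Omega> f F] by (auto simp: borel_version_outside elim!: eventually_mono split: split_indicator)

lemma borel_version_set_borel_measurable:
  "borel_version \<Omega> f F \<Longrightarrow> set_borel_measurable lebesgue \<Omega> f"
  unfolding set_borel_measurable_def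
  by (rule borel_measurable_lebesgue_AE[OF borel_version_borel_measurable borel_version_AE_indicator])

lemma borel_version_integral:
  assumes "borel_version \<Omega> f F" shows "(LINT x:\<Omega>|lebesgue. f x) = (LINT x|lborel. F x)"
proof -
  have F: "F \<in> borel_measurable lborel" using assms by (simp add: borel_version_def)
  have "(LINT x:\<Omega>|lebesgue. f x) = (LINT x|lebesgue. F x)"
    unfolding set_lebesgue_integral_def
  proof (rule integral_cong_AE)
    show "(\<lambda>x. indicator \<Omega> x *\<^sub>R f x) \<in> borel_measurable lebesgue"
      using borel_version_set_borel_measurable[OF assms] by (simp add: set_borel_measurable_def)
    show "F \<in> borel_measurable lebesgue" using F by (rule measurable_completion)
    show "AE x in lebesgue. indicator \<Omega> x *\<^sub>R f x = F x"
      unfolding AE_completion_iff by (rule borel_version_AE_indicator[OF assms])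
  qed
  then show ?thesis using integral_completion[OF F] by simp
qed

lemma borel_version_integrable:
  assumes "borel_version \<Omega> f F" shows "set_integrable lebesgue \<Omega> f \<longleftrightarrow> integrable lborel F"
proof -
  have F: "F \<in> borel_measurable lborel" using assms by (simp add: borel_version_def)
  have "set_integrable lebesgue \<Omega> f \<longleftrightarrow> integrable lebesgue F"
    unfolding set_integrable_def
  proof (rule integrable_cong_AE)
    show "(\<lambda>x. indicator \<Omega> x *\<^sub>R f x) \<in> borel_measurable lebesgue"
      using borel_version_set_borel_measurable[OF assms] by (simp add: set_borel_measurable_def)
    show "F \<in> borel_measurable lebesgue" using F by (rule measurable_completion)
    show "AE x in lebesgue. indicator \<Omega> x *\<^sub>R f x = F x"
      unfolding AE_completion_iff by (rule borel_version_AE_indicator[OF assms])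
  qed
  then show ?thesis using integrable_completion[OF F] by simp
qed

lemma borel_version_compose2:
  assumes "borel_version \<Omega> f F" "borel_version \<Omega> g G" "(\<lambda>x. h (F x) (G x)) \<in> borel_measurable borel" "h 0 0 = 0"
  shows "borel_version \<Omega> (\<lambda>x. h (f x) (g x)) (\<lambda>x. h (F x) (G x))"
  unfolding borel_version_def
proof (intro conjI allI impI assms(3))
  show "h (F x) (G x) = 0" if "x \<notin> \<Omega>" for x
    using that assms(1,2,4) by (simp add: borel_version_outside)
  show "AE x in lborel. x \<in> \<Omega> \<longrightarrow> h (F x) (G x) = h (f x) (g x)"
    using borel_version_AE[OF assms(1)] borel_version_AE[OF assms(2)] by eventually_elim auto
qed

lemma
  assumes f: "borel_version \<Omega> f F" and g: "borel_version \<Omega> g G"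
  shows borel_version_diff: "borel_version \<Omega> (\<lambda>x. f x - g x) (\<lambda>x. F x - G x)"
    and borel_version_mult: "borel_version \<Omega> (\<lambda>x. f x * g x) (\<lambda>x. F x * G x)"
    and borel_version_square: "borel_version \<Omega> (\<lambda>x. (f x)\<^sup>2) (\<lambda>x. (F x)\<^sup>2)"
proof -
  have [measurable]: "F \<in> borel_measurable borel" "G \<in> borel_measurable borel"
    using f g by (auto simp: borel_version_def)
  show "borel_version \<Omega> (\<lambda>x. f x - g x) (\<lambda>x. F x - G x)"
    "borel_version \<Omega> (\<lambda>x. f x * g x) (\<lambda>x. F x * G x)"
    "borel_version \<Omega> (\<lambda>x. (f x)\<^sup>2) (\<lambda>x. (F x)\<^sup>2)"
    using borel_version_compose2[OF f g, of "(-)"] borel_version_compose2[OF f g, of "(*)"]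
      borel_version_compose2[OF f g, of "\<lambda>x y. x\<^sup>2"] by simp_all
qed

lemma borel_version_cong_AE:
  assumes "borel_version \<Omega> f F" "AE x in lborel. x \<in> \<Omega> \<longrightarrow> f x = g x"
  shows "borel_version \<Omega> g F"
proof -
  have "AE x in lborel. x \<in> \<Omega> \<longrightarrow> F x = g x"
    using borel_version_AE[OF assms(1)] assms(2) by eventually_elim simp
  then show ?thesis using assms(1) by (simp add: borel_version_def)
qed

lemma borel_version_borel:
  "\<Omega> \<in> sets borel \<Longrightarrow> f \<in> borel_measurable borel \<Longrightarrow> borel_version \<Omega> f (\<lambda>x. indicator \<Omega> x * f x)"
  unfolding borel_version_def by auto

lemma borel_version_test_function: "test_function \<Omega> \<phi> \<Longrightarrow> borel_version \<Omega> \<phi> \<phi>"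
  unfolding borel_version_def by (auto simp: test_function_borel_measurable test_function_outside)

lemma L2_fun_iff:
  assumes "borel_version \<Omega> f F" shows "L2_fun \<Omega> f \<longleftrightarrow> integrable lborel (\<lambda>x. (F x)\<^sup>2)"
  using borel_version_integrable[OF borel_version_square[OF assms assms]]
    borel_version_set_borel_measurable[OF assms] by (simp add: L2_fun_def)

lemma norm_L2_square:
  assumes "borel_version \<Omega> f F" shows "(norm_L2 \<Omega> f)\<^sup>2 = (LINT x|lborel. (F x)\<^sup>2)"
  unfolding norm_L2_def borel_version_integral[OF borel_version_square[OF assms assms]] by simp

lemma L2_fun_borel_version:
  assumes "\<Omega> \<in> sets borel" "L2_fun \<Omega> f"
  shows "\<exists>F. borel_version \<Omega> f F \<and> integrable lborel (\<lambda>x. (F x)\<^sup>2)"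
  using borel_version_exists[OF assms(1), of f] assms(2) L2_fun_iff unfolding L2_fun_def by blast

lemma integrable_mult_L2:
  fixes F G :: "'a \<Rightarrow> real"
  assumes [measurable]: "F \<in> borel_measurable M" "G \<in> borel_measurable M"
    and "integrable M (\<lambda>x. (F x)\<^sup>2)" "integrable M (\<lambda>x. (G x)\<^sup>2)"
  shows "integrable M (\<lambda>x. F x * G x)"
proof (rule Bochner_Integration.integrable_bound)
  show "integrable M (\<lambda>x. (F x)\<^sup>2 + (G x)\<^sup>2)" using assms by simp
  have "2 * \<bar>F x * G x\<bar> \<le> (F x)\<^sup>2 + (G x)\<^sup>2" for x
    using sum_squares_bound[of "\<bar>F x\<bar>" "\<bar>G x\<bar>"] by (simp add: abs_mult)
  then have "\<bar>F x * G x\<bar> \<le> (F x)\<^sup>2 + (G x)\<^sup>2" for x by (smt (verit) abs_ge_zero)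
  then show "AE x in M. norm (F x * G x) \<le> norm ((F x)\<^sup>2 + (G x)\<^sup>2)" by simp
qed simp

lemma integrable_L2_box:
  fixes F :: "'a::euclidean_space \<Rightarrow> real"
  assumes [measurable]: "F \<in> borel_measurable borel" and F2: "integrable lborel (\<lambda>x. (F x)\<^sup>2)"
    and F0: "\<And>x. x \<notin> box a b \<Longrightarrow> F x = 0"
  shows "integrable lborel F"
proof -
  have "integrable lborel (\<lambda>x. F x * indicator (box a b) x)"
  proof (rule integrable_mult_L2[OF _ _ F2])
    have "(\<lambda>x. (indicator (box a b) x)\<^sup>2 :: real) = indicator (box a b)" by (auto split: split_indicator)
    then show "integrable lborel (\<lambda>x. (indicator (box a b) x)\<^sup>2 :: real)"
      using integrable_real_indicator[OF _ emeasure_lborel_box_finite] by simp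
  qed auto
  moreover have "F x * indicator (box a b) x = F x" for x using F0[of x] by (auto split: split_indicator)
  ultimately show ?thesis by simp
qed

lemma locally_integrable_set_borel_measurable:
  fixes f :: "'a::euclidean_space \<Rightarrow> real"
  assumes "open \<Omega>" and f: "locally_integrable \<Omega> f"
  shows "set_borel_measurable lebesgue \<Omega> f"
proof -
  obtain C :: "nat \<Rightarrow> 'a set" where C: "\<And>n. compact (C n)" "\<And>n. C n \<subseteq> \<Omega>" "\<And>n. C n \<subseteq> interior (C (Suc n))" "\<Union> (range C) = \<Omega>"
    by (rule open_Union_compact_subsets[OF assms(1)]) blast
  have mono: "C m \<subseteq> C n" if "m \<le> n" for m n
    by (rule lift_Suc_mono_le[OF _ that]) (rule order_trans[OF C(3) interior_subset])
  show ?thesis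
    unfolding set_borel_measurable_def
  proof (rule borel_measurable_LIMSEQ_real)
    show "(\<lambda>x. indicator (C n) x *\<^sub>R f x) \<in> borel_measurable lebesgue" for n
      using f C(1,2)[of n] by (auto simp: locally_integrable_def set_integrable_def)
    fix x
    show "(\<lambda>n. indicator (C n) x *\<^sub>R f x) \<longlonglongrightarrow> indicator \<Omega> x *\<^sub>R f x"
    proof (cases "x \<in> \<Omega>")
      case True
      then obtain N where "x \<in> C N" using C(4) by blast
      then have "eventually (\<lambda>n. indicator \<Omega> x *\<^sub>R f x = indicator (C n) x *\<^sub>R f x) sequentially"
        using subsetD[OF mono[of N]] True unfolding eventually_sequentially by (intro exI[of _ N]) auto
      then show ?thesis by (rule Lim_transform_eventually[rotated]) simp
    next
      case False
      then have "x \<notin> C n" for n using C(2) by auto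
      then show ?thesis using False by simp
    qed
  qed
qed

lemma locally_integrable_borel_version:
  "open \<Omega> \<Longrightarrow> locally_integrable \<Omega> f \<Longrightarrow> \<exists>F. borel_version \<Omega> f F"
  by (intro borel_version_exists locally_integrable_set_borel_measurable) auto

lemma borel_version_compact_integrable:
  assumes bv: "borel_version \<Omega> f F" and f: "locally_integrable \<Omega> f" and K: "compact K" "K \<subseteq> \<Omega>"
  shows "integrable lborel (\<lambda>x. indicator K x * F x)"
proof -
  have K': "K \<in> sets borel" using K(1) by (simp add: borel_compact)
  have "borel_version K f (\<lambda>x. indicator K x * F x)"
    unfolding borel_version_def
  proof (intro conjI)
    show "(\<lambda>x. indicator K x * F x) \<in> borel_measurable borel"
      using K' borel_version_borel_measurable[OF bv] by simp
    show "AE x in lborel. x \<in> K \<longrightarrow> indicator K x * F x = f x"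
      using borel_version_AE[OF bv] by eventually_elim (use K(2) in auto)
  qed simp
  from borel_version_integrable[OF this] show ?thesis using f K by (auto simp: locally_integrable_def)
qed

lemma borel_version_integrable_test_function:
  assumes bv: "borel_version \<Omega> f F" and f: "locally_integrable \<Omega> f" and \<phi>: "test_function \<Omega> \<phi>"
  shows "integrable lborel (\<lambda>x. F x * \<phi> x)"
proof -
  obtain K where K: "compact K" "K \<subseteq> \<Omega>" "\<And>x. x \<notin> K \<Longrightarrow> \<phi> x = 0"
    using \<phi> unfolding test_function_def by metis
  have "integrable lborel (\<lambda>x. (indicator K x * F x) * \<phi> x)"
    by (rule integrable_mult_test_function[OF borel_version_compact_integrable[OF bv f K(1,2)] \<phi>])
  moreover have "(indicator K x * F x) * \<phi> x = F x * \<phi> x" for x using K(3)[of x] by (auto split: split_indicator)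
  ultimately show ?thesis by simp
qed

lemma borel_version_integral_test_function:
  "borel_version \<Omega> f F \<Longrightarrow> test_function \<Omega> \<phi> \<Longrightarrow> (LINT x:\<Omega>|lebesgue. f x * \<phi> x) = (LINT x|lborel. F x * \<phi> x)"
  by (intro borel_version_integral borel_version_mult borel_version_test_function)

lemma set_integrable_test_function:
  "borel_version \<Omega> f F \<Longrightarrow> locally_integrable \<Omega> f \<Longrightarrow> test_function \<Omega> \<phi> \<Longrightarrow>
    set_integrable lebesgue \<Omega> (\<lambda>x. f x * \<phi> x)"
  using borel_version_integrable_test_function
    borel_version_integrable[OF borel_version_mult[OF _ borel_version_test_function]] by metis

section \<open>Weak derivatives\<close>

lemma AE_not_in_frontier_cbox: "AE x in lborel. x \<notin> cbox a b - box a b"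
proof -
  have "cbox a b - box a b \<in> null_sets lebesgue"
    using negligible_frontier_interval[of a b] by (simp add: negligible_iff_null_sets)
  from AE_not_in[OF this] show ?thesis unfolding AE_completion_iff .
qed

lemma locally_integrable_AE_eqI:
  fixes f g :: "'a::euclidean_space \<times> 'b::euclidean_space \<Rightarrow> real"
  assumes \<Omega>: "open \<Omega>" and f: "locally_integrable \<Omega> f" and g: "locally_integrable \<Omega> g"
    and test: "\<And>\<phi>. test_function \<Omega> \<phi> \<Longrightarrow> (LINT x:\<Omega>|lebesgue. f x * \<phi> x) = (LINT x:\<Omega>|lebesgue. g x * \<phi> x)"
  shows "AE x in lborel. x \<in> \<Omega> \<longrightarrow> f x = g x"
proof -
  obtain F G where F: "borel_version \<Omega> f F" and G: "borel_version \<Omega> g G"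
    using locally_integrable_borel_version[OF \<Omega>] f g by metis
  have [measurable]: "F \<in> borel_measurable borel" "G \<in> borel_measurable borel"
    using F G by (auto simp: borel_version_def)
  have box: "AE x in lborel. x \<in> cbox a b \<longrightarrow> F x = G x" if ab: "cbox a b \<subseteq> \<Omega>" for a b
  proof -
    let ?h = "\<lambda>x. indicator (box a b) x * (F x - G x)"
    have prod: "box a b = box (fst a) (fst b) \<times> box (snd a) (snd b)" by (rule box_prod)
    have "AE x in lborel. ?h x = 0"
    proof (rule fundamental_lemma)
      have "integrable lborel (\<lambda>x. indicator (box a b) x *\<^sub>R (indicator (cbox a b) x * F x - indicator (cbox a b) x * G x))"
        by (intro integrable_mult_indicator Bochner_Integration.integrable_diff
            borel_version_compact_integrable[OF F f _ ab] borel_version_compact_integrable[OF G g _ ab]) auto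
      also have "(\<lambda>x. indicator (box a b) x *\<^sub>R (indicator (cbox a b) x * F x - indicator (cbox a b) x * G x)) = ?h"
        using subsetD[OF box_subset_cbox[of a b]] by (intro ext) (auto split: split_indicator)
      finally show "integrable lborel ?h" .
      show "?h p = 0" if "p \<notin> box (fst a) (fst b) \<times> box (snd a) (snd b)" for p
        using that by (simp add: prod)
      fix \<phi> \<psi> assume t: "test_function (box (fst a) (fst b)) \<phi>" "test_function (box (snd a) (snd b)) \<psi>"
      let ?t = "\<lambda>(x, y). \<phi> x * \<psi> y"
      have t': "test_function (box a b) ?t" unfolding prod by (rule test_function_tensor[OF t])
      then have t\<Omega>: "test_function \<Omega> ?t" using ab box_subset_cbox[of a b] by (auto intro: test_function_mono)
      have "(LINT p|lborel. ?h p * (\<phi> (fst p) * \<psi> (snd p))) = (LINT p|lborel. F p * ?t p - G p * ?t p)"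
        using test_function_outside[OF t']
        by (intro Bochner_Integration.integral_cong) (auto simp: split_def algebra_simps split: split_indicator)
      also have "\<dots> = 0"
        using borel_version_integrable_test_function[OF F f t\<Omega>] borel_version_integrable_test_function[OF G g t\<Omega>]
          test[OF t\<Omega>] borel_version_integral_test_function[OF F t\<Omega>] borel_version_integral_test_function[OF G t\<Omega>]
        by simp
      finally show "(LINT p|lborel. ?h p * (\<phi> (fst p) * \<psi> (snd p))) = 0" .
    qed
    then show ?thesis using AE_not_in_frontier_cbox[of a b] by eventually_elim auto
  qed
  obtain D where D: "countable D" "\<And>X. X \<in> D \<Longrightarrow> X \<subseteq> \<Omega> \<and> (\<exists>a b. X = cbox a b)" "\<Union>D = \<Omega>"
    using open_countable_Union_open_cbox[OF \<Omega>] by (metis PowD subsetD)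
  have "AE x in lborel. \<forall>X\<in>D. x \<in> X \<longrightarrow> F x = G x"
    unfolding AE_ball_countable[OF D(1)] using D(2) box by metis
  then show ?thesis
    using borel_version_AE[OF F] borel_version_AE[OF G]
    by eventually_elim (use D(3) in auto)
qed

lemma
  assumes "has_weak_deriv ds \<Omega> f g"
  shows has_weak_deriv_locally_integrable: "locally_integrable \<Omega> f" "locally_integrable \<Omega> g"
    and has_weak_derivD: "test_function \<Omega> \<phi> \<Longrightarrow> (LINT x:\<Omega>|lebesgue. f x * foldr dir_deriv ds \<phi> x)
      = (- 1) ^ length ds * (LINT x:\<Omega>|lebesgue. g x * \<phi> x)"
  using assms unfolding has_weak_deriv_def by blast+

lemma weak_deriv_unique:
  fixes f g h :: "'a::euclidean_space \<times> 'b::euclidean_space \<Rightarrow> real"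
  assumes "open \<Omega>" "has_weak_deriv ds \<Omega> f g" "has_weak_deriv ds \<Omega> f h"
  shows "AE x in lborel. x \<in> \<Omega> \<longrightarrow> g x = h x"
proof (rule locally_integrable_AE_eqI)
  show "open \<Omega>" by (rule assms(1))
  show "locally_integrable \<Omega> g" by (rule has_weak_deriv_locally_integrable(2)[OF assms(2)])
  show "locally_integrable \<Omega> h" by (rule has_weak_deriv_locally_integrable(2)[OF assms(3)])
  show "(LINT x:\<Omega>|lebesgue. g x * \<phi> x) = (LINT x:\<Omega>|lebesgue. h x * \<phi> x)" if "test_function \<Omega> \<phi>" for \<phi>
  proof -
    have "(- 1) ^ length ds * (LINT x:\<Omega>|lebesgue. g x * \<phi> x) = (- 1) ^ length ds * (LINT x:\<Omega>|lebesgue. h x * \<phi> x)"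
      using has_weak_derivD[OF assms(2) that] has_weak_derivD[OF assms(3) that] by (rule trans[OF sym])
    then show ?thesis by (rule mult_left_cancel[THEN iffD1, rotated]) simp
  qed
qed

lemma weak_deriv_works: "has_weak_deriv ds \<Omega> f g \<Longrightarrow> has_weak_deriv ds \<Omega> f (weak_deriv ds \<Omega> f)"
  unfolding weak_deriv_def by (rule someI[of "has_weak_deriv ds \<Omega> f"])

lemma weak_deriv_AE_eq:
  fixes f g :: "'a::euclidean_space \<times> 'b::euclidean_space \<Rightarrow> real"
  shows "open \<Omega> \<Longrightarrow> has_weak_deriv ds \<Omega> f g \<Longrightarrow> AE x in lborel. x \<in> \<Omega> \<longrightarrow> weak_deriv ds \<Omega> f x = g x"
  using weak_deriv_unique weak_deriv_works by blast

lemma locally_integrable_add_cmult: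
  "locally_integrable \<Omega> f \<Longrightarrow> locally_integrable \<Omega> g \<Longrightarrow> locally_integrable \<Omega> (\<lambda>x. f x + c * g x)"
  unfolding locally_integrable_def by (simp add: set_integral_add(1))

lemma has_weak_deriv_add_cmult:
  fixes c :: real
  assumes \<Omega>: "open \<Omega>" and f: "has_weak_deriv ds \<Omega> f f'" and g: "has_weak_deriv ds \<Omega> g g'"
  shows "has_weak_deriv ds \<Omega> (\<lambda>x. f x + c * g x) (\<lambda>x. f' x + c * g' x)"
  unfolding has_weak_deriv_def
proof (intro conjI allI impI)
  have l: "locally_integrable \<Omega> f" "locally_integrable \<Omega> g" "locally_integrable \<Omega> f'" "locally_integrable \<Omega> g'"
    using has_weak_deriv_locally_integrable[OF f] has_weak_deriv_locally_integrable[OF g] by simp_all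
  then show "locally_integrable \<Omega> (\<lambda>x. f x + c * g x)" "locally_integrable \<Omega> (\<lambda>x. f' x + c * g' x)"
    by (auto intro: locally_integrable_add_cmult)
  have lin: "(LINT x:\<Omega>|lebesgue. (f x + c * g x) * \<phi> x) = (LINT x:\<Omega>|lebesgue. f x * \<phi> x) + c * (LINT x:\<Omega>|lebesgue. g x * \<phi> x)"
    if l: "locally_integrable \<Omega> f" "locally_integrable \<Omega> g" and \<phi>: "test_function \<Omega> \<phi>" for f g \<phi>
  proof -
    have "set_integrable lebesgue \<Omega> (\<lambda>x. f x * \<phi> x)" "set_integrable lebesgue \<Omega> (\<lambda>x. g x * \<phi> x)"
      using locally_integrable_borel_version[OF \<Omega>] set_integrable_test_function l \<phi> by metis+
    then have "(LINT x:\<Omega>|lebesgue. f x * \<phi> x + c * (g x * \<phi> x)) = (LINT x:\<Omega>|lebesgue. f x * \<phi> x) + c * (LINT x:\<Omega>|lebesgue. g x * \<phi> x)"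
      by (subst set_integral_add) auto
    then show ?thesis by (simp add: algebra_simps)
  qed
  fix \<phi> assume \<phi>: "test_function \<Omega> \<phi>"
  show "(LINT x:\<Omega>|lebesgue. (f x + c * g x) * foldr dir_deriv ds \<phi> x) =
      (- 1) ^ length ds * (LINT x:\<Omega>|lebesgue. (f' x + c * g' x) * \<phi> x)"
    unfolding lin[OF l(3,4) \<phi>] lin[OF l(1,2) test_function_foldr_dir_deriv[OF \<phi>]]
    unfolding has_weak_derivD[OF f \<phi>] has_weak_derivD[OF g \<phi>] by (simp add: algebra_simps)
qed

lemma has_weak_deriv_dirs:
  assumes "has_weak_deriv (dirs i j) \<Omega> f g" "has_weak_deriv (dirs (i + k) (j + l)) \<Omega> f h"
  shows "has_weak_deriv (dirs k l) \<Omega> g h"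
  unfolding has_weak_deriv_def
proof (intro conjI allI impI)
  show "locally_integrable \<Omega> g" "locally_integrable \<Omega> h"
    using has_weak_deriv_locally_integrable[OF assms(1)] has_weak_deriv_locally_integrable[OF assms(2)] by simp_all
  fix \<phi> :: "real \<times> real \<Rightarrow> real" assume \<phi>: "test_function \<Omega> \<phi>"
  have len: "length (dirs m n) = m + n" for m n by (simp add: dirs_def)
  have "(LINT x:\<Omega>|lebesgue. f x * foldr dir_deriv (dirs i j) (foldr dir_deriv (dirs k l) \<phi>) x)
      = (- 1) ^ (i + j) * (LINT x:\<Omega>|lebesgue. g x * foldr dir_deriv (dirs k l) \<phi> x)"
    using has_weak_derivD[OF assms(1) test_function_foldr_dir_deriv[OF \<phi>]] by (simp only: len)
  moreover have "foldr dir_deriv (dirs i j) (foldr dir_deriv (dirs k l) \<phi>) = foldr dir_deriv (dirs (i + k) (j + l)) \<phi>"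
    using foldr_dir_deriv_dirs_append[of \<phi> i j k l] \<phi> by (simp add: test_function_def)
  moreover have "(LINT x:\<Omega>|lebesgue. f x * foldr dir_deriv (dirs (i + k) (j + l)) \<phi> x)
      = (- 1) ^ (i + k + (j + l)) * (LINT x:\<Omega>|lebesgue. h x * \<phi> x)"
    using has_weak_derivD[OF assms(2) \<phi>] by (simp only: len)
  moreover have e: "i + k + (j + l) = (i + j) + (k + l)" by simp
  ultimately have "(- 1) ^ (i + j) * (LINT x:\<Omega>|lebesgue. g x * foldr dir_deriv (dirs k l) \<phi> x)
      = (- 1) ^ (i + j) * ((- 1) ^ (k + l) * (LINT x:\<Omega>|lebesgue. h x * \<phi> x))"
    unfolding e power_add[of _ "i + j"] mult.assoc by metis
  moreover have "(- 1 :: real) ^ (i + j) \<noteq> 0" by simp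
  ultimately show "(LINT x:\<Omega>|lebesgue. g x * foldr dir_deriv (dirs k l) \<phi> x)
      = (- 1) ^ length (dirs k l) * (LINT x:\<Omega>|lebesgue. h x * \<phi> x)"
    unfolding len by (rule mult_left_cancel[THEN iffD1, rotated])
qed

lemma rect_eq_box: "rect L B = box (0, 0) (L, B)"
  by (simp add: rect_def box_prod)

lemma open_rect: "open (rect L B)"
  unfolding rect_eq_box by (rule open_box)

lemma rect_borel: "rect L B \<in> sets borel"
  by (rule borel_open[OF open_rect])

lemma continuous_locally_integrable:
  assumes "continuous_on UNIV f" shows "locally_integrable \<Omega> f"
  unfolding locally_integrable_def
proof (intro allI impI)
  fix K :: "'a set" assume K: "compact K \<and> K \<subseteq> \<Omega>"
  have "integrable lborel (\<lambda>x. indicator K x *\<^sub>R f x)"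
    using K continuous_on_subset[OF assms] by (intro borel_integrable_compact) auto
  moreover have "borel_version K f (\<lambda>x. indicator K x * f x)"
    using K assms by (intro borel_version_borel) (auto intro: borel_compact borel_measurable_continuous_onI)
  ultimately show "set_integrable lebesgue K f"
    using borel_version_integrable by fastforce
qed

lemma
  fixes \<zeta> :: "real \<times> 'b::euclidean_space \<Rightarrow> real"
  assumes \<zeta>: "test_function (A \<times> Q) \<zeta>"
  shows test_function_slice: "test_function A (\<lambda>x. \<zeta> (x, y))"
    and dir_deriv_slice: "dir_deriv 1 (\<lambda>x. \<zeta> (x, y)) = (\<lambda>x. dir_deriv (1, 0) \<zeta> (x, y))"
proof -
  have h: "((\<lambda>x. (x, y)) has_derivative (\<lambda>e. (e, 0))) (at x)" for x
    by (intro derivative_intros)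
  have s: "smooth \<zeta>" using \<zeta> by (simp add: test_function_def)
  show "dir_deriv 1 (\<lambda>x. \<zeta> (x, y)) = (\<lambda>x. dir_deriv (1, 0) \<zeta> (x, y))"
    by (rule dir_deriv_compose_affine[OF s h])
  obtain K where K: "compact K" "K \<subseteq> A \<times> Q" "\<And>p. p \<notin> K \<Longrightarrow> \<zeta> p = 0"
    using \<zeta> unfolding test_function_def by metis
  show "test_function A (\<lambda>x. \<zeta> (x, y))"
    unfolding test_function_def
  proof (intro conjI exI[of _ "fst ` (K \<inter> UNIV \<times> {y})"] allI impI)
    show "smooth (\<lambda>x. \<zeta> (x, y))" by (rule smooth_compose_affine[OF s h])
    show "compact (fst ` (K \<inter> UNIV \<times> {y}))"
      by (intro compact_continuous_image continuous_intros compact_Int_closed K closed_Times closed_UNIV closed_singleton)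
    show "fst ` (K \<inter> UNIV \<times> {y}) \<subseteq> A" using K by auto
    show "\<zeta> (x, y) = 0" if "x \<notin> fst ` (K \<inter> UNIV \<times> {y})" for x using that K(3) by force
  qed
qed

lemma integral_dir_deriv_test_function:
  fixes \<zeta> :: "real \<times> 'b::euclidean_space \<Rightarrow> real"
  assumes L: "0 < L" and \<zeta>: "test_function ({0<..<L} \<times> box c d) \<zeta>"
  shows "(LINT p|lborel. dir_deriv (1, 0) \<zeta> p) = 0"
proof -
  have b: "{0<..<L} \<times> box c d = box (0, c) (L, d)" by (simp add: box_prod)
  have i: "integrable lborel (dir_deriv (1, 0) \<zeta>)"
    using test_function_integrable[OF test_function_dir_deriv[OF \<zeta>[unfolded b]]] .
  have "(LINT x|lborel. dir_deriv (1, 0) \<zeta> (x, y)) = 0" for y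
  proof -
    let ?\<phi> = "\<lambda>x. \<zeta> (x, y)"
    note t = test_function_slice[OF \<zeta>, of y]
    note ac = ac_test_function[OF less_imp_le[OF L] t]
    have "?\<phi> L = 0 + (LINT s|lborel. dir_deriv 1 ?\<phi> s)"
      by (rule ac_ge_support[OF ac, of 0 L]) (use test_function_outside[OF test_function_dir_deriv[OF t]] in auto)
    then show ?thesis using test_function_outside[OF t, of L] by (simp add: dir_deriv_slice[OF \<zeta>])
  qed
  then show ?thesis using integral_snd_lborel[OF i] by simp
qed

lemma swap_has_derivative: "(prod.swap has_derivative prod.swap) (at p)"
  using has_derivative_Pair[OF has_derivative_snd[OF has_derivative_ident] has_derivative_fst[OF has_derivative_ident]]
  by (simp add: prod.swap_def[abs_def])

lemma
  assumes "smooth f"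
  shows smooth_swap: "smooth (\<lambda>p. f (prod.swap p))"
    and dir_deriv_swap: "dir_deriv e (\<lambda>p. f (prod.swap p)) = (\<lambda>p. dir_deriv (prod.swap e) f (prod.swap p))"
  using smooth_compose_affine[OF assms swap_has_derivative] dir_deriv_compose_affine[OF assms swap_has_derivative]
  by auto

lemma test_function_swap:
  assumes "test_function (A \<times> B) \<phi>" shows "test_function (B \<times> A) (\<lambda>p. \<phi> (prod.swap p))"
proof -
  obtain K where K: "compact K" "K \<subseteq> A \<times> B" "\<And>p. p \<notin> K \<Longrightarrow> \<phi> p = 0"
    using assms unfolding test_function_def by metis
  have "\<phi> (prod.swap p) = 0" if "p \<notin> prod.swap ` K" for p
    using that K(3) by (metis image_eqI swap_swap)
  moreover have "compact (prod.swap ` K)" by (intro compact_continuous_image continuous_on_swap K)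
  moreover have "prod.swap ` K \<subseteq> B \<times> A" using K(2) by auto
  ultimately show ?thesis using assms smooth_swap unfolding test_function_def by blast
qed

lemma integral_dir_deriv_test_function_rect:
  assumes "0 < L" "0 < B" and \<zeta>: "test_function (rect L B) \<zeta>" and e: "e \<in> {(1, 0), (0, 1)}"
  shows "(LINT p|lborel. dir_deriv e \<zeta> p) = 0"
proof (cases "e = (1, 0)")
  case True
  then show ?thesis using integral_dir_deriv_test_function[OF assms(1), of 0 B \<zeta>] \<zeta> by (simp add: rect_def)
next
  case False
  then have e: "e = (0, 1)" using assms by auto
  have t: "test_function ({0<..<B} \<times> {0<..<L}) (\<lambda>p. \<zeta> (prod.swap p))"
    by (rule test_function_swap) (use \<zeta> in \<open>simp add: rect_def\<close>)
  have s: "smooth \<zeta>" using \<zeta> by (simp add: test_function_def)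
  have "(LINT p|lborel. dir_deriv (1, 0) (\<lambda>p. \<zeta> (prod.swap p)) p) = 0"
    using integral_dir_deriv_test_function[OF assms(2), of 0 L] t by simp
  then have "(LINT p|lborel. dir_deriv e \<zeta> (prod.swap p)) = 0" by (simp add: dir_deriv_swap[OF s] e)
  then show ?thesis
    using integral_swap_lborel[of "dir_deriv e \<zeta>"] smooth_borel_measurable[OF smooth_dir_deriv[OF s]] by simp
qed

lemma test_function_mult_smooth:
  assumes "smooth f" "test_function \<Omega> \<phi>" shows "test_function \<Omega> (\<lambda>x. f x * \<phi> x)"
  using assms smooth_mult[of f \<phi>] unfolding test_function_def by (metis mult_zero_right)

lemma smooth_has_weak_deriv:
  assumes L: "0 < L" "0 < B" and f: "smooth f" and e: "e \<in> {(1, 0), (0, 1)}"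
  shows "has_weak_deriv [e] (rect L B) f (dir_deriv e f)"
  unfolding has_weak_deriv_def
proof (intro conjI allI impI)
  show "locally_integrable (rect L B) f" "locally_integrable (rect L B) (dir_deriv e f)"
    by (auto intro!: continuous_locally_integrable smooth_continuous_on smooth_dir_deriv f)
  fix \<phi> assume \<phi>: "test_function (rect L B) \<phi>"
  have bv: "(LINT x:rect L B|lebesgue. g x * \<psi> x) = (LINT x|lborel. g x * \<psi> x)"
    if g: "smooth g" and \<psi>: "test_function (rect L B) \<psi>" for g \<psi>
    using borel_version_integral[OF borel_version_test_function[OF test_function_mult_smooth[OF g \<psi>]]] .
  have i: "integrable lborel (\<lambda>x. g x * \<psi> x)"
    if g: "smooth g" and \<psi>: "test_function (rect L B) \<psi>" for g \<psi>
    using test_function_integrable[OF test_function_mult_smooth[OF g \<psi>, unfolded rect_eq_box]] .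
  have \<phi>s: "smooth \<phi>" using \<phi> by (simp add: test_function_def)
  have "0 = (LINT x|lborel. dir_deriv e (\<lambda>x. f x * \<phi> x) x)"
    using integral_dir_deriv_test_function_rect[OF L test_function_mult_smooth[OF f \<phi>] e] by simp
  also have "\<dots> = (LINT x|lborel. f x * dir_deriv e \<phi> x) + (LINT x|lborel. dir_deriv e f x * \<phi> x)"
    unfolding dir_deriv_mult[OF f \<phi>s]
    by (intro Bochner_Integration.integral_add i f \<phi> smooth_dir_deriv test_function_dir_deriv)
  finally show "(LINT x:rect L B|lebesgue. f x * foldr dir_deriv [e] \<phi> x) =
      (- 1) ^ length [e] * (LINT x:rect L B|lebesgue. dir_deriv e f x * \<phi> x)"
    by (simp add: bv[OF f test_function_dir_deriv[OF \<phi>]] bv[OF smooth_dir_deriv[OF f] \<phi>])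
qed

lemma has_weak_deriv_Nil: "locally_integrable \<Omega> f \<Longrightarrow> has_weak_deriv [] \<Omega> f f"
  by (simp add: has_weak_deriv_def)

section \<open>Traces\<close>

lemma sobolev_norm_1:
  "(sobolev_norm 1 \<Omega> f)\<^sup>2 = (norm_L2 \<Omega> (wd 0 0 \<Omega> f))\<^sup>2 + (norm_L2 \<Omega> (wd 0 1 \<Omega> f))\<^sup>2 + (norm_L2 \<Omega> (wd 1 0 \<Omega> f))\<^sup>2"
proof -
  have "sobolev_norm 1 \<Omega> f = sqrt ((norm_L2 \<Omega> (wd 0 0 \<Omega> f))\<^sup>2 + (norm_L2 \<Omega> (wd 0 1 \<Omega> f))\<^sup>2 + (norm_L2 \<Omega> (wd 1 0 \<Omega> f))\<^sup>2)"
    by (simp add: sobolev_norm_def)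
  then show ?thesis by simp
qed

lemma sobolev_weak_deriv:
  assumes "f \<in> sobolev k (rect L B)" "i + j \<le> k"
  shows "has_weak_deriv (dirs i j) (rect L B) f (wd i j (rect L B) f)"
  using assms weak_deriv_works unfolding sobolev_def L2_weak_deriv_def by blast

lemma has_trace_zeroE:
  assumes L: "0 < L" "0 < B" and tr: "has_trace (rect L B) \<sigma> l f (\<lambda>_. 0)"
    and F: "borel_version (rect L B) f F" and F1: "borel_version (rect L B) (wd 1 0 (rect L B) f) F1"
    and F2: "borel_version (rect L B) (wd 0 1 (rect L B) f) F2"
  obtains \<phi> where "\<And>n::nat. smooth (\<phi> n)"
    "(\<lambda>n. LINT p|lborel. (indicator (rect L B) p * \<phi> n p - F p)\<^sup>2) \<longlonglongrightarrow> 0"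
    "(\<lambda>n. LINT p|lborel. (indicator (rect L B) p * dir_deriv (1, 0) (\<phi> n) p - F1 p)\<^sup>2) \<longlonglongrightarrow> 0"
    "(\<lambda>n. LINT p|lborel. (indicator (rect L B) p * dir_deriv (0, 1) (\<phi> n) p - F2 p)\<^sup>2) \<longlonglongrightarrow> 0"
    "(\<lambda>n. norm_L2 {0<..<l} (\<lambda>s. \<phi> n (\<sigma> s))) \<longlonglongrightarrow> 0"
proof -
  let ?D = "rect L B"
  obtain \<phi> where \<phi>: "\<And>n::nat. smooth (\<phi> n)"
    and S: "(\<lambda>n. sobolev_norm 1 ?D (\<lambda>p. \<phi> n p - f p)) \<longlonglongrightarrow> 0"
    and T: "(\<lambda>n. norm_L2 {0<..<l} (\<lambda>s. \<phi> n (\<sigma> s) - 0)) \<longlonglongrightarrow> 0"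
    using tr unfolding has_trace_def by auto
  have f1: "f \<in> sobolev 1 ?D" using tr unfolding has_trace_def by auto
  have lf: "locally_integrable ?D f"
    using has_weak_deriv_locally_integrable(1)[OF sobolev_weak_deriv[OF f1, of 0 0]] by simp
  have key: "(norm_L2 ?D (weak_deriv ds ?D (\<lambda>p. \<phi> n p - f p)))\<^sup>2 = (LINT p|lborel. (indicator ?D p * g p - G p)\<^sup>2)"
    if g: "has_weak_deriv ds ?D (\<phi> n) g" and sg: "smooth g" and f': "has_weak_deriv ds ?D f f'" and G: "borel_version ?D f' G" for n ds g f' G
  proof -
    have "has_weak_deriv ds ?D (\<lambda>p. \<phi> n p - f p) (\<lambda>p. g p - f' p)"
      using has_weak_deriv_add_cmult[OF open_rect g f', of "- 1"] by simp
    from weak_deriv_AE_eq[OF open_rect this]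
    have ae: "AE x in lborel. x \<in> ?D \<longrightarrow> g x - f' x = weak_deriv ds ?D (\<lambda>p. \<phi> n p - f p) x"
      by eventually_elim simp
    have "borel_version ?D (\<lambda>p. g p - f' p) (\<lambda>p. indicator ?D p * g p - G p)"
      by (intro borel_version_diff borel_version_borel rect_borel smooth_borel_measurable sg G)
    from norm_L2_square[OF borel_version_cong_AE[OF this ae]] show ?thesis .
  qed
  have d: "dirs 0 0 = []" "dirs 1 0 = [(1,0)]" "dirs 0 1 = [(0,1)]" by (simp_all add: dirs_def)
  have k0: "(norm_L2 ?D (wd 0 0 ?D (\<lambda>p. \<phi> n p - f p)))\<^sup>2 = (LINT p|lborel. (indicator ?D p * \<phi> n p - F p)\<^sup>2)" for n
    unfolding d by (rule key[OF has_weak_deriv_Nil \<phi> has_weak_deriv_Nil[OF lf] F])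
      (intro continuous_locally_integrable smooth_continuous_on \<phi>)
  have w1: "has_weak_deriv (dirs 1 0) ?D (\<phi> n) (dir_deriv (1, 0) (\<phi> n))"
    and w2: "has_weak_deriv (dirs 0 1) ?D (\<phi> n) (dir_deriv (0, 1) (\<phi> n))" for n
    unfolding d by (rule smooth_has_weak_deriv[OF L \<phi>]; simp)+
  have k1: "(norm_L2 ?D (wd 1 0 ?D (\<lambda>p. \<phi> n p - f p)))\<^sup>2 = (LINT p|lborel. (indicator ?D p * dir_deriv (1, 0) (\<phi> n) p - F1 p)\<^sup>2)" for n
    by (rule key[OF w1 smooth_dir_deriv[OF \<phi>] sobolev_weak_deriv[OF f1] F1]) simp
  have k2: "(norm_L2 ?D (wd 0 1 ?D (\<lambda>p. \<phi> n p - f p)))\<^sup>2 = (LINT p|lborel. (indicator ?D p * dir_deriv (0, 1) (\<phi> n) p - F2 p)\<^sup>2)" for n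
    by (rule key[OF w2 smooth_dir_deriv[OF \<phi>] sobolev_weak_deriv[OF f1] F2]) simp
  have S2: "(\<lambda>n. (sobolev_norm 1 ?D (\<lambda>p. \<phi> n p - f p))\<^sup>2) \<longlonglongrightarrow> 0"
    using tendsto_power[OF S, of 2] by simp
  have sq: "X \<longlonglongrightarrow> 0" if "\<And>n. 0 \<le> X n" "\<And>n. X n \<le> (sobolev_norm 1 ?D (\<lambda>p. \<phi> n p - f p))\<^sup>2" for X :: "nat \<Rightarrow> real"
    by (rule tendsto_sandwich[OF _ _ tendsto_const S2]) (use that in auto)
  show ?thesis
  proof (rule that[OF \<phi>])
    show "(\<lambda>n. LINT p|lborel. (indicator ?D p * \<phi> n p - F p)\<^sup>2) \<longlonglongrightarrow> 0"
      unfolding k0[symmetric] by (rule sq) (unfold sobolev_norm_1, simp_all)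
    show "(\<lambda>n. LINT p|lborel. (indicator ?D p * dir_deriv (1, 0) (\<phi> n) p - F1 p)\<^sup>2) \<longlonglongrightarrow> 0"
      unfolding k1[symmetric] by (rule sq) (unfold sobolev_norm_1, simp_all)
    show "(\<lambda>n. LINT p|lborel. (indicator ?D p * dir_deriv (0, 1) (\<phi> n) p - F2 p)\<^sup>2) \<longlonglongrightarrow> 0"
      unfolding k2[symmetric] by (rule sq) (unfold sobolev_norm_1, simp_all)
    show "(\<lambda>n. norm_L2 {0<..<l} (\<lambda>s. \<phi> n (\<sigma> s))) \<longlonglongrightarrow> 0" using T by simp
  qed
qed

lemma L2_tendsto_imp_L1_tendsto:
  fixes H :: "nat \<Rightarrow> 'a::euclidean_space \<Rightarrow> real"
  assumes [measurable]: "\<And>n. H n \<in> borel_measurable borel" and H2: "\<And>n. integrable lborel (\<lambda>x. (H n x)\<^sup>2)"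
    and H0: "\<And>n x. x \<notin> box a b \<Longrightarrow> H n x = 0"
    and lim: "(\<lambda>n. LINT x|lborel. (H n x)\<^sup>2) \<longlonglongrightarrow> 0"
  shows "(\<lambda>n. LINT x|lborel. \<bar>H n x\<bar>) \<longlonglongrightarrow> 0"
proof -
  let ?m = "measure lborel (box a b)"
  define t where "t n = sqrt (LINT x|lborel. (H n x)\<^sup>2) + 1 / real (Suc n)" for n
  have H: "integrable lborel (H n)" for n by (rule integrable_L2_box[OF _ H2 H0]) simp_all
  have ib: "integrable lborel (indicator (box a b) :: 'a \<Rightarrow> real)"
    by (intro integrable_real_indicator emeasure_lborel_box_finite) auto
  have bound: "(LINT x|lborel. \<bar>H n x\<bar>) \<le> t n * (1 + ?m) / 2" for n
  proof -
    have nn: "0 \<le> (LINT x|lborel. (H n x)\<^sup>2)" by (intro Bochner_Integration.integral_nonneg) simp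
    then have t: "0 < t n" by (simp add: t_def add_nonneg_pos)
    have "sqrt (LINT x|lborel. (H n x)\<^sup>2) \<le> t n" by (simp add: t_def)
    then have a: "(LINT x|lborel. (H n x)\<^sup>2) \<le> (t n)\<^sup>2" by (rule sqrt_le_D)
    have "(LINT x|lborel. 2 * t n * \<bar>H n x\<bar>) \<le> (LINT x|lborel. (H n x)\<^sup>2 + (t n)\<^sup>2 * indicator (box a b) x)"
    proof (rule integral_mono)
      fix x
      show "2 * t n * \<bar>H n x\<bar> \<le> (H n x)\<^sup>2 + (t n)\<^sup>2 * indicator (box a b) x"
        using sum_squares_bound[of "t n" "\<bar>H n x\<bar>"] H0[of x n] by (auto split: split_indicator)
    qed (use H H2 ib in auto)
    also have "\<dots> = (LINT x|lborel. (H n x)\<^sup>2) + (t n)\<^sup>2 * ?m" using H2 ib by simp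
    finally have "2 * t n * (LINT x|lborel. \<bar>H n x\<bar>) \<le> (t n)\<^sup>2 * (1 + ?m)" using a by (simp add: algebra_simps)
    then have "t n * (2 * (LINT x|lborel. \<bar>H n x\<bar>)) \<le> t n * (t n * (1 + ?m))" by (simp add: power2_eq_square algebra_simps)
    then show ?thesis using t by simp
  qed
  have "t \<longlonglongrightarrow> sqrt 0 + 0"
    unfolding t_def using LIMSEQ_inverse_real_of_nat
    by (intro tendsto_add tendsto_real_sqrt lim) (simp add: inverse_eq_divide)
  then have "(\<lambda>n. t n * (1 + ?m) / 2) \<longlonglongrightarrow> 0 * (1 + ?m) / 2" by (intro tendsto_intros) auto
  then have lim': "(\<lambda>n. t n * (1 + ?m) / 2) \<longlonglongrightarrow> 0" by simp
  show ?thesis by (rule tendsto_sandwich[OF _ _ tendsto_const lim']) (use bound in auto)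
qed

lemma integral_tensor:
  fixes F :: "'a::euclidean_space \<Rightarrow> real" and G :: "'b::euclidean_space \<Rightarrow> real"
  assumes F: "integrable lborel F" and G: "integrable lborel G"
  shows "(LINT p|lborel. F (fst p) * G (snd p)) = (LINT x|lborel. F x) * (LINT y|lborel. G y)"
proof -
  have "integrable lborel (\<lambda>p. F (fst p) * G (snd p))" using integrable_tensor[OF F G] by (simp add: split_def)
  from integral_fst_lborel[OF this] show ?thesis by simp
qed

lemma integrable_smooth_box:
  assumes "smooth f" shows "integrable lborel (\<lambda>x. indicator (box a b) x * f x)"
proof -
  have "integrable lborel (\<lambda>x. indicator (cbox a b) x *\<^sub>R f x)"
    by (intro borel_integrable_compact smooth_continuous_on assms) simp
  then have "integrable lborel (\<lambda>x. indicator (box a b) x *\<^sub>R (indicator (cbox a b) x *\<^sub>R f x))"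
    by (rule integrable_mult_indicator[rotated]) simp
  also have "(\<lambda>x. indicator (box a b) x *\<^sub>R (indicator (cbox a b) x *\<^sub>R f x)) = (\<lambda>x. indicator (box a b) x * f x)"
    using subsetD[OF box_subset_cbox[of a b]] by (intro ext) (auto split: split_indicator)
  finally show ?thesis .
qed

lemma prim_if_trace_zero:
  fixes F Fx :: "real \<times> real \<Rightarrow> real"
  assumes L: "0 < L" and c: "0 \<le> c" "c \<le> L"
    and Fm[measurable]: "F \<in> borel_measurable borel" "Fx \<in> borel_measurable borel"
    and F2: "integrable lborel (\<lambda>p. (F p)\<^sup>2)" "integrable lborel (\<lambda>p. (Fx p)\<^sup>2)"
    and F0: "\<And>p. p \<notin> rect L B \<Longrightarrow> F p = 0" "\<And>p. p \<notin> rect L B \<Longrightarrow> Fx p = 0"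
    and \<phi>: "\<And>n::nat. smooth (\<phi> n)"
    and lim: "(\<lambda>n. LINT p|lborel. (indicator (rect L B) p * \<phi> n p - F p)\<^sup>2) \<longlonglongrightarrow> 0"
    and limx: "(\<lambda>n. LINT p|lborel. (indicator (rect L B) p * dir_deriv (1, 0) (\<phi> n) p - Fx p)\<^sup>2) \<longlonglongrightarrow> 0"
    and limc: "(\<lambda>n. LINT y|lborel. (indicator {0<..<B} y * \<phi> n (c, y))\<^sup>2) \<longlonglongrightarrow> 0"
  shows "AE p in lborel. p \<in> rect L B \<longrightarrow>
    F p = prim (\<lambda>r. Fx (r, snd p)) (fst p) - prim (\<lambda>r. Fx (r, snd p)) c"
proof -
  let ?D = "rect L B"
  have [measurable]: "?D \<in> sets borel" by (rule rect_borel)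
  have [measurable]: "\<phi> n \<in> borel_measurable borel" "dir_deriv (1,0) (\<phi> n) \<in> borel_measurable borel" for n
    by (auto intro!: smooth_borel_measurable \<phi> smooth_dir_deriv)
  define H where "H n p = indicator ?D p * \<phi> n p - F p" for n p
  define Hx where "Hx n p = indicator ?D p * dir_deriv (1,0) (\<phi> n) p - Fx p" for n p
  define Hc where "Hc n y = indicator {0<..<B} y * \<phi> n (c, y)" for n y
  have Hm[measurable]: "H n \<in> borel_measurable borel" "Hx n \<in> borel_measurable borel" for n
    unfolding H_def[abs_def] Hx_def[abs_def] by measurable
  have sl: "smooth (\<lambda>y. \<phi> n (c, y))" for n
    by (rule smooth_compose_affine[OF \<phi>, where A = "\<lambda>e. (0, e)"]) (intro derivative_intros)
  have Hcm[measurable]: "Hc n \<in> borel_measurable borel" for n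
    unfolding Hc_def[abs_def] using smooth_borel_measurable[OF sl[of n]] by simp
  have diff2: "integrable lborel (\<lambda>p. (indicator ?D p * f p - G p)\<^sup>2)"
    if f: "smooth f" and G[measurable]: "G \<in> borel_measurable borel" and G2: "integrable lborel (\<lambda>p. (G p)\<^sup>2)" for f and G :: "real \<times> real \<Rightarrow> real"
  proof -
    have f2: "integrable lborel (\<lambda>p. (indicator ?D p * f p)\<^sup>2)"
      using integrable_smooth_box[OF smooth_mult[OF f f], of "(0,0)" "(L,B)"]
      by (rule Bochner_Integration.integrable_cong[THEN iffD1, rotated -1]) (auto simp: rect_eq_box power2_eq_square split: split_indicator)
    have [measurable]: "f \<in> borel_measurable borel" by (rule smooth_borel_measurable[OF f])
    have "integrable lborel (\<lambda>p. (indicator ?D p * f p)\<^sup>2 + (G p)\<^sup>2 - 2 * ((indicator ?D p * f p) * G p))"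
      using f2 G2 by (intro Bochner_Integration.integrable_diff Bochner_Integration.integrable_add integrable_mult_right integrable_mult_L2) auto
    then show ?thesis by (simp add: power2_diff algebra_simps)
  qed
  have H2: "integrable lborel (\<lambda>p. (H n p)\<^sup>2)" "integrable lborel (\<lambda>p. (Hx n p)\<^sup>2)" for n
    unfolding H_def Hx_def by (intro diff2 \<phi> smooth_dir_deriv Fm F2)+
  have Hc2: "integrable lborel (\<lambda>y. (Hc n y)\<^sup>2)" for n
    using integrable_smooth_box[OF smooth_mult[OF sl[of n] sl[of n]], of 0 B]
    by (rule Bochner_Integration.integrable_cong[THEN iffD1, rotated -1]) (auto simp: Hc_def power2_eq_square split: split_indicator)
  have H0: "H n p = 0" "Hx n p = 0" if "p \<notin> box (0,0) (L,B)" for n p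
    using that F0[of p] by (auto simp: H_def Hx_def rect_eq_box)
  have Hc0: "Hc n y = 0" if "y \<notin> box 0 B" for n y using that by (simp add: Hc_def)
  have H1: "integrable lborel (H n)" "integrable lborel (Hx n)" "integrable lborel (Hc n)" for n
    using integrable_L2_box[OF Hm(1) H2(1) H0(1)] integrable_L2_box[OF Hm(2) H2(2) H0(2)]
      integrable_L2_box[OF Hcm Hc2 Hc0] by auto
  have l1: "(\<lambda>n. LINT p|lborel. \<bar>H n p\<bar>) \<longlonglongrightarrow> 0"
    by (rule L2_tendsto_imp_L1_tendsto[OF Hm(1) H2(1) H0(1)]) (use lim in \<open>simp_all add: H_def\<close>)
  have l2: "(\<lambda>n. LINT p|lborel. \<bar>Hx n p\<bar>) \<longlonglongrightarrow> 0"
    by (rule L2_tendsto_imp_L1_tendsto[OF Hm(2) H2(2) H0(2)]) (use limx in \<open>simp_all add: Hx_def\<close>)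
  have l3: "(\<lambda>n. LINT y|lborel. \<bar>Hc n y\<bar>) \<longlonglongrightarrow> 0"
    by (rule L2_tendsto_imp_L1_tendsto[OF Hcm Hc2 Hc0]) (use limc in \<open>simp_all add: Hc_def\<close>)
  have Fxi: "integrable lborel Fx"
    by (rule integrable_L2_box[OF Fm(2) F2(2)]) (use F0(2) in \<open>simp add: rect_eq_box\<close>)
  define I :: "real \<Rightarrow> real" where "I = indicator {0<..<L}"
  have Ii: "integrable lborel I" and IL: "(LINT x|lborel. I x) = L" using L by (simp_all add: I_def)
  define E where "E p = indicator ?D p * (F p - (prim (\<lambda>r. Fx (r, snd p)) (fst p) - prim (\<lambda>r. Fx (r, snd p)) c))" for p
  have [measurable]: "(\<lambda>p. prim (\<lambda>r. Fx (r, snd p)) (fst p)) \<in> borel_measurable (borel :: (real \<times> real) measure)"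
    "(\<lambda>p. prim (\<lambda>r. Fx (r, snd p)) c) \<in> borel_measurable (borel :: (real \<times> real) measure)"
    unfolding prim_def borel_prod[symmetric] by measurable
  have Em[measurable]: "E \<in> borel_measurable borel" unfolding E_def by measurable
  have N: "integrable lborel (\<lambda>y. LINT r|lborel. \<bar>Hx n (r, y)\<bar>)" for n
    using integrable_snd_lborel[of "\<lambda>p. \<bar>Hx n p\<bar>"] H1(2)[of n] by simp
  have NI: "(LINT y|lborel. LINT r|lborel. \<bar>Hx n (r, y)\<bar>) = (LINT p|lborel. \<bar>Hx n p\<bar>)" for n
    using integral_snd_lborel[of "\<lambda>p. \<bar>Hx n p\<bar>"] H1(2)[of n] by simp
  have bound: "AE p in lborel. \<bar>E p\<bar> \<le> \<bar>H n p\<bar> + I (fst p) * \<bar>Hc n (snd p)\<bar> + 2 * (I (fst p) * (LINT r|lborel. \<bar>Hx n (r, snd p)\<bar>))" for n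
    using AE_lborel_sndI[OF AE_integrable_snd_lborel[OF Fxi]] AE_lborel_sndI[OF AE_integrable_snd_lborel[OF H1(2)[of n]]]
  proof eventually_elim
    fix p :: "real \<times> real"
    obtain x y where p: "p = (x, y)" by (cases p)
    assume "integrable lborel (\<lambda>r. Fx (r, snd p))" "integrable lborel (\<lambda>r. Hx n (r, snd p))"
    then have i: "integrable lborel (\<lambda>r. Fx (r, y))" "integrable lborel (\<lambda>r. Hx n (r, y))" by (auto simp: p)
    show "\<bar>E p\<bar> \<le> \<bar>H n p\<bar> + I (fst p) * \<bar>Hc n (snd p)\<bar> + 2 * (I (fst p) * (LINT r|lborel. \<bar>Hx n (r, snd p)\<bar>))"
    proof (cases "p \<in> ?D")
      case False
      have "0 \<le> (LINT r|lborel. \<bar>Hx n (r, snd p)\<bar>)" by (intro Bochner_Integration.integral_nonneg) simp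
      then show ?thesis using False by (simp add: E_def I_def)
    next
      case True
      then have x: "0 < x" "x < L" and y: "0 < y" "y < B" by (auto simp: p rect_def)
      have "((\<lambda>x. \<phi> n (x, y)) has_real_derivative dir_deriv (1, 0) (\<phi> n) (x, y)) (at x)" for x
        using smooth_has_line_derivative[OF \<phi>, of n "(0, y)" "(1, 0)" x] by simp
      moreover have "continuous_on {0..L} (\<lambda>x. dir_deriv (1, 0) (\<phi> n) (x, y))"
        by (rule continuous_on_compose2[OF smooth_continuous_on[OF smooth_dir_deriv[OF \<phi>], of UNIV]]) (auto intro!: continuous_intros)
      ultimately obtain P where P: "ac P (\<lambda>x. if x \<in> {0<..<L} then dir_deriv (1, 0) (\<phi> n) (x, y) else 0) (\<phi> n (0, y))"
          "\<And>x. x \<in> {0..L} \<Longrightarrow> P x = \<phi> n (x, y)"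
        using ac_C1[OF less_imp_le[OF L], of "\<lambda>x. \<phi> n (x, y)" "\<lambda>x. dir_deriv (1, 0) (\<phi> n) (x, y)"] by blast
      let ?G = "\<lambda>x. if x \<in> {0<..<L} then dir_deriv (1, 0) (\<phi> n) (x, y) else 0"
      have Gi: "integrable lborel ?G" by (rule ac_integrable[OF P(1)])
      have G: "(\<lambda>r. Hx n (r, y)) = (\<lambda>r. ?G r - Fx (r, y))" using y by (auto simp: Hx_def rect_def)
      have "\<phi> n (x, y) - \<phi> n (c, y) = prim ?G x - prim ?G c"
      proof -
        have "P x = \<phi> n (x, y)" "P c = \<phi> n (c, y)" using P(2) x c by auto
        moreover have "P x = \<phi> n (0, y) + prim ?G x" "P c = \<phi> n (0, y) + prim ?G c"
          using P(1) unfolding ac_def by blast+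
        ultimately show ?thesis by linarith
      qed
      then have "E p = - H n p + Hc n y + (prim (\<lambda>r. Hx n (r, y)) x - prim (\<lambda>r. Hx n (r, y)) c)"
        unfolding G prim_diff[OF Gi i(1)] using True y by (simp add: E_def H_def Hc_def p)
      moreover have "\<bar>prim (\<lambda>r. Hx n (r, y)) z\<bar> \<le> (LINT r|lborel. \<bar>Hx n (r, y)\<bar>)" for z
        by (rule abs_prim_le[OF i(2)])
      from this[of x] this[of c]
      have "\<bar>prim (\<lambda>r. Hx n (r, y)) x - prim (\<lambda>r. Hx n (r, y)) c\<bar> \<le> 2 * (LINT r|lborel. \<bar>Hx n (r, y)\<bar>)" by linarith
      ultimately show ?thesis using x by (simp add: I_def p)
    qed
  qed
  let ?R = "\<lambda>n p. \<bar>H n p\<bar> + I (fst p) * \<bar>Hc n (snd p)\<bar> + 2 * (I (fst p) * (LINT r|lborel. \<bar>Hx n (r, snd p)\<bar>))"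
  have ti: "integrable lborel (\<lambda>p :: real \<times> real. I (fst p) * G (snd p))" if "integrable lborel G" for G
    using integrable_tensor[OF Ii that] by (simp add: split_def)
  have Ri: "integrable lborel (?R n)" for n
    using H1(1)[of n] ti[of "\<lambda>y. \<bar>Hc n y\<bar>"] H1(3)[of n] ti[OF N[of n]] by simp
  have RI: "(LINT p|lborel. ?R n p) = (LINT p|lborel. \<bar>H n p\<bar>) + L * (LINT y|lborel. \<bar>Hc n y\<bar>) + 2 * (L * (LINT p|lborel. \<bar>Hx n p\<bar>))" for n
    using H1(1)[of n] ti[of "\<lambda>y. \<bar>Hc n y\<bar>"] H1(3)[of n] ti[OF N[of n]]
      integral_tensor[OF Ii, of "\<lambda>y. \<bar>Hc n y\<bar>"] integral_tensor[OF Ii N[of n]] by (simp add: IL NI)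
  have Ei: "integrable lborel E"
    by (rule Bochner_Integration.integrable_bound[OF Ri[of 0]]) (use bound[of 0] in auto)
  have le: "(LINT p|lborel. \<bar>E p\<bar>) \<le> (LINT p|lborel. \<bar>H n p\<bar>) + L * (LINT y|lborel. \<bar>Hc n y\<bar>) + 2 * (L * (LINT p|lborel. \<bar>Hx n p\<bar>))" for n
    unfolding RI[symmetric] by (rule integral_mono_AE) (use Ei Ri bound in auto)
  have "(\<lambda>n. (LINT p|lborel. \<bar>H n p\<bar>) + L * (LINT y|lborel. \<bar>Hc n y\<bar>) + 2 * (L * (LINT p|lborel. \<bar>Hx n p\<bar>))) \<longlonglongrightarrow> 0 + L * 0 + 2 * (L * 0)"
    by (intro tendsto_intros l1 l2 l3)
  then have "(LINT p|lborel. \<bar>E p\<bar>) \<le> 0" using le by (intro LIMSEQ_le_const) auto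
  moreover have "0 \<le> (LINT p|lborel. \<bar>E p\<bar>)" by (intro Bochner_Integration.integral_nonneg) simp
  ultimately have "(LINT p|lborel. \<bar>E p\<bar>) = 0" by simp
  then have "AE p in lborel. \<bar>E p\<bar> = 0" using integral_nonneg_eq_0_iff_AE[of lborel "\<lambda>p. \<bar>E p\<bar>"] Ei by simp
  then show ?thesis by eventually_elim (auto simp: E_def)
qed

section \<open>Integration by parts on rectangles\<close>

definition L2_rect :: "real \<Rightarrow> real \<Rightarrow> (real \<times> real \<Rightarrow> real) \<Rightarrow> bool" where
  "L2_rect L B F \<longleftrightarrow> F \<in> borel_measurable borel \<and> integrable lborel (\<lambda>p. (F p)\<^sup>2) \<and> (\<forall>p. p \<notin> rect L B \<longrightarrow> F p = 0)"

definition ac_rect :: "real \<Rightarrow> real \<Rightarrow> (real \<times> real \<Rightarrow> real) \<Rightarrow> (real \<times> real \<Rightarrow> real) \<Rightarrow> bool" where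
  "ac_rect L B F G \<longleftrightarrow> (\<exists>C. AE p in lborel. p \<in> rect L B \<longrightarrow> F p = C (snd p) + prim (\<lambda>r. G (r, snd p)) (fst p))"

definition ac_zero_rect :: "real \<Rightarrow> real \<Rightarrow> real \<Rightarrow> (real \<times> real \<Rightarrow> real) \<Rightarrow> (real \<times> real \<Rightarrow> real) \<Rightarrow> bool" where
  "ac_zero_rect L B c F G \<longleftrightarrow> (AE p in lborel. p \<in> rect L B \<longrightarrow>
     F p = prim (\<lambda>r. G (r, snd p)) (fst p) - prim (\<lambda>r. G (r, snd p)) c)"

abbreviation swapped :: "(real \<times> real \<Rightarrow> real) \<Rightarrow> real \<times> real \<Rightarrow> real" where
  "swapped F \<equiv> \<lambda>p. F (prod.swap p)"

lemma swap_in_rect: "prod.swap p \<in> rect L B \<longleftrightarrow> p \<in> rect B L"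
  by (cases p) (auto simp: rect_def)

lemma borel_measurable_swap:
  fixes F :: "'a::euclidean_space \<times> 'b::euclidean_space \<Rightarrow> real"
  assumes "F \<in> borel_measurable borel" shows "(\<lambda>p. F (prod.swap p)) \<in> borel_measurable borel"
  by (rule measurable_compose[OF borel_measurable_continuous_onI[OF continuous_on_swap] assms])

lemma L2_rectD:
  assumes "L2_rect L B F"
  shows "F \<in> borel_measurable borel" "integrable lborel (\<lambda>p. (F p)\<^sup>2)" "p \<notin> rect L B \<Longrightarrow> F p = 0"
    "integrable lborel F"
proof -
  have F: "F \<in> borel_measurable borel" "integrable lborel (\<lambda>p. (F p)\<^sup>2)" and F0: "\<And>p. p \<notin> rect L B \<Longrightarrow> F p = 0"
    using assms unfolding L2_rect_def by blast+
  show "F \<in> borel_measurable borel" "integrable lborel (\<lambda>p. (F p)\<^sup>2)" "p \<notin> rect L B \<Longrightarrow> F p = 0"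
    by (fact F F0)+
  show "integrable lborel F"
    by (rule integrable_L2_box[OF F F0[unfolded rect_eq_box]])
qed

lemma L2_rect_swap: "L2_rect L B F \<Longrightarrow> L2_rect B L (swapped F)"
  using integrable_swap_lborel[of "\<lambda>p. (F p)\<^sup>2"] swap_in_rect
  unfolding L2_rect_def by (auto intro: borel_measurable_swap)

lemma L2_rect_mult: "L2_rect L B F \<Longrightarrow> L2_rect L B G \<Longrightarrow> integrable lborel (\<lambda>p. F p * G p)"
  by (intro integrable_mult_L2) (simp_all add: L2_rectD)

lemma AE_interval_const:
  assumes "(a::real) < b" "AE x in lborel. x \<in> {a<..<b} \<longrightarrow> P" shows P
proof (rule ccontr)
  assume "\<not> P"
  then have "AE x in lborel. x \<notin> {a<..<b}" using assms(2) by auto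
  then have "emeasure lborel {a<..<b} = 0" by (subst (asm) AE_iff_measurable[of "{a<..<b}"]) auto
  then show False using assms(1) by simp
qed

lemma ac_rect_slices:
  assumes G: "integrable lborel G" and ac: "ac_rect L B F G"
  shows "AE y in lborel. y \<in> {0<..<B} \<longrightarrow>
    (\<exists>f \<alpha>. ac f (\<lambda>x. G (x, y)) \<alpha> \<and> (AE x in lborel. x \<in> {0<..<L} \<longrightarrow> F (x, y) = f x))"
proof -
  obtain C where C: "AE p in lborel. p \<in> rect L B \<longrightarrow> F p = C (snd p) + prim (\<lambda>r. G (r, snd p)) (fst p)"
    using ac by (auto simp: ac_rect_def)
  show ?thesis
    using AE_snd_lborel[OF C] AE_integrable_snd_lborel[OF G]
  proof eventually_elim
    fix y assume y: "AE x in lborel. (x, y) \<in> rect L B \<longrightarrow> F (x, y) = C (snd (x, y)) + prim (\<lambda>r. G (r, snd (x, y))) (fst (x, y))"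
      and i: "integrable lborel (\<lambda>x. G (x, y))"
    show "y \<in> {0<..<B} \<longrightarrow> (\<exists>f \<alpha>. ac f (\<lambda>x. G (x, y)) \<alpha> \<and> (AE x in lborel. x \<in> {0<..<L} \<longrightarrow> F (x, y) = f x))"
    proof
      assume yB: "y \<in> {0<..<B}"
      have "ac (\<lambda>x. C y + prim (\<lambda>r. G (r, y)) x) (\<lambda>x. G (x, y)) (C y)" using i by (simp add: ac_def)
      moreover have "AE x in lborel. x \<in> {0<..<L} \<longrightarrow> F (x, y) = C y + prim (\<lambda>r. G (r, y)) x"
        using y by eventually_elim (use yB in \<open>auto simp: rect_def\<close>)
      ultimately show "\<exists>f \<alpha>. ac f (\<lambda>x. G (x, y)) \<alpha> \<and> (AE x in lborel. x \<in> {0<..<L} \<longrightarrow> F (x, y) = f x)" by blast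
    qed
  qed
qed

lemma ac_zero_left_slices:
  assumes L: "0 < L" and G: "L2_rect L B G" and ac: "ac_zero_rect L B 0 F G"
  shows "AE y in lborel. y \<in> {0<..<B} \<longrightarrow> ac (prim (\<lambda>x. G (x, y))) (\<lambda>x. G (x, y)) 0 \<and>
    (AE x in lborel. x \<in> {0<..<L} \<longrightarrow> F (x, y) = prim (\<lambda>x. G (x, y)) x)"
  using AE_snd_lborel[OF ac[unfolded ac_zero_rect_def]] AE_integrable_snd_lborel[OF L2_rectD(4)[OF G]]
proof eventually_elim
  fix y assume y: "AE x in lborel. (x, y) \<in> rect L B \<longrightarrow>
      F (x, y) = prim (\<lambda>r. G (r, snd (x, y))) (fst (x, y)) - prim (\<lambda>r. G (r, snd (x, y))) 0"
    and i: "integrable lborel (\<lambda>x. G (x, y))"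
  have "G (x, y) = 0" if "x \<notin> {0<..<L}" for x using that by (intro L2_rectD(3)[OF G]) (auto simp: rect_def)
  then have "prim (\<lambda>r. G (r, y)) 0 = 0" by (intro prim_le_support[of 0 L]) auto
  with y i show "y \<in> {0<..<B} \<longrightarrow> ac (prim (\<lambda>x. G (x, y))) (\<lambda>x. G (x, y)) 0 \<and>
      (AE x in lborel. x \<in> {0<..<L} \<longrightarrow> F (x, y) = prim (\<lambda>x. G (x, y)) x)"
    by (auto simp: ac_def rect_def elim: eventually_mono)
qed

lemma ac_zero_right_slices:
  assumes L: "0 < L" and G: "L2_rect L B G" and ac: "ac_zero_rect L B L F G"
  shows "AE y in lborel. y \<in> {0<..<B} \<longrightarrow> (\<exists>f \<alpha>. ac f (\<lambda>x. G (x, y)) \<alpha> \<and> \<alpha> + (LINT x|lborel. G (x, y)) = 0 \<and>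
    (AE x in lborel. x \<in> {0<..<L} \<longrightarrow> F (x, y) = f x))"
  using AE_snd_lborel[OF ac[unfolded ac_zero_rect_def]] AE_integrable_snd_lborel[OF L2_rectD(4)[OF G]]
proof eventually_elim
  fix y assume y: "AE x in lborel. (x, y) \<in> rect L B \<longrightarrow>
      F (x, y) = prim (\<lambda>r. G (r, snd (x, y))) (fst (x, y)) - prim (\<lambda>r. G (r, snd (x, y))) L"
    and i: "integrable lborel (\<lambda>x. G (x, y))"
  have "G (x, y) = 0" if "x \<notin> {0<..<L}" for x using that by (intro L2_rectD(3)[OF G]) (auto simp: rect_def)
  then have p: "prim (\<lambda>r. G (r, y)) L = (LINT x|lborel. G (x, y))" by (intro prim_ge_support[of 0 L]) auto
  show "y \<in> {0<..<B} \<longrightarrow> (\<exists>f \<alpha>. ac f (\<lambda>x. G (x, y)) \<alpha> \<and> \<alpha> + (LINT x|lborel. G (x, y)) = 0 \<and>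
      (AE x in lborel. x \<in> {0<..<L} \<longrightarrow> F (x, y) = f x))"
  proof
    assume yB: "y \<in> {0<..<B}"
    let ?f = "\<lambda>x. - prim (\<lambda>r. G (r, y)) L + prim (\<lambda>r. G (r, y)) x"
    have "ac ?f (\<lambda>x. G (x, y)) (- prim (\<lambda>r. G (r, y)) L)" using i by (simp add: ac_def)
    moreover have "- prim (\<lambda>r. G (r, y)) L + (LINT x|lborel. G (x, y)) = 0" using p by simp
    moreover have "AE x in lborel. x \<in> {0<..<L} \<longrightarrow> F (x, y) = ?f x"
      using y by eventually_elim (use yB in \<open>auto simp: rect_def\<close>)
    ultimately show "\<exists>f \<alpha>. ac f (\<lambda>x. G (x, y)) \<alpha> \<and> \<alpha> + (LINT x|lborel. G (x, y)) = 0 \<and>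
      (AE x in lborel. x \<in> {0<..<L} \<longrightarrow> F (x, y) = f x)" by blast
  qed
qed

lemma ac_zero_both_slices:
  assumes L: "0 < L" and G: "L2_rect L B G" and l: "ac_zero_rect L B 0 F G" and r: "ac_zero_rect L B L F G"
  shows "AE y in lborel. y \<in> {0<..<B} \<longrightarrow> ac (prim (\<lambda>x. G (x, y))) (\<lambda>x. G (x, y)) 0 \<and> (LINT x|lborel. G (x, y)) = 0 \<and>
    (AE x in lborel. x \<in> {0<..<L} \<longrightarrow> F (x, y) = prim (\<lambda>x. G (x, y)) x)"
  using ac_zero_left_slices[OF L G l] ac_zero_right_slices[OF L G r]
proof eventually_elim
  fix y
  assume 1: "y \<in> {0<..<B} \<longrightarrow> ac (prim (\<lambda>x. G (x, y))) (\<lambda>x. G (x, y)) 0 \<and>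
      (AE x in lborel. x \<in> {0<..<L} \<longrightarrow> F (x, y) = prim (\<lambda>x. G (x, y)) x)"
    and 2: "y \<in> {0<..<B} \<longrightarrow> (\<exists>f \<alpha>. ac f (\<lambda>x. G (x, y)) \<alpha> \<and> \<alpha> + (LINT x|lborel. G (x, y)) = 0 \<and>
      (AE x in lborel. x \<in> {0<..<L} \<longrightarrow> F (x, y) = f x))"
  show "y \<in> {0<..<B} \<longrightarrow> ac (prim (\<lambda>x. G (x, y))) (\<lambda>x. G (x, y)) 0 \<and> (LINT x|lborel. G (x, y)) = 0 \<and>
    (AE x in lborel. x \<in> {0<..<L} \<longrightarrow> F (x, y) = prim (\<lambda>x. G (x, y)) x)"
  proof (intro impI conjI)
    assume y: "y \<in> {0<..<B}"
    show "ac (prim (\<lambda>x. G (x, y))) (\<lambda>x. G (x, y)) 0"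
      and e: "AE x in lborel. x \<in> {0<..<L} \<longrightarrow> F (x, y) = prim (\<lambda>x. G (x, y)) x" using 1 y by auto
    obtain f \<alpha> where f: "ac f (\<lambda>x. G (x, y)) \<alpha>" "\<alpha> + (LINT x|lborel. G (x, y)) = 0"
      "AE x in lborel. x \<in> {0<..<L} \<longrightarrow> F (x, y) = f x" using 2 y by blast
    have "AE x in lborel. x \<in> {0<..<L} \<longrightarrow> \<alpha> = 0"
      using e f(3) by eventually_elim (use f(1) in \<open>auto simp: ac_def\<close>)
    then have "\<alpha> = 0" by (rule AE_interval_const[OF L])
    then show "(LINT x|lborel. G (x, y)) = 0" using f(2) by simp
  qed
qed

lemma integral_rect_nonpos:
  fixes K :: "real \<times> real \<Rightarrow> real"
  assumes K: "integrable lborel K" and K0: "\<And>p. p \<notin> rect L B \<Longrightarrow> K p = 0"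
    and sl: "AE y in lborel. y \<in> {0<..<B} \<longrightarrow> (LINT x|lborel. K (x, y)) \<le> 0"
  shows "integral\<^sup>L lborel K \<le> 0"
proof -
  have "AE y in lborel. (LINT x|lborel. K (x, y)) \<le> 0"
    using sl
  proof eventually_elim
    fix y assume "y \<in> {0<..<B} \<longrightarrow> (LINT x|lborel. K (x, y)) \<le> 0"
    moreover have "(\<lambda>x. K (x, y)) = (\<lambda>x. 0)" if "y \<notin> {0<..<B}" using that by (intro ext K0) (auto simp: rect_def)
    ultimately show "(LINT x|lborel. K (x, y)) \<le> 0" by (cases "y \<in> {0<..<B}") auto
  qed
  then have "(LINT y|lborel. LINT x|lborel. K (x, y)) \<le> (LINT y|(lborel :: real measure). 0)"
    using integrable_snd_lborel[OF K] by (intro integral_mono_AE) auto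
  then show ?thesis using integral_snd_lborel[OF K] by simp
qed

lemma integral_rect_zero:
  fixes K :: "real \<times> real \<Rightarrow> real"
  assumes K: "integrable lborel K" and K0: "\<And>p. p \<notin> rect L B \<Longrightarrow> K p = 0"
    and sl: "AE y in lborel. y \<in> {0<..<B} \<longrightarrow> (LINT x|lborel. K (x, y)) = 0"
  shows "integral\<^sup>L lborel K = 0"
proof -
  have "integral\<^sup>L lborel K \<le> 0"
    by (rule integral_rect_nonpos[OF K K0]) (use sl in \<open>auto elim: eventually_mono\<close>)
  moreover have "(LINT p|lborel. - K p) \<le> 0"
    by (rule integral_rect_nonpos[of "\<lambda>p. - K p" L B]) (use K K0 sl in \<open>auto elim: eventually_mono\<close>)
  ultimately show ?thesis by simp
qed

lemma slice_borel_measurable: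
  fixes F :: "'a::euclidean_space \<times> 'b::euclidean_space \<Rightarrow> real"
  assumes "F \<in> borel_measurable borel" shows "(\<lambda>x. F (x, y)) \<in> borel_measurable borel"
  by (rule measurable_compose[OF _ assms]) (intro borel_measurable_continuous_onI continuous_intros)

lemma integral_by_parts_rect:
  assumes L: "0 < L" and F: "L2_rect L B F" "L2_rect L B F'" and G: "L2_rect L B G" "L2_rect L B G'"
    and FF': "ac_rect L B F F'" and l: "ac_zero_rect L B 0 G G'" and r: "ac_zero_rect L B L G G'"
  shows "(LINT p|lborel. F' p * G p) = - (LINT p|lborel. F p * G' p)"
proof -
  note i = L2_rect_mult[OF F(2) G(1)] L2_rect_mult[OF F(1) G(2)]
  have "(LINT p|lborel. F' p * G p + F p * G' p) = 0"
  proof (rule integral_rect_zero[where L = L and B = B])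
    show "integrable lborel (\<lambda>p. F' p * G p + F p * G' p)" using i by simp
    show "F' p * G p + F p * G' p = 0" if "p \<notin> rect L B" for p using that F G by (simp add: L2_rectD(3))
    show "AE y in lborel. y \<in> {0<..<B} \<longrightarrow> (LINT x|lborel. F' (x, y) * G (x, y) + F (x, y) * G' (x, y)) = 0"
      using ac_rect_slices[OF L2_rectD(4)[OF F(2)] FF'] ac_zero_both_slices[OF L G(2) l r]
    proof (eventually_elim, intro impI)
      fix y assume a: "y \<in> {0<..<B} \<longrightarrow> (\<exists>f \<alpha>. ac f (\<lambda>x. F' (x, y)) \<alpha> \<and> (AE x in lborel. x \<in> {0<..<L} \<longrightarrow> F (x, y) = f x))"
        and g: "y \<in> {0<..<B} \<longrightarrow> ac (prim (\<lambda>x. G' (x, y))) (\<lambda>x. G' (x, y)) 0 \<and> (LINT x|lborel. G' (x, y)) = 0 \<and>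
          (AE x in lborel. x \<in> {0<..<L} \<longrightarrow> G (x, y) = prim (\<lambda>x. G' (x, y)) x)"
        and y: "y \<in> {0<..<B}"
      obtain f \<alpha> where f: "ac f (\<lambda>x. F' (x, y)) \<alpha>" "AE x in lborel. x \<in> {0<..<L} \<longrightarrow> F (x, y) = f x"
        using a y by blast
      let ?g = "prim (\<lambda>x. G' (x, y))"
      have g1: "ac ?g (\<lambda>x. G' (x, y)) 0" "(LINT x|lborel. G' (x, y)) = 0"
        "AE x in lborel. x \<in> {0<..<L} \<longrightarrow> G (x, y) = ?g x" using g y by auto
      have z: "F' (x, y) = 0" "G' (x, y) = 0" if "x \<notin> {0<..<L}" for x
        using that F G by (auto simp: rect_def intro!: L2_rectD(3))
      have "(LINT x|lborel. F' (x, y) * G (x, y) + F (x, y) * G' (x, y)) = (LINT x|lborel. F' (x, y) * ?g x + f x * G' (x, y))"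
      proof (rule integral_cong_AE)
        show "AE x in lborel. F' (x, y) * G (x, y) + F (x, y) * G' (x, y) = F' (x, y) * ?g x + f x * G' (x, y)"
          using f(2) g1(3)
        proof eventually_elim
          fix x assume "x \<in> {0<..<L} \<longrightarrow> F (x, y) = f x" "x \<in> {0<..<L} \<longrightarrow> G (x, y) = ?g x"
          then show "F' (x, y) * G (x, y) + F (x, y) * G' (x, y) = F' (x, y) * ?g x + f x * G' (x, y)"
            using z[of x] by (cases "x \<in> {0<..<L}") auto
        qed
        have [measurable]: "(\<lambda>x. K (x, y)) \<in> borel_measurable borel" if "L2_rect L B K" for K
          by (rule slice_borel_measurable[OF L2_rectD(1)[OF that]])
        note [measurable] = this[OF F(1)] this[OF F(2)] this[OF G(1)] this[OF G(2)]
        have [measurable]: "f \<in> borel_measurable borel" "?g \<in> borel_measurable borel"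
          by (auto intro: ac_borel_measurable[OF f(1)] ac_borel_measurable[OF g1(1)])
        show "(\<lambda>x. F' (x, y) * G (x, y) + F (x, y) * G' (x, y)) \<in> borel_measurable lborel" by measurable
        show "(\<lambda>x. F' (x, y) * ?g x + f x * G' (x, y)) \<in> borel_measurable lborel" by measurable
      qed
      also have "\<dots> = 0"
        using ac_integral_mult[OF f(1) g1(1), of 0 L] z g1(2) by auto
      finally show "(LINT x|lborel. F' (x, y) * G (x, y) + F (x, y) * G' (x, y)) = 0" .
    qed
  qed
  then show ?thesis using i by simp
qed

lemma integral_square_mult_deriv_rect:
  assumes L: "0 < L" and W: "L2_rect L B W" and W1: "L2_rect L B W1"
    and l: "ac_zero_rect L B 0 W W1" and r: "ac_zero_rect L B L W W1"
    and i: "integrable lborel (\<lambda>p. W p * W p * W1 p)"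
  shows "(LINT p|lborel. W p * W p * W1 p) = 0"
proof (rule integral_rect_zero[where L = L and B = B, OF i])
  show "W p * W p * W1 p = 0" if "p \<notin> rect L B" for p using that W by (simp add: L2_rectD(3))
  show "AE y in lborel. y \<in> {0<..<B} \<longrightarrow> (LINT x|lborel. W (x, y) * W (x, y) * W1 (x, y)) = 0"
    using ac_zero_both_slices[OF L W1 l r]
  proof (eventually_elim, intro impI)
    fix y assume g: "y \<in> {0<..<B} \<longrightarrow> ac (prim (\<lambda>x. W1 (x, y))) (\<lambda>x. W1 (x, y)) 0 \<and> (LINT x|lborel. W1 (x, y)) = 0 \<and>
        (AE x in lborel. x \<in> {0<..<L} \<longrightarrow> W (x, y) = prim (\<lambda>x. W1 (x, y)) x)"
      and y: "y \<in> {0<..<B}"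
    let ?g = "prim (\<lambda>x. W1 (x, y))"
    have g1: "ac ?g (\<lambda>x. W1 (x, y)) 0" "(LINT x|lborel. W1 (x, y)) = 0"
      "AE x in lborel. x \<in> {0<..<L} \<longrightarrow> W (x, y) = ?g x" using g y by auto
    have z: "W1 (x, y) = 0" if "x \<notin> {0<..<L}" for x using that W1 by (auto simp: rect_def intro!: L2_rectD(3))
    note [measurable] = slice_borel_measurable[OF L2_rectD(1)[OF W]] slice_borel_measurable[OF L2_rectD(1)[OF W1]]
      ac_borel_measurable[OF g1(1)]
    have "(LINT x|lborel. W (x, y) * W (x, y) * W1 (x, y)) = (LINT x|lborel. ?g x * ?g x * W1 (x, y))"
    proof (rule integral_cong_AE)
      show "AE x in lborel. W (x, y) * W (x, y) * W1 (x, y) = ?g x * ?g x * W1 (x, y)"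
        using g1(3) by eventually_elim (use z in fastforce)
    qed measurable
    also have "\<dots> = 0" by (rule ac_integral_square_mult_deriv[OF g1(1) z g1(2)])
    finally show "(LINT x|lborel. W (x, y) * W (x, y) * W1 (x, y)) = 0" .
  qed
qed

lemma integral_deriv_mult_self_rect:
  assumes L: "0 < L" and F: "L2_rect L B F" and F': "L2_rect L B F'" and r: "ac_zero_rect L B L F F'"
  shows "(LINT p|lborel. F' p * F p) \<le> 0"
proof (rule integral_rect_nonpos[where L = L and B = B, OF L2_rect_mult[OF F' F]])
  show "F' p * F p = 0" if "p \<notin> rect L B" for p using that F by (simp add: L2_rectD(3))
  show "AE y in lborel. y \<in> {0<..<B} \<longrightarrow> (LINT x|lborel. F' (x, y) * F (x, y)) \<le> 0"
    using ac_zero_right_slices[OF L F' r]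
  proof (eventually_elim, intro impI)
    fix y assume "y \<in> {0<..<B} \<longrightarrow> (\<exists>f \<alpha>. ac f (\<lambda>x. F' (x, y)) \<alpha> \<and> \<alpha> + (LINT x|lborel. F' (x, y)) = 0 \<and>
        (AE x in lborel. x \<in> {0<..<L} \<longrightarrow> F (x, y) = f x))" "y \<in> {0<..<B}"
    then obtain f \<alpha> where f: "ac f (\<lambda>x. F' (x, y)) \<alpha>" "\<alpha> + (LINT x|lborel. F' (x, y)) = 0"
      "AE x in lborel. x \<in> {0<..<L} \<longrightarrow> F (x, y) = f x" by blast
    have z: "F' (x, y) = 0" if "x \<notin> {0<..<L}" for x using that F' by (auto simp: rect_def intro!: L2_rectD(3))
    note [measurable] = slice_borel_measurable[OF L2_rectD(1)[OF F]] slice_borel_measurable[OF L2_rectD(1)[OF F']]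
      ac_borel_measurable[OF f(1)]
    have "(LINT x|lborel. F' (x, y) * F (x, y)) = (LINT x|lborel. F' (x, y) * f x)"
    proof (rule integral_cong_AE)
      show "AE x in lborel. F' (x, y) * F (x, y) = F' (x, y) * f x"
        using f(3) by eventually_elim (use z in fastforce)
    qed measurable
    also have "\<dots> \<le> 0" by (rule ac_integral_deriv_mult_self[OF f(1) z f(2)])
    finally show "(LINT x|lborel. F' (x, y) * F (x, y)) \<le> 0" .
  qed
qed

lemma wirtinger_rect:
  assumes L: "0 < L" and W: "L2_rect L B W" and W1: "L2_rect L B W1"
    and l: "ac_zero_rect L B 0 W W1" and r: "ac_zero_rect L B L W W1"
  shows "(pi / L)\<^sup>2 * (LINT p|lborel. (W p)\<^sup>2) \<le> (LINT p|lborel. (W1 p)\<^sup>2)"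
proof -
  note i = L2_rectD(2)[OF W] L2_rectD(2)[OF W1]
  have "(LINT p|lborel. (pi / L)\<^sup>2 * (W p)\<^sup>2 - (W1 p)\<^sup>2) \<le> 0"
  proof (rule integral_rect_nonpos[where L = L and B = B])
    show "integrable lborel (\<lambda>p. (pi / L)\<^sup>2 * (W p)\<^sup>2 - (W1 p)\<^sup>2)" using i by simp
    show "(pi / L)\<^sup>2 * (W p)\<^sup>2 - (W1 p)\<^sup>2 = 0" if "p \<notin> rect L B" for p using that W W1 by (simp add: L2_rectD(3))
    show "AE y in lborel. y \<in> {0<..<B} \<longrightarrow> (LINT x|lborel. (pi / L)\<^sup>2 * (W (x, y))\<^sup>2 - (W1 (x, y))\<^sup>2) \<le> 0"
      using ac_zero_both_slices[OF L W1 l r] AE_integrable_snd_lborel[OF i(1)] AE_integrable_snd_lborel[OF i(2)]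
    proof (eventually_elim, intro impI)
      fix y assume g: "y \<in> {0<..<B} \<longrightarrow> ac (prim (\<lambda>x. W1 (x, y))) (\<lambda>x. W1 (x, y)) 0 \<and> (LINT x|lborel. W1 (x, y)) = 0 \<and>
          (AE x in lborel. x \<in> {0<..<L} \<longrightarrow> W (x, y) = prim (\<lambda>x. W1 (x, y)) x)"
        and iy: "integrable lborel (\<lambda>x. (W (x, y))\<^sup>2)" "integrable lborel (\<lambda>x. (W1 (x, y))\<^sup>2)"
        and y: "y \<in> {0<..<B}"
      let ?g = "prim (\<lambda>x. W1 (x, y))"
      have g1: "ac ?g (\<lambda>x. W1 (x, y)) 0" "(LINT x|lborel. W1 (x, y)) = 0"
        "AE x in lborel. x \<in> {0<..<L} \<longrightarrow> W (x, y) = ?g x" using g y by auto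
      have z: "W1 (x, y) = 0" "W (x, y) = 0" if "x \<notin> {0<..<L}" for x
        using that W W1 by (auto simp: rect_def intro!: L2_rectD(3))
      have gz: "?g x = 0" if x: "x \<notin> {0<..<L}" for x
        using x ac_le_support[OF g1(1) z(1), of 0 L x] ac_ge_support[OF g1(1) z(1), of 0 L x] g1(2)
        by (cases "x \<le> 0") auto
      note [measurable] = slice_borel_measurable[OF L2_rectD(1)[OF W]] ac_borel_measurable[OF g1(1)]
      have "(LINT x|lborel. (W (x, y))\<^sup>2) = (LINT x|lborel. (?g x)\<^sup>2)"
      proof (rule integral_cong_AE)
        show "AE x in lborel. (W (x, y))\<^sup>2 = (?g x)\<^sup>2"
          using g1(3)
        proof eventually_elim
          fix x assume "x \<in> {0<..<L} \<longrightarrow> W (x, y) = ?g x"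
          then show "(W (x, y))\<^sup>2 = (?g x)\<^sup>2" using z[of x] gz[of x] by (cases "x \<in> {0<..<L}") auto
        qed
      qed measurable
      then show "(LINT x|lborel. (pi / L)\<^sup>2 * (W (x, y))\<^sup>2 - (W1 (x, y))\<^sup>2) \<le> 0"
        using wirtinger[OF L g1(1) z(1) g1(2) iy(2)] iy by simp
    qed
  qed
  then show ?thesis using i by simp
qed

lemma dir_deriv_tensor_fst:
  assumes "smooth \<phi>" "smooth \<psi>"
  shows "dir_deriv (e, 0) (\<lambda>(x, y). \<phi> x * \<psi> y) = (\<lambda>(x, y). dir_deriv e \<phi> x * \<psi> y)"
    "dir_deriv (0, e') (\<lambda>(x, y). \<phi> x * \<psi> y) = (\<lambda>(x, y). \<phi> x * dir_deriv e' \<psi> y)"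
  using dir_deriv_tensor[OF assms] linear_0[OF has_derivative_linear[OF smooth_has_derivative[OF assms(1)]]]
    linear_0[OF has_derivative_linear[OF smooth_has_derivative[OF assms(2)]]] by auto

lemma weak_deriv_test_tensor:
  assumes f: "borel_version (rect L B) f F" and g: "borel_version (rect L B) g G"
    and \<phi>: "test_function {0<..<L} \<phi>" and \<psi>: "test_function {0<..<B} \<psi>"
  shows "has_weak_deriv (dirs 1 0) (rect L B) f g \<Longrightarrow>
      (LINT p|lborel. F p * (dir_deriv 1 \<phi> (fst p) * \<psi> (snd p))) = - (LINT p|lborel. G p * (\<phi> (fst p) * \<psi> (snd p)))"
    and "has_weak_deriv (dirs 0 1) (rect L B) f g \<Longrightarrow>
      (LINT p|lborel. F p * (\<phi> (fst p) * dir_deriv 1 \<psi> (snd p))) = - (LINT p|lborel. G p * (\<phi> (fst p) * \<psi> (snd p)))"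
proof -
  let ?t = "\<lambda>(x, y). \<phi> x * \<psi> y"
  have t: "test_function (rect L B) ?t" unfolding rect_def by (rule test_function_tensor[OF \<phi> \<psi>])
  have s: "smooth \<phi>" "smooth \<psi>" using \<phi> \<psi> by (auto simp: test_function_def)
  have *: "(LINT p|lborel. F p * dir_deriv e ?t p) = - (LINT p|lborel. G p * ?t p)"
    if "has_weak_deriv [e] (rect L B) f g" for e
    using has_weak_derivD[OF that t] borel_version_integral_test_function[OF f test_function_dir_deriv[OF t]]
      borel_version_integral_test_function[OF g t] by simp
  show "has_weak_deriv (dirs 1 0) (rect L B) f g \<Longrightarrow>
      (LINT p|lborel. F p * (dir_deriv 1 \<phi> (fst p) * \<psi> (snd p))) = - (LINT p|lborel. G p * (\<phi> (fst p) * \<psi> (snd p)))"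
    using *[of "(1, 0)"] unfolding dir_deriv_tensor_fst[OF s] by (simp add: dirs_def split_def)
  show "has_weak_deriv (dirs 0 1) (rect L B) f g \<Longrightarrow>
      (LINT p|lborel. F p * (\<phi> (fst p) * dir_deriv 1 \<psi> (snd p))) = - (LINT p|lborel. G p * (\<phi> (fst p) * \<psi> (snd p)))"
    using *[of "(0, 1)"] unfolding dir_deriv_tensor_fst[OF s] by (simp add: dirs_def split_def)
qed

lemma ac_rect_if_weak_deriv_x:
  assumes L: "0 < L" and f: "borel_version (rect L B) f F" "L2_rect L B F"
    and g: "borel_version (rect L B) g G" "L2_rect L B G"
    and wd: "has_weak_deriv (dirs 1 0) (rect L B) f g"
  shows "ac_rect L B F G"
proof -
  have "\<exists>C. integrable lborel C \<and>
    (AE p in lborel. fst p \<in> {0<..<L} \<longrightarrow> F p = C (snd p) + prim (\<lambda>r. G (r, snd p)) (fst p))"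
  proof (rule weak_derivative_imp_ac[OF L L2_rectD(4)[OF f(2)] L2_rectD(4)[OF g(2)], of 0 B])
    show "F p = 0" "G p = 0" if "p \<notin> {0<..<L} \<times> box 0 B" for p
      using that f g by (auto simp: rect_def intro!: L2_rectD(3))
  qed (use weak_deriv_test_tensor(1)[OF f(1) g(1) _ _ wd] in simp)
  then obtain C where "AE p in lborel. fst p \<in> {0<..<L} \<longrightarrow> F p = C (snd p) + prim (\<lambda>r. G (r, snd p)) (fst p)"
    by blast
  then have "AE p in lborel. p \<in> rect L B \<longrightarrow> F p = C (snd p) + prim (\<lambda>r. G (r, snd p)) (fst p)"
    by eventually_elim (auto simp: rect_def)
  then show ?thesis unfolding ac_rect_def by blast
qed

lemma ac_rect_if_weak_deriv_y:
  assumes B: "0 < B" and f: "borel_version (rect L B) f F" "L2_rect L B F"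
    and g: "borel_version (rect L B) g G" "L2_rect L B G"
    and wd: "has_weak_deriv (dirs 0 1) (rect L B) f g"
  shows "ac_rect B L (swapped F) (swapped G)"
proof -
  note F' = L2_rect_swap[OF f(2)] and G' = L2_rect_swap[OF g(2)]
  have "\<exists>C. integrable lborel C \<and>
    (AE p in lborel. fst p \<in> {0<..<B} \<longrightarrow> swapped F p = C (snd p) + prim (\<lambda>r. swapped G (r, snd p)) (fst p))"
  proof (rule weak_derivative_imp_ac[OF B L2_rectD(4)[OF F'] L2_rectD(4)[OF G'], of 0 L])
    show "swapped F p = 0" "swapped G p = 0" if "p \<notin> {0<..<B} \<times> box 0 L" for p
      using that L2_rectD(3)[OF F', of p] L2_rectD(3)[OF G', of p] by (auto simp: rect_def)
    fix \<phi> \<psi> assume \<phi>: "test_function {0<..<B} \<phi>" and \<psi>: "test_function (box 0 L) \<psi>"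
    have \<psi>': "test_function {0<..<L} \<psi>" using \<psi> by simp
    have [measurable]: "\<phi> \<in> borel_measurable borel" "\<psi> \<in> borel_measurable borel" "dir_deriv 1 \<phi> \<in> borel_measurable borel"
      using test_function_borel_measurable[OF \<phi>] test_function_borel_measurable[OF \<psi>]
        test_function_borel_measurable[OF test_function_dir_deriv[OF \<phi>]] by auto
    have [measurable]: "F \<in> borel_measurable borel" "G \<in> borel_measurable borel"
      using L2_rectD(1)[OF f(2)] L2_rectD(1)[OF g(2)] by auto
    have 1: "(LINT p|lborel. swapped F p * (dir_deriv 1 \<phi> (fst p) * \<psi> (snd p))) = (LINT p|lborel. F p * (\<psi> (fst p) * dir_deriv 1 \<phi> (snd p)))"
      using integral_swap_lborel[of "\<lambda>p. F p * (\<psi> (fst p) * dir_deriv 1 \<phi> (snd p))"] by (simp add: mult.commute)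
    have 2: "(LINT p|lborel. swapped G p * (\<phi> (fst p) * \<psi> (snd p))) = (LINT p|lborel. G p * (\<psi> (fst p) * \<phi> (snd p)))"
      using integral_swap_lborel[of "\<lambda>p. G p * (\<psi> (fst p) * \<phi> (snd p))"] by (simp add: mult.commute)
    show "(LINT p|lborel. swapped F p * (dir_deriv 1 \<phi> (fst p) * \<psi> (snd p))) = - (LINT p|lborel. swapped G p * (\<phi> (fst p) * \<psi> (snd p)))"
      unfolding 1 2 by (rule weak_deriv_test_tensor(2)[OF f(1) g(1) \<psi>' \<phi> wd])
  qed
  then obtain C where "AE p in lborel. fst p \<in> {0<..<B} \<longrightarrow> swapped F p = C (snd p) + prim (\<lambda>r. swapped G (r, snd p)) (fst p)"
    by blast
  then have "AE p in lborel. p \<in> rect B L \<longrightarrow> swapped F p = C (snd p) + prim (\<lambda>r. swapped G (r, snd p)) (fst p)"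
    by eventually_elim (auto simp: rect_def)
  then show ?thesis unfolding ac_rect_def by blast
qed

lemma limit_norm_L2_interval:
  assumes sm: "\<And>n. smooth (\<phi> n)" and lim: "(\<lambda>n. norm_L2 {0<..<(l::real)} (\<phi> n)) \<longlonglongrightarrow> 0"
  shows "(\<lambda>n. LINT y|lborel. (indicator {0<..<l} y * \<phi> n y)\<^sup>2) \<longlonglongrightarrow> 0"
proof -
  have "(norm_L2 {0<..<l} (\<phi> n))\<^sup>2 = (LINT y|lborel. (indicator {0<..<l} y * \<phi> n y)\<^sup>2)" for n
    by (intro norm_L2_square borel_version_borel smooth_borel_measurable sm) simp
  then show ?thesis using tendsto_power[OF lim, of 2] by simp
qed

lemma L2_weak_deriv_L2_rect:
  assumes "L2_weak_deriv i j (rect L B) f" "borel_version (rect L B) (wd i j (rect L B) f) G"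
  shows "L2_rect L B G"
proof -
  obtain g where g: "has_weak_deriv (dirs i j) (rect L B) f g" "L2_fun (rect L B) g"
    using assms(1) by (auto simp: L2_weak_deriv_def)
  have "borel_version (rect L B) g G"
    by (rule borel_version_cong_AE[OF assms(2) weak_deriv_AE_eq[OF open_rect g(1)]])
  then show ?thesis using g(2) L2_fun_iff unfolding L2_rect_def borel_version_def by blast
qed

lemma sobolev_L2_weak_deriv: "f \<in> sobolev k \<Omega> \<Longrightarrow> i + j \<le> k \<Longrightarrow> L2_weak_deriv i j \<Omega> f"
  by (simp add: sobolev_def)

lemma sobolev_borel_version:
  assumes "f \<in> sobolev k (rect L B)" "i + j \<le> k"
  shows "\<exists>G. borel_version (rect L B) (wd i j (rect L B) f) G"
  by (rule locally_integrable_borel_version[OF open_rect has_weak_deriv_locally_integrable(2)[OF sobolev_weak_deriv[OF assms]]])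

lemma sobolev_borel_version_0:
  assumes f: "f \<in> sobolev k (rect L B)" and F: "borel_version (rect L B) f F"
  shows "borel_version (rect L B) (wd 0 0 (rect L B) f) F"
proof -
  have wd: "has_weak_deriv (dirs 0 0) (rect L B) f f"
    using has_weak_deriv_locally_integrable(1)[OF sobolev_weak_deriv[OF f, of 0 0]] has_weak_deriv_Nil
    by (simp add: dirs_def)
  have "AE x in lborel. x \<in> rect L B \<longrightarrow> f x = wd 0 0 (rect L B) f x"
    using weak_deriv_AE_eq[OF open_rect wd] by eventually_elim simp
  then show ?thesis by (rule borel_version_cong_AE[OF F])
qed

lemma sobolev_L2_rect:
  assumes f: "f \<in> sobolev k (rect L B)" and F: "borel_version (rect L B) f F"
  shows "L2_rect L B F"
  by (rule L2_weak_deriv_L2_rect[OF sobolev_L2_weak_deriv[OF f] sobolev_borel_version_0[OF f F]]) simp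

lemma ac_zero_rect_if_zero_at_x:
  assumes L: "0 < L" "0 < B" and c: "0 \<le> c" "c \<le> L" and z: "zero_at_x L B c f"
    and F: "borel_version (rect L B) f F" and F1: "borel_version (rect L B) (wd 1 0 (rect L B) f) F1"
  shows "ac_zero_rect L B c F F1"
proof -
  have tr: "has_trace (rect L B) (\<lambda>y. (c, y)) B f (\<lambda>_. 0)" using z by (simp add: zero_at_x_def)
  then have f: "f \<in> sobolev 1 (rect L B)" by (simp add: has_trace_def)
  obtain F2 where F2: "borel_version (rect L B) (wd 0 1 (rect L B) f) F2" using sobolev_borel_version[OF f, of 0 1] by auto
  note FL = sobolev_L2_rect[OF f F]
  have F1L: "L2_rect L B F1" by (rule L2_weak_deriv_L2_rect[OF sobolev_L2_weak_deriv[OF f] F1]) simp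
  obtain \<phi> where \<phi>: "\<And>n::nat. smooth (\<phi> n)"
    "(\<lambda>n. LINT p|lborel. (indicator (rect L B) p * \<phi> n p - F p)\<^sup>2) \<longlonglongrightarrow> 0"
    "(\<lambda>n. LINT p|lborel. (indicator (rect L B) p * dir_deriv (1, 0) (\<phi> n) p - F1 p)\<^sup>2) \<longlonglongrightarrow> 0"
    "(\<lambda>n. LINT p|lborel. (indicator (rect L B) p * dir_deriv (0, 1) (\<phi> n) p - F2 p)\<^sup>2) \<longlonglongrightarrow> 0"
    "(\<lambda>n. norm_L2 {0<..<B} (\<lambda>y. \<phi> n (c, y))) \<longlonglongrightarrow> 0"
    by (rule has_trace_zeroE[OF L tr F F1 F2]) (rule that)
  have sl: "smooth (\<lambda>y. \<phi> n (c, y))" for n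
    by (rule smooth_compose_affine[OF \<phi>(1), where A = "\<lambda>e. (0, e)"]) (intro derivative_intros)
  show ?thesis unfolding ac_zero_rect_def
    by (rule prim_if_trace_zero[OF L(1) c L2_rectD(1)[OF FL] L2_rectD(1)[OF F1L] L2_rectD(2)[OF FL] L2_rectD(2)[OF F1L]
        L2_rectD(3)[OF FL] L2_rectD(3)[OF F1L] \<phi>(1-3) limit_norm_L2_interval[OF sl \<phi>(5)]])
qed

lemma ac_zero_rect_if_zero_at_y:
  assumes L: "0 < L" "0 < B" and c: "0 \<le> c" "c \<le> B" and z: "zero_at_y L B c f"
    and F: "borel_version (rect L B) f F" and F2: "borel_version (rect L B) (wd 0 1 (rect L B) f) F2"
  shows "ac_zero_rect B L c (swapped F) (swapped F2)"
proof -
  have tr: "has_trace (rect L B) (\<lambda>x. (x, c)) L f (\<lambda>_. 0)" using z by (simp add: zero_at_y_def)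
  then have f: "f \<in> sobolev 1 (rect L B)" by (simp add: has_trace_def)
  obtain F1 where F1: "borel_version (rect L B) (wd 1 0 (rect L B) f) F1" using sobolev_borel_version[OF f, of 1 0] by auto
  note FL = sobolev_L2_rect[OF f F]
  have F2L: "L2_rect L B F2" by (rule L2_weak_deriv_L2_rect[OF sobolev_L2_weak_deriv[OF f] F2]) simp
  obtain \<phi> where \<phi>: "\<And>n::nat. smooth (\<phi> n)"
    "(\<lambda>n. LINT p|lborel. (indicator (rect L B) p * \<phi> n p - F p)\<^sup>2) \<longlonglongrightarrow> 0"
    "(\<lambda>n. LINT p|lborel. (indicator (rect L B) p * dir_deriv (1, 0) (\<phi> n) p - F1 p)\<^sup>2) \<longlonglongrightarrow> 0"
    "(\<lambda>n. LINT p|lborel. (indicator (rect L B) p * dir_deriv (0, 1) (\<phi> n) p - F2 p)\<^sup>2) \<longlonglongrightarrow> 0"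
    "(\<lambda>n. norm_L2 {0<..<L} (\<lambda>x. \<phi> n (x, c))) \<longlonglongrightarrow> 0"
    by (rule has_trace_zeroE[OF L tr F F1 F2]) (rule that)
  have sl: "smooth (\<lambda>x. swapped (\<phi> n) (c, x))" for n
    by (rule smooth_compose_affine[OF smooth_swap[OF \<phi>(1)], where A = "\<lambda>e. (0, e)"]) (intro derivative_intros)
  have sw: "(LINT p|lborel. (indicator (rect B L) p * swapped g p - swapped G p)\<^sup>2) = (LINT p|lborel. (indicator (rect L B) p * g p - G p)\<^sup>2)"
    if "smooth g" "G \<in> borel_measurable borel" for g G
  proof -
    have [measurable]: "g \<in> borel_measurable borel" "G \<in> borel_measurable borel" "rect L B \<in> sets borel"
      using that by (auto intro: smooth_borel_measurable rect_borel)
    have "indicator (rect B L) p = (indicator (rect L B) (prod.swap p) :: real)" for p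
      using swap_in_rect[of p L B] by (auto simp: indicator_def)
    then show ?thesis
      using integral_swap_lborel[of "\<lambda>p. (indicator (rect L B) p * g p - G p)\<^sup>2"] by simp
  qed
  note FL' = L2_rect_swap[OF FL] and F2L' = L2_rect_swap[OF F2L]
  show ?thesis unfolding ac_zero_rect_def
  proof (rule prim_if_trace_zero[OF L(2) c L2_rectD(1)[OF FL'] L2_rectD(1)[OF F2L'] L2_rectD(2)[OF FL'] L2_rectD(2)[OF F2L']
        L2_rectD(3)[OF FL'] L2_rectD(3)[OF F2L'] smooth_swap[OF \<phi>(1)]])
    show "(\<lambda>n. LINT p|lborel. (indicator (rect B L) p * swapped (\<phi> n) p - swapped F p)\<^sup>2) \<longlonglongrightarrow> 0"
      unfolding sw[OF \<phi>(1) L2_rectD(1)[OF FL]] by (rule \<phi>(2))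
    show "(\<lambda>n. LINT p|lborel. (indicator (rect B L) p * dir_deriv (1, 0) (swapped (\<phi> n)) p - swapped F2 p)\<^sup>2) \<longlonglongrightarrow> 0"
      unfolding dir_deriv_swap[OF \<phi>(1)] sw[OF smooth_dir_deriv[OF \<phi>(1)] L2_rectD(1)[OF F2L]]
      using \<phi>(4) by simp
    show "(\<lambda>n. LINT y|lborel. (indicator {0<..<L} y * swapped (\<phi> n) (c, y))\<^sup>2) \<longlonglongrightarrow> 0"
      by (rule limit_norm_L2_interval[OF sl]) (use \<phi>(5) in simp)
  qed
qed

lemma integral_prim_slices:
  fixes K :: "real \<times> 'b::euclidean_space \<Rightarrow> real"
  assumes K: "integrable lborel K"
  shows "(LINT y|lborel. prim (\<lambda>r. K (r, y)) x) = prim (\<lambda>r. LINT y|lborel. K (r, y)) x"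
proof -
  define J where "J p = (if fst p \<le> x then K p else 0)" for p
  have [measurable]: "K \<in> borel_measurable borel" using K by auto
  have J: "integrable lborel J"
  proof (rule Bochner_Integration.integrable_bound[OF K])
    have "J \<in> borel_measurable borel" unfolding J_def[abs_def] by measurable
    then show "J \<in> borel_measurable lborel" by simp
  qed (simp add: J_def)
  have "(LINT y|lborel. prim (\<lambda>r. K (r, y)) x) = (LINT y|lborel. LINT r|lborel. J (r, y))"
    by (simp add: prim_def J_def)
  also have "\<dots> = (LINT r|lborel. LINT y|lborel. J (r, y))"
    using integral_fst_lborel[OF J] integral_snd_lborel[OF J] by simp
  also have "\<dots> = prim (\<lambda>r. LINT y|lborel. K (r, y)) x"
    unfolding prim_def by (rule Bochner_Integration.integral_cong) (auto simp: J_def)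
  finally show ?thesis .
qed

lemma prim_mult_right: "prim (\<lambda>s. F s * c) x = prim F x * c"
proof -
  have "prim (\<lambda>s. F s * c) x = (LINT s|lborel. (if s \<le> x then F s else 0) * c)"
    unfolding prim_def by (rule Bochner_Integration.integral_cong) auto
  then show ?thesis by (simp add: prim_def)
qed

lemma prim_uminus: "prim (\<lambda>s. - F s) x = - prim F x"
  using prim_mult_right[of F "- 1" x] by simp

lemma integral_prim_slices_mult:
  fixes K :: "real \<times> 'b::euclidean_space \<Rightarrow> real"
  assumes K: "integrable lborel K" and \<psi>: "test_function \<Omega> \<psi>"
  shows "(LINT y|lborel. prim (\<lambda>r. K (r, y)) x * \<psi> y) = prim (\<lambda>r. LINT y|lborel. K (r, y) * \<psi> y) x"
proof -
  obtain C where C: "\<And>y. \<bar>\<psi> y\<bar> \<le> C" using test_function_bounded[OF \<psi>] by auto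
  have "integrable lborel (\<lambda>p. K p * \<psi> (snd p))"
    by (rule integrable_mult_bounded[OF K _ C]) (use test_function_borel_measurable[OF \<psi>] in simp)
  from integral_prim_slices[OF this, of x] show ?thesis by (simp add: prim_mult_right)
qed

text \<open>Weak differentiation under the integral sign. The boundary conditions give no direct information
  on \<open>w\<^sub>y\<close> at \<open>x = 0\<close> and \<open>x = L\<close>, which is needed to see that \<open>w\<^sub>x\<^sub>y w\<^sub>y\<close> has integral zero.\<close>

lemma ac_zero_rect_tangential:
  assumes L: "0 < L" "0 < B"
    and w: "borel_version (rect L B) w W" "L2_rect L B W"
    and wx: "borel_version (rect L B) wx Wx" "L2_rect L B Wx"
    and wy: "borel_version (rect L B) wy Wy" "L2_rect L B Wy"
    and wxy: "borel_version (rect L B) wxy Wxy" "L2_rect L B Wxy"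
    and z: "ac_zero_rect L B c W Wx"
    and d: "has_weak_deriv (dirs 0 1) (rect L B) w wy" "has_weak_deriv (dirs 0 1) (rect L B) wx wxy"
  shows "ac_zero_rect L B c Wy Wxy"
proof -
  define S where "S K p = indicator {0<..<L} (fst p) * prim (\<lambda>r. K (r, snd p)) (fst p)
      - indicator {0<..<L} (fst p) * prim (\<lambda>r. K (r, snd p)) c" for K :: "real \<times> real \<Rightarrow> real" and p
  have Si: "integrable lborel (S K)" if "L2_rect L B K" for K
    unfolding S_def using integrable_prim_slices[OF L(1) L2_rectD(4)[OF that], of "\<lambda>x. x"]
      integrable_prim_slices[OF L(1) L2_rectD(4)[OF that], of "\<lambda>x. c"] by simp
  have S0: "S K p = 0" if K: "L2_rect L B K" and p: "p \<notin> rect L B" for K p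
  proof (cases "fst p \<in> {0<..<L}")
    case True
    then have "K (r, snd p) = 0" for r using p by (cases p) (auto intro!: L2_rectD(3)[OF K] simp: rect_def)
    then show ?thesis by (simp add: S_def prim_def)
  qed (simp add: S_def)
  have key: "(LINT p|lborel. S K p * (\<phi> (fst p) * \<eta> (snd p)))
      = (LINT x|lborel. \<phi> x * (prim (\<lambda>r. LINT y|lborel. K (r, y) * \<eta> y) x - prim (\<lambda>r. LINT y|lborel. K (r, y) * \<eta> y) c))"
    if K: "L2_rect L B K" and \<phi>: "test_function {0<..<L} \<phi>" and \<eta>: "test_function {0<..<B} \<eta>" for K \<phi> \<eta>
  proof -
    have i: "integrable lborel (\<lambda>p. S K p * (\<phi> (fst p) * \<eta> (snd p)))"
      by (rule integrable_mult_tensor_test_function[OF Si[OF K] \<phi> \<eta>])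
    obtain C where C: "\<And>y. \<bar>\<eta> y\<bar> \<le> C" using test_function_bounded[OF \<eta>] by auto
    have Ji: "AE x in lborel. integrable lborel (\<lambda>y. indicator {0<..<L} x * prim (\<lambda>r. K (r, y)) (z x))"
      if "z \<in> borel_measurable borel" for z
      using AE_integrable_fst_lborel[OF integrable_prim_slices[OF L(1) L2_rectD(4)[OF K] that]] by simp
    have Ji1: "AE x in lborel. integrable lborel (\<lambda>y. indicator {0<..<L} x * prim (\<lambda>r. K (r, y)) x)"
      by (rule Ji) simp
    have Ji2: "AE x in lborel. integrable lborel (\<lambda>y. indicator {0<..<L} x * prim (\<lambda>r. K (r, y)) c)"
      by (rule Ji) simp
    have "(LINT p|lborel. S K p * (\<phi> (fst p) * \<eta> (snd p))) = (LINT x|lborel. LINT y|lborel. S K (x, y) * (\<phi> x * \<eta> y))"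
      using integral_fst_lborel[OF i] by simp
    also have "\<dots> = (LINT x|lborel. \<phi> x * (prim (\<lambda>r. LINT y|lborel. K (r, y) * \<eta> y) x - prim (\<lambda>r. LINT y|lborel. K (r, y) * \<eta> y) c))"
    proof (rule integral_cong_AE)
      have K\<eta>: "integrable lborel (\<lambda>p. K p * \<eta> (snd p))"
        by (rule integrable_mult_bounded[OF L2_rectD(4)[OF K] _ C]) (use test_function_borel_measurable[OF \<eta>] in simp)
      have [measurable]: "(\<lambda>r. LINT y|lborel. K (r, y) * \<eta> y) \<in> borel_measurable borel"
        using borel_measurable_integrable[OF integrable_fst_lborel[OF K\<eta>]] by simp
      have [measurable]: "\<phi> \<in> borel_measurable borel" by (rule test_function_borel_measurable[OF \<phi>])
      show "(\<lambda>x. \<phi> x * (prim (\<lambda>r. LINT y|lborel. K (r, y) * \<eta> y) x - prim (\<lambda>r. LINT y|lborel. K (r, y) * \<eta> y) c)) \<in> borel_measurable lborel"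
        by measurable
      show "(\<lambda>x. LINT y|lborel. S K (x, y) * (\<phi> x * \<eta> y)) \<in> borel_measurable lborel"
        using borel_measurable_integrable[OF integrable_fst_lborel[OF i]] by simp
      show "AE x in lborel. (LINT y|lborel. S K (x, y) * (\<phi> x * \<eta> y)) =
        \<phi> x * (prim (\<lambda>r. LINT y|lborel. K (r, y) * \<eta> y) x - prim (\<lambda>r. LINT y|lborel. K (r, y) * \<eta> y) c)"
        using Ji1 Ji2
      proof eventually_elim
        fix x assume ix: "integrable lborel (\<lambda>y. indicator {0<..<L} x * prim (\<lambda>r. K (r, y)) x)"
          "integrable lborel (\<lambda>y. indicator {0<..<L} x * prim (\<lambda>r. K (r, y)) c)"
        show "(LINT y|lborel. S K (x, y) * (\<phi> x * \<eta> y)) =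
          \<phi> x * (prim (\<lambda>r. LINT y|lborel. K (r, y) * \<eta> y) x - prim (\<lambda>r. LINT y|lborel. K (r, y) * \<eta> y) c)"
        proof (cases "x \<in> {0<..<L}")
          case False
          then show ?thesis using test_function_outside[OF \<phi> False] by simp
        next
          case True
          have i1: "integrable lborel (\<lambda>y. prim (\<lambda>r. K (r, y)) x * \<eta> y)" "integrable lborel (\<lambda>y. prim (\<lambda>r. K (r, y)) c * \<eta> y)"
            using ix True integrable_mult_test_function[OF _ \<eta>] by auto
          have "(LINT y|lborel. S K (x, y) * (\<phi> x * \<eta> y)) = (LINT y|lborel. \<phi> x * (prim (\<lambda>r. K (r, y)) x * \<eta> y - prim (\<lambda>r. K (r, y)) c * \<eta> y))"
            using True by (intro Bochner_Integration.integral_cong) (auto simp: S_def algebra_simps)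
          also have "\<dots> = \<phi> x * ((LINT y|lborel. prim (\<lambda>r. K (r, y)) x * \<eta> y) - (LINT y|lborel. prim (\<lambda>r. K (r, y)) c * \<eta> y))"
            using i1 by simp
          finally show ?thesis unfolding integral_prim_slices_mult[OF L2_rectD(4)[OF K] \<eta>] .
        qed
      qed
    qed
    finally show ?thesis .
  qed
  define h where "h p = Wy p - S Wxy p" for p
  have hi: "integrable lborel h" unfolding h_def using L2_rectD(4)[OF wy(2)] Si[OF wxy(2)] by simp
  have "AE p in lborel. h p = 0"
  proof (rule fundamental_lemma[OF hi])
    show "h p = 0" if "p \<notin> box 0 L \<times> box 0 B" for p
      using that S0[OF wxy(2), of p] L2_rectD(3)[OF wy(2), of p] by (auto simp: h_def rect_def)
    fix \<phi> \<psi> assume "test_function (box 0 L) \<phi>" "test_function (box 0 B) \<psi>"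
    then have \<phi>: "test_function {0<..<L} \<phi>" and \<psi>: "test_function {0<..<B} \<psi>" by auto
    note \<psi>' = test_function_dir_deriv[OF \<psi>, of 1]
    let ?A = "\<lambda>r. LINT y|lborel. Wx (r, y) * dir_deriv 1 \<psi> y"
    let ?A' = "\<lambda>r. LINT y|lborel. Wxy (r, y) * \<psi> y"
    have A: "AE r in lborel. ?A r = - ?A' r"
      using ac_rect_slices[OF L2_rectD(4)[OF L2_rect_swap[OF wxy(2)]] ac_rect_if_weak_deriv_y[OF L(2) wx wxy d(2)]]
    proof eventually_elim
      fix r assume sl: "r \<in> {0<..<L} \<longrightarrow> (\<exists>f \<alpha>. ac f (\<lambda>y. swapped Wxy (y, r)) \<alpha> \<and>
          (AE y in lborel. y \<in> {0<..<B} \<longrightarrow> swapped Wx (y, r) = f y))"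
      show "?A r = - ?A' r"
      proof (cases "r \<in> {0<..<L}")
        case False
        then have "Wx (r, y) = 0" "Wxy (r, y) = 0" for y
          by (auto intro!: L2_rectD(3)[OF wx(2)] L2_rectD(3)[OF wxy(2)] simp: rect_def)
        then show ?thesis by simp
      next
        case True
        then obtain f \<alpha> where f: "ac f (\<lambda>y. Wxy (r, y)) \<alpha>" "AE y in lborel. y \<in> {0<..<B} \<longrightarrow> Wx (r, y) = f y"
          using sl by auto
        note \<psi>ac = ac_test_function[OF less_imp_le[OF L(2)] \<psi>]
        have z: "Wxy (r, y) = 0" if "y \<notin> {0<..<B}" for y
          using that by (auto intro!: L2_rectD(3)[OF wxy(2)] simp: rect_def)
        have z': "dir_deriv 1 \<psi> y = 0" if "y \<notin> {0<..<B}" for y by (rule test_function_outside[OF \<psi>' that])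
        have "\<psi> B = 0 + (LINT s|lborel. dir_deriv 1 \<psi> s)"
          by (rule ac_ge_support[OF \<psi>ac z']) auto
        then have i0: "(LINT s|lborel. dir_deriv 1 \<psi> s) = 0" using test_function_outside[OF \<psi>, of B] by simp
        have "?A r = (LINT y|lborel. f y * dir_deriv 1 \<psi> y)"
        proof (rule integral_cong_AE)
          have [measurable]: "dir_deriv 1 \<psi> \<in> borel_measurable borel" by (rule test_function_borel_measurable[OF \<psi>'])
          have [measurable]: "f \<in> borel_measurable borel" by (rule ac_borel_measurable[OF f(1)])
          have [measurable]: "(\<lambda>y. Wx (r, y)) \<in> borel_measurable borel"
            using slice_borel_measurable[OF borel_measurable_swap[OF L2_rectD(1)[OF wx(2)]]] by simp
          show "(\<lambda>y. Wx (r, y) * dir_deriv 1 \<psi> y) \<in> borel_measurable lborel" by measurable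
          show "(\<lambda>y. f y * dir_deriv 1 \<psi> y) \<in> borel_measurable lborel" by measurable
          show "AE y in lborel. Wx (r, y) * dir_deriv 1 \<psi> y = f y * dir_deriv 1 \<psi> y"
            using f(2) by eventually_elim (use z' in fastforce)
        qed
        moreover have "(LINT y|lborel. Wxy (r, y) * \<psi> y + f y * dir_deriv 1 \<psi> y) = 0"
          using ac_integral_mult[OF f(1) \<psi>ac z z'] i0 by simp
        moreover have "integrable lborel (\<lambda>y. Wxy (r, y) * \<psi> y)" "integrable lborel (\<lambda>y. f y * dir_deriv 1 \<psi> y)"
          using integrable_mult_test_function[OF ac_integrable[OF f(1)] \<psi>] integrable_mult_ac[OF ac_integrable[OF \<psi>ac] f(1)]
          by auto
        ultimately show ?thesis by simp
      qed
    qed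
    have Am: "?A \<in> borel_measurable borel" "?A' \<in> borel_measurable borel"
    proof -
      have "integrable lborel (\<lambda>p. K p * \<eta> (snd p))" if K: "L2_rect L B K" and \<eta>: "test_function {0<..<B} \<eta>" for K \<eta>
      proof -
        obtain C where C: "\<And>y. \<bar>\<eta> y\<bar> \<le> C" using test_function_bounded[OF \<eta>] by auto
        show ?thesis by (rule integrable_mult_bounded[OF L2_rectD(4)[OF K] _ C])
          (use test_function_borel_measurable[OF \<eta>] in simp)
      qed
      note i = this[OF wx(2) \<psi>'] this[OF wxy(2) \<psi>]
      show "?A \<in> borel_measurable borel" "?A' \<in> borel_measurable borel"
        using borel_measurable_integrable[OF integrable_fst_lborel[OF i(1)]]
          borel_measurable_integrable[OF integrable_fst_lborel[OF i(2)]] by simp_all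
    qed
    have pA: "prim ?A x = - prim ?A' x" for x
      using prim_cong_AE[OF A Am(1), of x] Am(2) prim_uminus[of ?A' x] by simp
    have "(LINT p|lborel. Wy p * (\<phi> (fst p) * \<psi> (snd p))) = - (LINT p|lborel. W p * (\<phi> (fst p) * dir_deriv 1 \<psi> (snd p)))"
      using weak_deriv_test_tensor(2)[OF w(1) wy(1) \<phi> \<psi> d(1)] by simp
    also have "(LINT p|lborel. W p * (\<phi> (fst p) * dir_deriv 1 \<psi> (snd p))) = (LINT p|lborel. S Wx p * (\<phi> (fst p) * dir_deriv 1 \<psi> (snd p)))"
    proof (rule integral_cong_AE)
      show "(\<lambda>p. W p * (\<phi> (fst p) * dir_deriv 1 \<psi> (snd p))) \<in> borel_measurable lborel"
        using integrable_mult_tensor_test_function[OF L2_rectD(4)[OF w(2)] \<phi> \<psi>'] by auto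
      show "(\<lambda>p. S Wx p * (\<phi> (fst p) * dir_deriv 1 \<psi> (snd p))) \<in> borel_measurable lborel"
        using integrable_mult_tensor_test_function[OF Si[OF wx(2)] \<phi> \<psi>'] by auto
      show "AE p in lborel. W p * (\<phi> (fst p) * dir_deriv 1 \<psi> (snd p)) = S Wx p * (\<phi> (fst p) * dir_deriv 1 \<psi> (snd p))"
        using z[unfolded ac_zero_rect_def]
      proof eventually_elim
        fix p assume p: "p \<in> rect L B \<longrightarrow> W p = prim (\<lambda>r. Wx (r, snd p)) (fst p) - prim (\<lambda>r. Wx (r, snd p)) c"
        have "W p = S Wx p"
        proof (cases "p \<in> rect L B")
          case True
          then have "fst p \<in> {0<..<L}" by (auto simp: rect_def)
          then show ?thesis using p True by (simp add: S_def)
        qed (simp add: S0[OF wx(2)] L2_rectD(3)[OF w(2)])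
        then show "W p * (\<phi> (fst p) * dir_deriv 1 \<psi> (snd p)) = S Wx p * (\<phi> (fst p) * dir_deriv 1 \<psi> (snd p))" by simp
      qed
    qed
    also have "- \<dots> = (LINT p|lborel. S Wxy p * (\<phi> (fst p) * \<psi> (snd p)))"
      unfolding key[OF wx(2) \<phi> \<psi>'] key[OF wxy(2) \<phi> \<psi>] pA
      by (subst integral_minus[symmetric]) (simp add: algebra_simps)
    finally show "(LINT p|lborel. h p * (\<phi> (fst p) * \<psi> (snd p))) = 0"
      using integrable_mult_tensor_test_function[OF L2_rectD(4)[OF wy(2)] \<phi> \<psi>]
        integrable_mult_tensor_test_function[OF Si[OF wxy(2)] \<phi> \<psi>] by (simp add: h_def left_diff_distrib)
  qed
  then show ?thesis unfolding ac_zero_rect_def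
    by eventually_elim (auto simp: h_def S_def rect_def)
qed

section \<open>The energy inequality at a fixed time\<close>

lemma integral_swapped_mult:
  assumes "L2_rect L B F" "L2_rect L B G"
  shows "(LINT p|lborel. swapped F p * swapped G p) = (LINT p|lborel. F p * G p)"
  using integral_swap_lborel[of "\<lambda>p. F p * G p"] L2_rectD(1)[OF assms(1)] L2_rectD(1)[OF assms(2)] by simp

lemma integral_by_parts_rect_swapped:
  assumes "0 < B" "L2_rect L B F" "L2_rect L B F'" "L2_rect L B G" "L2_rect L B G'"
    and "ac_rect B L (swapped F) (swapped F')"
    and "ac_zero_rect B L 0 (swapped G) (swapped G')" "ac_zero_rect B L B (swapped G) (swapped G')"
  shows "(LINT p|lborel. F' p * G p) = - (LINT p|lborel. F p * G' p)"
  using integral_by_parts_rect[OF assms(1) L2_rect_swap[OF assms(2)] L2_rect_swap[OF assms(3)]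
      L2_rect_swap[OF assms(4)] L2_rect_swap[OF assms(5)] assms(6-8)]
  by (simp only: integral_swapped_mult[OF assms(3,4)] integral_swapped_mult[OF assms(2,5)])

lemma wirtinger_rect_swapped:
  assumes "0 < B" "L2_rect L B W" "L2_rect L B W1"
    and "ac_zero_rect B L 0 (swapped W) (swapped W1)" "ac_zero_rect B L B (swapped W) (swapped W1)"
  shows "(pi / B)\<^sup>2 * (LINT p|lborel. W p * W p) \<le> (LINT p|lborel. W1 p * W1 p)"
  using wirtinger_rect[OF assms(1) L2_rect_swap[OF assms(2)] L2_rect_swap[OF assms(3)] assms(4,5)]
  by (simp only: power2_eq_square[of "swapped _ _"] integral_swapped_mult[OF assms(2,2)] integral_swapped_mult[OF assms(3,3)])

lemma weak_deriv_lap: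
  assumes f: "has_weak_deriv (dirs i j) \<Omega> (wd 2 0 \<Omega> f) g" and g: "has_weak_deriv (dirs i j) \<Omega> (wd 0 2 \<Omega> f) h"
    and "open \<Omega>"
  shows "AE p in lborel. p \<in> \<Omega> \<longrightarrow> wd i j \<Omega> (lap \<Omega> f) p = g p + h p"
  using weak_deriv_AE_eq[OF \<open>open \<Omega>\<close> has_weak_deriv_add_cmult[OF \<open>open \<Omega>\<close> f g, of 1]]
  by (simp add: lap_def[abs_def])

lemma energy_inequality:
  fixes w v :: "real \<times> real \<Rightarrow> real"
  assumes B: "0 < B" and L: "0 < L" and \<gamma>: "0 < \<gamma>" "\<gamma> < a" and a: "a = pi\<^sup>2 / B\<^sup>2 + pi\<^sup>2 / L\<^sup>2"
    and w4: "w \<in> sobolev 4 (rect L B)" and w5: "L2_weak_deriv 5 0 (rect L B) w"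
    and bc: "boundary_conditions L B w"
    and W: "borel_version (rect L B) w W"
    and V: "borel_version (rect L B) v V" "L2_rect L B V"
    and eq: "AE p in lborel. p \<in> rect L B \<longrightarrow>
      v p + lap (rect L B) (lap (rect L B) w) p + \<gamma> * lap (rect L B) w p + lap (rect L B) (wd 1 0 (rect L B) w) p
        + w p * wd 1 0 (rect L B) w p - wd 5 0 (rect L B) w p = 0"
  shows "(LINT p|lborel. V p * W p) \<le> - (a\<^sup>2 * (1 - \<gamma> / a)) * (LINT p|lborel. (W p)\<^sup>2)"
proof -
  let ?D = "rect L B"
  define S :: "nat \<Rightarrow> nat \<Rightarrow> bool" where "S i j \<longleftrightarrow> i + j \<le> 4 \<or> i = 5 \<and> j = 0" for i j
  have L2w: "L2_weak_deriv i j ?D w" if "S i j" for i j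
    using that w5 sobolev_L2_weak_deriv[OF w4] by (auto simp: S_def)
  have hwd: "has_weak_deriv (dirs i j) ?D w (wd i j ?D w)" if "S i j" for i j
    using L2w[OF that] weak_deriv_works unfolding L2_weak_deriv_def by blast
  have "\<exists>G. S i j \<longrightarrow> borel_version ?D (wd i j ?D w) G" for i j
    using locally_integrable_borel_version[OF open_rect has_weak_deriv_locally_integrable(2)[OF hwd]] by blast
  then obtain U where U: "\<And>i j. S i j \<Longrightarrow> borel_version ?D (wd i j ?D w) (U i j)" by metis
  have UL: "L2_rect L B (U i j)" if "S i j" for i j by (rule L2_weak_deriv_L2_rect[OF L2w[OF that] U[OF that]])
  have step: "has_weak_deriv (dirs k l) ?D (wd i j ?D w) (wd (i + k) (j + l) ?D w)" if "S i j" "S (i + k) (j + l)" for i j k l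
    by (rule has_weak_deriv_dirs[OF hwd[OF that(1)] hwd[OF that(2)]])
  have Ustep: "borel_version ?D (wd k l ?D (wd i j ?D w)) (U (i + k) (j + l))" if "S i j" "S (i + k) (j + l)" for i j k l
  proof (rule borel_version_cong_AE[OF U[OF that(2)]])
    show "AE x in lborel. x \<in> ?D \<longrightarrow> wd (i + k) (j + l) ?D w x = wd k l ?D (wd i j ?D w) x"
      using weak_deriv_AE_eq[OF open_rect step[OF that]] by eventually_elim simp
  qed
  have acx: "ac_rect L B (U i j) (U (i + 1) j)" if "S i j" "S (i + 1) j" for i j
    using ac_rect_if_weak_deriv_x[OF L U[OF that(1)] UL[OF that(1)] U[OF that(2)] UL[OF that(2)]] step[of i j 1 0] that by simp
  have acy: "ac_rect B L (swapped (U i j)) (swapped (U i (j + 1)))" if "S i j" "S i (j + 1)" for i j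
    using ac_rect_if_weak_deriv_y[OF B U[OF that(1)] UL[OF that(1)] U[OF that(2)] UL[OF that(2)]] step[of i j 0 1] that by simp
  have W0: "AE p in lborel. W p = U 0 0 p"
  proof -
    have S00: "S 0 0" by (simp add: S_def)
    have "has_weak_deriv (dirs 0 0) ?D w w"
      using has_weak_deriv_Nil[OF has_weak_deriv_locally_integrable(1)[OF hwd[of 0 0]]] by (simp add: S_def dirs_def)
    from weak_deriv_AE_eq[OF open_rect this] borel_version_AE[OF U[OF S00]] borel_version_AE[OF W]
    show ?thesis
    proof eventually_elim
      fix p assume p: "p \<in> ?D \<longrightarrow> wd 0 0 ?D w p = w p" "p \<in> ?D \<longrightarrow> U 0 0 p = wd 0 0 ?D w p" "p \<in> ?D \<longrightarrow> W p = w p"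
      show "W p = U 0 0 p"
        using p borel_version_outside[OF W] borel_version_outside[OF U[OF S00]] by (cases "p \<in> ?D") auto
    qed
  qed
  have Uw: "borel_version ?D w (U 0 0)"
    unfolding borel_version_def
  proof (intro conjI allI impI)
    show "U 0 0 \<in> borel_measurable borel" by (rule L2_rectD(1)[OF UL]) (simp add: S_def)
    show "U 0 0 p = 0" if "p \<notin> ?D" for p by (rule L2_rectD(3)[OF UL that]) (simp add: S_def)
    show "AE p in lborel. p \<in> ?D \<longrightarrow> U 0 0 p = w p"
      using W0 borel_version_AE[OF W] by eventually_elim simp
  qed
  have Sx: "S 0 0" "S 1 0" "S 2 0" "S 3 0" "S 4 0" "S 5 0" "S 0 1" "S 0 2" "S 0 3" "S 0 4" "S 1 1" "S 1 2" "S 2 2"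
    by (simp_all add: S_def)
  have bcs: "zero_at_x L B 0 w" "zero_at_x L B L w" "zero_at_y L B 0 w" "zero_at_y L B B w"
    "zero_at_y L B 0 (wd 0 2 ?D w)" "zero_at_y L B B (wd 0 2 ?D w)"
    "zero_at_x L B 0 (wd 1 0 ?D w)" "zero_at_x L B L (wd 1 0 ?D w)" "zero_at_x L B L (wd 2 0 ?D w)"
    using bc unfolding boundary_conditions_def by blast+
  have c: "0 \<le> L" "0 \<le> B" "L \<le> L" "B \<le> B" "(0::real) \<le> 0" using L B by auto
  have U11: "borel_version ?D (wd 1 0 ?D (wd 1 0 ?D w)) (U 2 0)" using Ustep[of 1 0 1 0] by (simp add: S_def numeral_2_eq_2)
  have U21: "borel_version ?D (wd 1 0 ?D (wd 2 0 ?D w)) (U 3 0)" using Ustep[of 2 0 1 0] by (simp add: S_def)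
  have U03: "borel_version ?D (wd 0 1 ?D (wd 0 2 ?D w)) (U 0 3)" using Ustep[of 0 2 0 1] by (simp add: S_def)
  note zxI = ac_zero_rect_if_zero_at_x[OF L B] and zyI = ac_zero_rect_if_zero_at_y[OF L B]
  note zx = zxI[OF c(5,1) bcs(1) Uw U[OF Sx(2)]] zxI[OF c(1,3) bcs(2) Uw U[OF Sx(2)]]
  note zy = zyI[OF c(5,2) bcs(3) Uw U[OF Sx(7)]] zyI[OF c(2,4) bcs(4) Uw U[OF Sx(7)]]
  note zx1 = zxI[OF c(5,1) bcs(7) U[OF Sx(2)] U11] zxI[OF c(1,3) bcs(8) U[OF Sx(2)] U11]
  note zx2 = zxI[OF c(1,3) bcs(9) U[OF Sx(3)] U21]
  note zy2 = zyI[OF c(5,2) bcs(5) U[OF Sx(8)] U03] zyI[OF c(2,4) bcs(6) U[OF Sx(8)] U03]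
  have d01: "has_weak_deriv (dirs 0 1) ?D w (wd 0 1 ?D w)" by (rule hwd[OF Sx(7)])
  have d11: "has_weak_deriv (dirs 0 1) ?D (wd 1 0 ?D w) (wd 1 1 ?D w)" using step[of 1 0 0 1] by (simp add: S_def)
  have zt: "ac_zero_rect L B c (U 0 1) (U 1 1)" if "ac_zero_rect L B c (U 0 0) (U 1 0)" for c
    by (rule ac_zero_rect_tangential[OF L B Uw UL[OF Sx(1)] U[OF Sx(2)] UL[OF Sx(2)] U[OF Sx(7)] UL[OF Sx(7)]
          U[OF Sx(11)] UL[OF Sx(11)] that d01 d11])
  define ip where "ip F G = (LINT p|lborel. F p * G p)" for F G :: "real \<times> real \<Rightarrow> real"
  have ipc: "ip F G = ip G F" for F G by (simp add: ip_def mult.commute)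
  have ibx: "ip (U (i + 1) j) (U k l) = - ip (U i j) (U (k + 1) l)"
    if "S i j" "S (i + 1) j" "S k l" "S (k + 1) l"
      "ac_zero_rect L B 0 (U k l) (U (k + 1) l)" "ac_zero_rect L B L (U k l) (U (k + 1) l)" for i j k l
    unfolding ip_def
    by (rule integral_by_parts_rect[OF L UL[OF that(1)] UL[OF that(2)] UL[OF that(3)] UL[OF that(4)] acx[OF that(1,2)] that(5,6)])
  have iby: "ip (U i (j + 1)) (U k l) = - ip (U i j) (U k (l + 1))"
    if "S i j" "S i (j + 1)" "S k l" "S k (l + 1)"
      "ac_zero_rect B L 0 (swapped (U k l)) (swapped (U k (l + 1)))" "ac_zero_rect B L B (swapped (U k l)) (swapped (U k (l + 1)))" for i j k l
    unfolding ip_def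
    by (rule integral_by_parts_rect_swapped[OF B UL[OF that(1)] UL[OF that(2)] UL[OF that(3)] UL[OF that(4)] acy[OF that(1,2)] that(5,6)])
  have e40: "ip (U 4 0) (U 0 0) = ip (U 2 0) (U 2 0)"
    using ibx[of 3 0 0 0] ibx[of 2 0 1 0] zx zx1 by (simp add: S_def numeral_2_eq_2 numeral_3_eq_3 eval_nat_numeral)
  have e04: "ip (U 0 4) (U 0 0) = ip (U 0 2) (U 0 2)"
    using iby[of 0 3 0 0] iby[of 0 1 0 2] zy zy2 ipc[of "U 0 3" "U 0 1"] by (simp add: S_def eval_nat_numeral)
  have e22: "ip (U 2 2) (U 0 0) = ip (U 0 2) (U 2 0)"
    using ibx[of 1 2 0 0] ibx[of 0 2 1 0] zx zx1 by (simp add: S_def eval_nat_numeral)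
  have e20: "ip (U 2 0) (U 0 0) = - ip (U 1 0) (U 1 0)"
    using ibx[of 1 0 0 0] zx by (simp add: S_def eval_nat_numeral)
  have e02: "ip (U 0 2) (U 0 0) = - ip (U 0 1) (U 0 1)"
    using iby[of 0 1 0 0] zy by (simp add: S_def eval_nat_numeral)
  have e30: "ip (U 3 0) (U 0 0) = 0"
    using ibx[of 2 0 0 0] ibx[of 1 0 1 0] zx zx1 ipc[of "U 1 0" "U 2 0"] by (simp add: S_def eval_nat_numeral)
  have e12: "ip (U 1 2) (U 0 0) = 0"
    using iby[of 1 1 0 0] zy ibx[of 0 1 0 1] zt[OF zx(1)] zt[OF zx(2)] ipc[of "U 1 1" "U 0 1"]
    by (simp add: S_def eval_nat_numeral)
  have e50: "ip (U 5 0) (U 0 0) \<le> 0"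
  proof -
    have "ip (U 5 0) (U 0 0) = ip (U 3 0) (U 2 0)"
      using ibx[of 4 0 0 0] ibx[of 3 0 1 0] zx zx1 by (simp add: S_def eval_nat_numeral)
    also have "\<dots> \<le> 0"
      unfolding ip_def by (rule integral_deriv_mult_self_rect[OF L UL[OF Sx(3)] UL[OF Sx(4)] zx2])
    finally show ?thesis .
  qed
  define Q where "Q p = V p + (U 4 0 p + U 2 2 p + (U 2 2 p + U 0 4 p)) + \<gamma> * (U 2 0 p + U 0 2 p) + (U 3 0 p + U 1 2 p) - U 5 0 p" for p
  have lap2: "AE p in lborel. p \<in> ?D \<longrightarrow> lap ?D (lap ?D w) p = wd 4 0 ?D w p + wd 2 2 ?D w p + (wd 2 2 ?D w p + wd 0 4 ?D w p)"
  proof -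
    have "AE p in lborel. p \<in> ?D \<longrightarrow> wd 2 0 ?D (lap ?D w) p = wd 4 0 ?D w p + wd 2 2 ?D w p"
      using step[of 2 0 2 0] step[of 0 2 2 0] by (intro weak_deriv_lap open_rect) (simp_all add: S_def eval_nat_numeral)
    moreover have "AE p in lborel. p \<in> ?D \<longrightarrow> wd 0 2 ?D (lap ?D w) p = wd 2 2 ?D w p + wd 0 4 ?D w p"
      using step[of 2 0 0 2] step[of 0 2 0 2] by (intro weak_deriv_lap open_rect) (simp_all add: S_def eval_nat_numeral)
    ultimately show ?thesis by eventually_elim (simp add: lap_def)
  qed
  have s30: "has_weak_deriv (dirs 2 0) ?D (wd 1 0 ?D w) (wd 3 0 ?D w)"
    and s12: "has_weak_deriv (dirs 0 2) ?D (wd 1 0 ?D w) (wd 1 2 ?D w)"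
    using step[of 1 0 2 0] step[of 1 0 0 2] by (simp_all add: S_def eval_nat_numeral)
  have lapx: "AE p in lborel. p \<in> ?D \<longrightarrow> lap ?D (wd 1 0 ?D w) p = wd 3 0 ?D w p + wd 1 2 ?D w p"
    using weak_deriv_AE_eq[OF open_rect s30] weak_deriv_AE_eq[OF open_rect s12]
    by eventually_elim (simp only: lap_def, simp)
  have Qeq: "AE p in lborel. U 0 0 p * U 1 0 p = - Q p"
    using eq lap2 lapx borel_version_AE[OF V(1)] borel_version_AE[OF Uw] borel_version_AE[OF U[OF Sx(2)]]
      borel_version_AE[OF U[OF Sx(3)]] borel_version_AE[OF U[OF Sx(4)]] borel_version_AE[OF U[OF Sx(5)]]
      borel_version_AE[OF U[OF Sx(6)]] borel_version_AE[OF U[OF Sx(8)]] borel_version_AE[OF U[OF Sx(10)]]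
      borel_version_AE[OF U[OF Sx(12)]] borel_version_AE[OF U[OF Sx(13)]]
  proof eventually_elim
    case (elim p)
    show ?case
    proof (cases "p \<in> ?D")
      case True
      then show ?thesis using elim by (simp add: Q_def lap_def[of ?D w] algebra_simps)
    next
      case False
      then show ?thesis using L2_rectD(3)[OF V(2) False] L2_rectD(3)[OF UL False]
        by (simp add: Q_def S_def)
    qed
  qed
  note I = L2_rect_mult[OF UL UL]
  have IV: "integrable lborel (\<lambda>p. V p * U 0 0 p)" by (rule L2_rect_mult[OF V(2) UL[OF Sx(1)]])
  have QW: "(\<lambda>p. Q p * U 0 0 p) = (\<lambda>p. V p * U 0 0 p + (U 4 0 p * U 0 0 p + U 2 2 p * U 0 0 p + (U 2 2 p * U 0 0 p + U 0 4 p * U 0 0 p))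
      + \<gamma> * (U 2 0 p * U 0 0 p + U 0 2 p * U 0 0 p) + (U 3 0 p * U 0 0 p + U 1 2 p * U 0 0 p) - U 5 0 p * U 0 0 p)"
    by (auto simp: Q_def algebra_simps)
  have iQ: "integrable lborel (\<lambda>p. Q p * U 0 0 p)"
    unfolding QW using IV I Sx by simp
  have Um[measurable]: "U 0 0 \<in> borel_measurable borel" "U 1 0 \<in> borel_measurable borel"
    by (auto intro!: L2_rectD(1)[OF UL] simp: S_def)
  have aeQ: "AE p in lborel. - (Q p * U 0 0 p) = U 0 0 p * U 0 0 p * U 1 0 p"
    using Qeq
  proof eventually_elim
    case (elim p)
    have "U 0 0 p * U 0 0 p * U 1 0 p = U 0 0 p * - Q p" unfolding mult.assoc elim ..
    then show ?case by (simp only: mult_minus_right mult.commute[of "Q p"])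
  qed
  have iQ': "integrable lborel (\<lambda>p. - (Q p * U 0 0 p))" using iQ by (rule Bochner_Integration.integrable_minus)
  have m3: "(\<lambda>p. U 0 0 p * U 0 0 p * U 1 0 p) \<in> borel_measurable lborel" by measurable
  note i3 = integrable_cong_AE_imp[OF iQ' m3 aeQ]
  have "(LINT p|lborel. - (Q p * U 0 0 p)) = (LINT p|lborel. U 0 0 p * U 0 0 p * U 1 0 p)"
    by (rule integral_cong_AE[OF borel_measurable_integrable[OF iQ'] m3 aeQ])
  also have "\<dots> = 0" by (rule integral_square_mult_deriv_rect[OF L UL[OF Sx(1)] UL[OF Sx(2)] zx i3])
  finally have "(LINT p|lborel. Q p * U 0 0 p) = 0" by simp
  moreover have "(LINT p|lborel. Q p * U 0 0 p) = ip V (U 0 0) + (ip (U 4 0) (U 0 0) + ip (U 2 2) (U 0 0) + (ip (U 2 2) (U 0 0) + ip (U 0 4) (U 0 0)))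
      + \<gamma> * (ip (U 2 0) (U 0 0) + ip (U 0 2) (U 0 0)) + (ip (U 3 0) (U 0 0) + ip (U 1 2) (U 0 0)) - ip (U 5 0) (U 0 0)"
    unfolding QW ip_def using IV I Sx by (simp add: mult.commute)
  ultimately have main: "ip V (U 0 0) \<le> - (ip (U 2 0) (U 2 0) + 2 * ip (U 0 2) (U 2 0) + ip (U 0 2) (U 0 2))
      + \<gamma> * (ip (U 1 0) (U 1 0) + ip (U 0 1) (U 0 1))"
    using e50 unfolding e40 e04 e22 e20 e02 e30 e12 by (simp add: algebra_simps)
  define n where "n = ip (U 0 0) (U 0 0)"
  define G where "G = ip (U 1 0) (U 1 0) + ip (U 0 1) (U 0 1)"
  define D2 where "D2 = ip (U 2 0) (U 2 0) + 2 * ip (U 0 2) (U 2 0) + ip (U 0 2) (U 0 2)"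
  have main': "ip V (U 0 0) \<le> - D2 + \<gamma> * G" using main by (simp only: D2_def G_def)
  have a0: "0 < a" using \<gamma> by simp
  have "(pi / L)\<^sup>2 * n \<le> ip (U 1 0) (U 1 0)"
    using wirtinger_rect[OF L UL[OF Sx(1)] UL[OF Sx(2)] zx] by (simp add: n_def ip_def power2_eq_square)
  moreover have "(pi / B)\<^sup>2 * n \<le> ip (U 0 1) (U 0 1)"
    using wirtinger_rect_swapped[OF B UL[OF Sx(1)] UL[OF Sx(7)] zy] by (simp add: n_def ip_def)
  ultimately have aG: "a * n \<le> G" by (simp add: a G_def power_divide algebra_simps)
  have "0 \<le> (LINT p|lborel. (U 2 0 p + U 0 2 p + a * U 0 0 p)\<^sup>2)" by (intro Bochner_Integration.integral_nonneg) simp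
  also have "(\<lambda>p. (U 2 0 p + U 0 2 p + a * U 0 0 p)\<^sup>2) = (\<lambda>p. U 2 0 p * U 2 0 p + 2 * (U 0 2 p * U 2 0 p) + U 0 2 p * U 0 2 p
      + 2 * a * (U 2 0 p * U 0 0 p + U 0 2 p * U 0 0 p) + a\<^sup>2 * (U 0 0 p * U 0 0 p))"
    by (auto simp: power2_eq_square algebra_simps)
  also have "(LINT p|lborel. U 2 0 p * U 2 0 p + 2 * (U 0 2 p * U 2 0 p) + U 0 2 p * U 0 2 p
      + 2 * a * (U 2 0 p * U 0 0 p + U 0 2 p * U 0 0 p) + a\<^sup>2 * (U 0 0 p * U 0 0 p)) = D2 + 2 * a * (ip (U 2 0) (U 0 0) + ip (U 0 2) (U 0 0)) + a\<^sup>2 * n"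
    unfolding D2_def n_def ip_def using I Sx by simp
  also have "\<dots> = D2 - 2 * a * G + a * (a * n)" by (simp add: e20 e02 G_def power2_eq_square algebra_simps)
  also have "\<dots> \<le> D2 - 2 * a * G + a * G" using mult_left_mono[OF aG, of a] a0 by simp
  finally have DG: "a * G \<le> D2" by (simp add: mult.commute)
  have aan: "a\<^sup>2 * n \<le> D2" using order_trans[OF mult_left_mono[OF aG less_imp_le[OF a0]] DG] by (simp add: power2_eq_square mult.assoc)
  have "\<gamma> * G \<le> \<gamma> / a * D2" using mult_left_mono[OF DG, of "\<gamma> / a"] \<gamma> a0 by simp
  then have "ip V (U 0 0) \<le> - ((1 - \<gamma> / a) * D2)" using main' by (simp add: algebra_simps)
  also have "\<dots> \<le> - ((1 - \<gamma> / a) * (a\<^sup>2 * n))"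
    using mult_left_mono[OF aan, of "1 - \<gamma> / a"] \<gamma> a0 by simp
  finally have fin: "ip V (U 0 0) \<le> - (a\<^sup>2 * (1 - \<gamma> / a)) * n" by (simp add: algebra_simps)
  have [measurable]: "W \<in> borel_measurable borel" "V \<in> borel_measurable borel"
    by (rule borel_version_borel_measurable[OF W], rule L2_rectD(1)[OF V(2)])
  have "(LINT p|lborel. V p * W p) = ip V (U 0 0)"
    unfolding ip_def
  proof (rule integral_cong_AE)
    show "AE p in lborel. V p * W p = V p * U 0 0 p" using W0 by eventually_elim simp
  qed measurable
  moreover have "(LINT p|lborel. (W p)\<^sup>2) = n"
    unfolding n_def ip_def
  proof (rule integral_cong_AE)
    show "AE p in lborel. (W p)\<^sup>2 = U 0 0 p * U 0 0 p" using W0 by eventually_elim (simp add: power2_eq_square)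
  qed measurable
  ultimately show ?thesis using fin by simp
qed

section \<open>The energy identity in time\<close>

lemma energy_identity:
  fixes f g :: "real \<times> 'b::euclidean_space \<Rightarrow> real"
  assumes T: "0 < T" and [measurable]: "f \<in> borel_measurable borel" "g \<in> borel_measurable borel"
    and f2: "integrable lborel (\<lambda>p. (f p)\<^sup>2)" and g2: "integrable lborel (\<lambda>p. (g p)\<^sup>2)"
    and f0: "\<And>p. p \<notin> {0<..<T} \<times> box c d \<Longrightarrow> f p = 0" and g0: "\<And>p. p \<notin> {0<..<T} \<times> box c d \<Longrightarrow> g p = 0"
    and wd: "\<And>\<phi> \<psi>. test_function {0<..<T} \<phi> \<Longrightarrow> test_function (box c d) \<psi> \<Longrightarrow>
      (LINT p|lborel. f p * (dir_deriv 1 \<phi> (fst p) * \<psi> (snd p))) = - (LINT p|lborel. g p * (\<phi> (fst p) * \<psi> (snd p)))"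
  shows "\<exists>\<alpha>. AE s in lborel. s \<in> {0<..<T} \<longrightarrow>
    (LINT q|lborel. (f (s, q))\<^sup>2) = \<alpha> + prim (\<lambda>r. LINT q|lborel. 2 * (f (r, q) * g (r, q))) s"
proof -
  have bx: "{0<..<T} \<times> box c d = box (0, c) (T, d)" by (simp add: box_prod)
  have f: "integrable lborel f" by (rule integrable_L2_box[OF _ f2, of "(0, c)" "(T, d)"]) (use f0 in \<open>simp_all add: bx\<close>)
  have g: "integrable lborel g" by (rule integrable_L2_box[OF _ g2, of "(0, c)" "(T, d)"]) (use g0 in \<open>simp_all add: bx\<close>)
  obtain C where C: "integrable lborel C"
    and fC: "AE p in lborel. fst p \<in> {0<..<T} \<longrightarrow> f p = C (snd p) + prim (\<lambda>r. g (r, snd p)) (fst p)"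
    using weak_derivative_imp_ac[OF T f g f0 g0 wd] by blast
  define K where "K p = 2 * (f p * g p)" for p
  have K: "integrable lborel K" unfolding K_def using integrable_mult_L2[of f lborel g] f2 g2 by simp
  have [measurable]: "K \<in> borel_measurable borel" "C \<in> borel_measurable borel" using K C by auto
  have [measurable]: "(\<lambda>p. prim (\<lambda>r. K (r, snd p)) (fst p)) \<in> borel_measurable (borel :: (real \<times> 'b) measure)"
    unfolding prim_def borel_prod[symmetric] by measurable
  have sq: "AE q in lborel. AE s in lborel. s \<in> {0<..<T} \<longrightarrow> (f (s, q))\<^sup>2 = (C q)\<^sup>2 + prim (\<lambda>r. K (r, q)) s"
    using AE_snd_lborel[OF fC] AE_integrable_snd_lborel[OF g]
  proof eventually_elim
    fix q assume e: "AE s in lborel. fst (s, q) \<in> {0<..<T} \<longrightarrow> f (s, q) = C (snd (s, q)) + prim (\<lambda>r. g (r, snd (s, q))) (fst (s, q))"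
      and i: "integrable lborel (\<lambda>s. g (s, q))"
    define F where "F s = C q + prim (\<lambda>r. g (r, q)) s" for s
    have F: "ac F (\<lambda>s. g (s, q)) (C q)" using i by (simp add: ac_def F_def)
    have e': "AE s in lborel. s \<in> {0<..<T} \<longrightarrow> f (s, q) = F s" using e by (simp add: F_def)
    have FF: "ac (\<lambda>s. F s * F s) (\<lambda>s. g (s, q) * F s + F s * g (s, q)) (C q * C q)" by (rule ac_mult[OF F F])
    have "AE s in lborel. g (s, q) * F s + F s * g (s, q) = K (s, q)"
      using e'
    proof eventually_elim
      fix s assume "s \<in> {0<..<T} \<longrightarrow> f (s, q) = F s"
      moreover have "s \<notin> {0<..<T} \<Longrightarrow> g (s, q) = 0" by (rule g0) auto
      ultimately show "g (s, q) * F s + F s * g (s, q) = K (s, q)" by (cases "s \<in> {0<..<T}") (auto simp: K_def)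
    qed
    then have p: "prim (\<lambda>s. g (s, q) * F s + F s * g (s, q)) x = prim (\<lambda>s. K (s, q)) x" for x
    proof (rule prim_cong_AE)
      show "(\<lambda>s. g (s, q) * F s + F s * g (s, q)) \<in> borel_measurable borel"
        using borel_measurable_integrable[OF ac_integrable[OF FF]] by simp
      show "(\<lambda>s. K (s, q)) \<in> borel_measurable borel" by (rule slice_borel_measurable) simp
    qed
    have FFe: "F s * F s = C q * C q + prim (\<lambda>s. K (s, q)) s" for s using FF p by (simp add: ac_def)
    show "AE s in lborel. s \<in> {0<..<T} \<longrightarrow> (f (s, q))\<^sup>2 = (C q)\<^sup>2 + prim (\<lambda>r. K (r, q)) s"
      using e' by eventually_elim (simp add: power2_eq_square FFe)
  qed
  have sq': "AE s in lborel. AE q in lborel. s \<in> {0<..<T} \<longrightarrow> (f (s, q))\<^sup>2 = (C q)\<^sup>2 + prim (\<lambda>r. K (r, q)) s"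
  proof -
    let ?Q = "\<lambda>p. fst p \<in> {0<..<T} \<longrightarrow> (f p)\<^sup>2 = (C (snd p))\<^sup>2 + prim (\<lambda>r. K (r, snd p)) (fst p)"
    have "{p. ?Q p} \<in> sets borel" by measurable
    then have m: "{p \<in> space (lborel \<Otimes>\<^sub>M lborel). ?Q (fst p, snd p)} \<in> sets (lborel \<Otimes>\<^sub>M lborel)"
      unfolding lborel_prod by simp
    have "(AE s in lborel. AE q in lborel. ?Q (s, q)) \<longleftrightarrow> (AE q in lborel. AE s in lborel. ?Q (s, q))"
      by (rule lborel_pair.AE_commute[of "\<lambda>s q. ?Q (s, q)", OF m])
    then show ?thesis using sq unfolding fst_conv snd_conv by blast
  qed
  have Kp: "AE s in lborel. integrable lborel (\<lambda>q. indicator {0<..<T} s * prim (\<lambda>r. K (r, q)) s)"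
    using AE_integrable_fst_lborel[OF integrable_prim_slices[OF T K, of "\<lambda>s. s"]] by simp
  have good: "AE s in lborel. s \<in> {0<..<T} \<longrightarrow> integrable lborel (\<lambda>q. (C q)\<^sup>2) \<and>
      (LINT q|lborel. (f (s, q))\<^sup>2) = (LINT q|lborel. (C q)\<^sup>2) + prim (\<lambda>r. LINT q|lborel. K (r, q)) s"
    using sq' Kp AE_integrable_fst_lborel[OF f2]
  proof (eventually_elim, intro impI)
    fix s assume e: "AE q in lborel. s \<in> {0<..<T} \<longrightarrow> (f (s, q))\<^sup>2 = (C q)\<^sup>2 + prim (\<lambda>r. K (r, q)) s"
      and i: "integrable lborel (\<lambda>q. indicator {0<..<T} s * prim (\<lambda>r. K (r, q)) s)" "integrable lborel (\<lambda>q. (f (s, q))\<^sup>2)"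
      and s: "s \<in> {0<..<T}"
    have i': "integrable lborel (\<lambda>q. prim (\<lambda>r. K (r, q)) s)" using i(1) s by simp
    have ae: "AE q in lborel. (f (s, q))\<^sup>2 - prim (\<lambda>r. K (r, q)) s = (C q)\<^sup>2" using e by eventually_elim (use s in auto)
    have d: "integrable lborel (\<lambda>q. (f (s, q))\<^sup>2 - prim (\<lambda>r. K (r, q)) s)" using i(2) i' by simp
    have C2: "integrable lborel (\<lambda>q. (C q)\<^sup>2)" by (rule integrable_cong_AE_imp[OF d _ ae]) simp
    have "(LINT q|lborel. (f (s, q))\<^sup>2 - prim (\<lambda>r. K (r, q)) s) = (LINT q|lborel. (C q)\<^sup>2)"
      by (rule integral_cong_AE[OF borel_measurable_integrable[OF d] _ ae]) simp
    then have "(LINT q|lborel. (f (s, q))\<^sup>2) = (LINT q|lborel. (C q)\<^sup>2) + (LINT q|lborel. prim (\<lambda>r. K (r, q)) s)"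
      using i(2) i' by simp
    then show "integrable lborel (\<lambda>q. (C q)\<^sup>2) \<and>
      (LINT q|lborel. (f (s, q))\<^sup>2) = (LINT q|lborel. (C q)\<^sup>2) + prim (\<lambda>r. LINT q|lborel. K (r, q)) s"
      using C2 integral_prim_slices[OF K] by simp
  qed
  then show ?thesis
    by (intro exI[of _ "LINT q|lborel. (C q)\<^sup>2"]) (auto simp: K_def elim: eventually_mono)
qed

lemma prim_antimono_AE:
  assumes k: "integrable lborel k" and le: "AE s in lborel. k s \<le> 0" and st: "s \<le> t"
  shows "prim k t \<le> prim k s"
  unfolding prim_def
proof (rule integral_mono_AE)
  show "AE r in lborel. (if r \<le> t then k r else 0) \<le> (if r \<le> s then k r else 0)"
    using le by eventually_elim (use st in auto)
qed (intro integrable_truncate k)+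

lemma AE_interval_ex:
  assumes "(a::real) < b" "AE x in lborel. x \<in> {a<..<b} \<longrightarrow> P x"
  shows "\<exists>x\<in>{a<..<b}. P x"
proof (rule ccontr)
  assume "\<not> (\<exists>x\<in>{a<..<b}. P x)"
  then have "AE x in lborel. x \<in> {a<..<b} \<longrightarrow> False"
    using assms(2) by (auto elim: eventually_mono)
  then show False by (rule AE_interval_const[OF assms(1)])
qed

lemma energy_decay:
  fixes N :: "real \<Rightarrow> real"
  assumes cont: "\<And>s. 0 \<le> s \<Longrightarrow> (N \<longlongrightarrow> N s) (at s within {0..})"
    and en: "\<And>T. 0 < T \<Longrightarrow> \<exists>\<alpha> h. integrable lborel h \<and> (\<forall>s. s \<notin> {0<..<T} \<longrightarrow> h s = 0) \<and>
      (AE s in lborel. s \<in> {0<..<T} \<longrightarrow> N s = \<alpha> + prim h s \<and> h s \<le> - (k * N s))"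
    and t: "0 \<le> t"
  shows "N t \<le> N 0 * exp (- k * t)"
proof (cases "t = 0")
  case False
  then have t: "0 < t" using assms(3) by simp
  define T where "T = t + 2"
  have T: "0 < T" using t by (simp add: T_def)
  obtain \<alpha> h where h: "integrable lborel h" "\<And>s. s \<notin> {0<..<T} \<Longrightarrow> h s = 0"
    and N: "AE s in lborel. s \<in> {0<..<T} \<longrightarrow> N s = \<alpha> + prim h s \<and> h s \<le> - (k * N s)"
    using en[OF T] by blast
  have E: "ac (\<lambda>s. \<alpha> + prim h s) h \<alpha>" using h by (simp add: ac_def)
  obtain p where p: "ac p (\<lambda>s. if s \<in> {0<..<T} then k * exp (k * s) else 0) (exp (k * 0))"
    and pe: "\<And>s. s \<in> {0..T} \<Longrightarrow> p s = exp (k * s)"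
  proof -
    have d: "((\<lambda>s. exp (k * s)) has_real_derivative k * exp (k * x)) (at x)" for x
      by (auto intro!: derivative_eq_intros)
    have c: "continuous_on {0..T} (\<lambda>s. k * exp (k * s))" by (intro continuous_intros)
    show ?thesis using ac_C1[OF less_imp_le[OF T] d c] that by blast
  qed
  define m where "m s = h s * p s + (\<alpha> + prim h s) * (if s \<in> {0<..<T} then k * exp (k * s) else 0)" for s
  have M: "ac (\<lambda>s. (\<alpha> + prim h s) * p s) m (\<alpha> * exp (k * 0))"
    unfolding m_def by (rule ac_mult[OF E p])
  have m0: "AE s in lborel. m s \<le> 0"
    using N
  proof eventually_elim
    fix s assume s: "s \<in> {0<..<T} \<longrightarrow> N s = \<alpha> + prim h s \<and> h s \<le> - (k * N s)"
    show "m s \<le> 0"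
    proof (cases "s \<in> {0<..<T}")
      case True
      then have "m s = (h s + k * N s) * exp (k * s)" using s pe[of s] by (simp add: m_def algebra_simps)
      also have "\<dots> \<le> 0" using s True by (intro mult_nonpos_nonneg) auto
      finally show ?thesis .
    next
      case False
      then show ?thesis using h(2)[OF False] unfolding m_def if_not_P[OF False] by simp
    qed
  qed
  have mono: "N t' * exp (k * t') \<le> N s * exp (k * s)"
    if "s \<in> {0<..<T}" "t' \<in> {0<..<T}" "s \<le> t'" "N s = \<alpha> + prim h s" "N t' = \<alpha> + prim h t'" for s t'
  proof -
    have "prim m t' \<le> prim m s" by (rule prim_antimono_AE[OF ac_integrable[OF M] m0 that(3)])
    then have "(\<alpha> + prim h t') * p t' \<le> (\<alpha> + prim h s) * p s" using M unfolding ac_def by simp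
    then show ?thesis using that pe[of s] pe[of t'] by simp
  qed
  have dense: "\<exists>s\<in>{a<..<b}. N s = \<alpha> + prim h s" if "0 \<le> a" "a < b" "b \<le> T" for a b
    by (rule AE_interval_ex[OF that(2)]) (use N that in \<open>auto elim: eventually_mono\<close>)
  have td: "t / real (Suc n) \<le> t" for n
  proof -
    have "t / real (Suc n) \<le> t / 1" using t by (intro divide_left_mono) auto
    then show ?thesis by simp
  qed
  have "\<exists>s\<in>{0<..<t / real (Suc n)}. N s = \<alpha> + prim h s" for n
    using t td[of n] by (intro dense) (auto simp: T_def)
  then obtain s where s: "\<And>n. s n \<in> {0<..<t / real (Suc n)}" "\<And>n. N (s n) = \<alpha> + prim h (s n)" by metis
  have "\<exists>s\<in>{t<..<t + 1 / real (Suc n)}. N s = \<alpha> + prim h s" for n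
    using t by (intro dense) (auto simp: T_def divide_le_eq)
  then obtain r where r: "\<And>n. r n \<in> {t<..<t + 1 / real (Suc n)}" "\<And>n. N (r n) = \<alpha> + prim h (r n)" by metis
  have inv: "(\<lambda>n. 1 / real (Suc n)) \<longlonglongrightarrow> 0" using LIMSEQ_inverse_real_of_nat by (simp add: inverse_eq_divide)
  have "(\<lambda>n. t * (1 / real (Suc n))) \<longlonglongrightarrow> t * 0" by (intro tendsto_mult tendsto_const inv)
  then have sl: "(\<lambda>n. t / real (Suc n)) \<longlonglongrightarrow> 0" by simp
  have s0: "s \<longlonglongrightarrow> 0"
    by (rule real_tendsto_sandwich[OF _ _ tendsto_const sl]) (use s(1) in \<open>auto intro!: always_eventually less_imp_le\<close>)
  have "(\<lambda>n. t + 1 / real (Suc n)) \<longlonglongrightarrow> t + 0" by (intro tendsto_add tendsto_const inv)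
  then have rl: "(\<lambda>n. t + 1 / real (Suc n)) \<longlonglongrightarrow> t" by simp
  have r0: "r \<longlonglongrightarrow> t"
    by (rule real_tendsto_sandwich[OF _ _ tendsto_const rl]) (use r(1) in \<open>auto intro!: always_eventually less_imp_le\<close>)
  have "s n \<in> {0..} \<and> s n \<noteq> 0" "r n \<in> {0..} \<and> r n \<noteq> t" for n
    using s(1)[of n] r(1)[of n] t by auto
  then have fs: "filterlim s (at 0 within {0..}) sequentially" and fr: "filterlim r (at t within {0..}) sequentially"
    unfolding filterlim_at by (auto intro!: always_eventually s0 r0)
  have Ns: "(\<lambda>n. N (s n)) \<longlonglongrightarrow> N 0" by (rule filterlim_compose[OF cont[OF order_refl] fs])
  have Nr: "(\<lambda>n. N (r n)) \<longlonglongrightarrow> N t" by (rule filterlim_compose[OF cont[OF less_imp_le[OF t]] fr])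
  have "N (r n) * exp (k * r n) \<le> N (s n) * exp (k * s n)" for n
  proof (rule mono[OF _ _ _ s(2) r(2)])
    note a = td[of n]
    have b: "1 / real (Suc n) \<le> 1" by simp
    have c: "0 < s n" "s n < t / real (Suc n)" "t < r n" "r n < t + 1 / real (Suc n)" using s(1)[of n] r(1)[of n] by auto
    have "0 < r n" "s n < t" "r n < t + 2" using a b c by linarith+
    then show "s n \<in> {0<..<T}" "r n \<in> {0<..<T}" "s n \<le> r n" using c unfolding T_def by auto
  qed
  moreover have "(\<lambda>n. N (r n) * exp (k * r n)) \<longlonglongrightarrow> N t * exp (k * t)" by (intro tendsto_intros Nr r0)
  moreover have "(\<lambda>n. N (s n) * exp (k * s n)) \<longlonglongrightarrow> N 0 * exp (k * 0)" by (intro tendsto_intros Ns s0)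
  ultimately have "N t * exp (k * t) \<le> N 0 * exp (k * 0)" by (intro LIMSEQ_le) auto
  then have "N t * exp (k * t) * exp (- k * t) \<le> N 0 * exp (- k * t)" by (intro mult_right_mono) auto
  then show ?thesis by (simp add: mult.assoc exp_minus)
qed simp

lemma L2_triangle:
  fixes F G :: "'a \<Rightarrow> real"
  assumes [measurable]: "F \<in> borel_measurable M" "G \<in> borel_measurable M"
    and F2: "integrable M (\<lambda>x. (F x)\<^sup>2)" and G2: "integrable M (\<lambda>x. (G x)\<^sup>2)"
  shows "sqrt (LINT x|M. (F x + G x)\<^sup>2) \<le> sqrt (LINT x|M. (F x)\<^sup>2) + sqrt (LINT x|M. (G x)\<^sup>2)"
proof -
  let ?A = "LINT x|M. (F x)\<^sup>2" and ?B = "LINT x|M. (G x)\<^sup>2" and ?c = "LINT x|M. F x * G x"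
  have FG: "integrable M (\<lambda>x. F x * G x)" by (rule integrable_mult_L2) (use F2 G2 in auto)
  have exp: "(LINT x|M. (F x + z * G x)\<^sup>2) = ?A + 2 * z * ?c + z\<^sup>2 * ?B" for z
  proof -
    have "(\<lambda>x. (F x + z * G x)\<^sup>2) = (\<lambda>x. (F x)\<^sup>2 + 2 * z * (F x * G x) + z\<^sup>2 * (G x)\<^sup>2)"
      by (auto simp: power2_eq_square algebra_simps)
    then show ?thesis using F2 G2 FG by simp
  qed
  have nn: "0 \<le> ?A + 2 * z * ?c + z\<^sup>2 * ?B" for z
    unfolding exp[symmetric] by (intro Bochner_Integration.integral_nonneg) simp
  have A: "0 \<le> ?A" and B: "0 \<le> ?B" by (auto intro: Bochner_Integration.integral_nonneg)
  have "?c\<^sup>2 \<le> ?A * ?B"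
  proof (cases "?B = 0")
    case True
    have "?c = 0"
    proof (rule ccontr)
      assume "?c \<noteq> 0"
      then show False using nn[of "- (?A + 1) / (2 * ?c)"] True by (simp add: field_simps)
    qed
    then show ?thesis using True by simp
  next
    case False
    then have "0 < ?B" using B by (metis order_le_less)
    then show ?thesis using nn[of "- ?c / ?B"] by (simp add: field_simps power2_eq_square)
  qed
  then have "\<bar>?c\<bar> \<le> sqrt (?A * ?B)" by (simp add: real_le_rsqrt)
  then have "?A + 2 * ?c + ?B \<le> (sqrt ?A + sqrt ?B)\<^sup>2"
    using A B by (simp add: power2_sum real_sqrt_mult)
  then show ?thesis using exp[of 1] A B by (simp add: real_le_lsqrt)
qed

lemma norm_L2_diff_le:
  assumes "\<Omega> \<in> sets borel" "L2_fun \<Omega> f" "L2_fun \<Omega> g"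
  shows "\<bar>norm_L2 \<Omega> f - norm_L2 \<Omega> g\<bar> \<le> norm_L2 \<Omega> (\<lambda>x. f x - g x)"
proof -
  obtain F G where F: "borel_version \<Omega> f F" "integrable lborel (\<lambda>x. (F x)\<^sup>2)"
    and G: "borel_version \<Omega> g G" "integrable lborel (\<lambda>x. (G x)\<^sup>2)"
    using L2_fun_borel_version assms by metis
  have n: "norm_L2 \<Omega> h = sqrt (LINT x|lborel. (H x)\<^sup>2)" if "borel_version \<Omega> h H" for h H
    using norm_L2_square[OF that] unfolding norm_L2_def
    by (simp add: Bochner_Integration.integral_nonneg set_lebesgue_integral_def)
  have [measurable]: "F \<in> borel_measurable lborel" "G \<in> borel_measurable lborel"
    using F G borel_version_borel_measurable by auto
  have D2: "integrable lborel (\<lambda>x. (F x - G x)\<^sup>2)"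
  proof -
    have "integrable lborel (\<lambda>x. (F x)\<^sup>2 + (G x)\<^sup>2 - 2 * (F x * G x))"
      using F(2) G(2) integrable_mult_L2[of F lborel G] by simp
    then show ?thesis by (simp add: power2_diff algebra_simps)
  qed
  have "sqrt (LINT x|lborel. (F x)\<^sup>2) \<le> sqrt (LINT x|lborel. (F x - G x)\<^sup>2) + sqrt (LINT x|lborel. (G x)\<^sup>2)"
    using L2_triangle[of "\<lambda>x. F x - G x" lborel G] D2 G(2) by simp
  moreover have "sqrt (LINT x|lborel. (G x)\<^sup>2) \<le> sqrt (LINT x|lborel. (F x - G x)\<^sup>2) + sqrt (LINT x|lborel. (F x)\<^sup>2)"
    using L2_triangle[of "\<lambda>x. G x - F x" lborel F] D2 F(2) by (simp add: power2_commute[of "G _" "F _"])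
  ultimately show ?thesis
    unfolding n[OF F(1)] n[OF G(1)] n[OF borel_version_diff[OF F(1) G(1)]] by (simp add: abs_le_iff)
qed

lemma slice_borel_measurable_snd:
  fixes F :: "'a::euclidean_space \<times> 'b::euclidean_space \<Rightarrow> real"
  assumes "F \<in> borel_measurable borel" shows "(\<lambda>y. F (x, y)) \<in> borel_measurable borel"
  by (rule measurable_compose[OF _ assms]) (intro borel_measurable_continuous_onI continuous_intros)

lemma integrable_if_slices_bounded:
  fixes K :: "real \<times> 'b::euclidean_space \<Rightarrow> real"
  assumes [measurable]: "K \<in> borel_measurable borel" and nn: "\<And>p. 0 \<le> K p"
    and K0: "\<And>s q. s \<notin> {0<..<T} \<Longrightarrow> K (s, q) = 0"
    and i: "AE s in lborel. s \<in> {0<..<T} \<longrightarrow> integrable lborel (\<lambda>q. K (s, q)) \<and> (LINT q|lborel. K (s, q)) \<le> C"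
  shows "integrable lborel K"
proof -
  have [measurable]: "K \<in> borel_measurable (lborel \<Otimes>\<^sub>M lborel)" unfolding lborel_prod by simp
  have "integrable (lborel \<Otimes>\<^sub>M lborel) K"
  proof (rule lborel_pair.Fubini_integrable)
    show "AE s in lborel. integrable lborel (\<lambda>q. K (s, q))"
      using i
    proof eventually_elim
      fix s assume "s \<in> {0<..<T} \<longrightarrow> integrable lborel (\<lambda>q. K (s, q)) \<and> (LINT q|lborel. K (s, q)) \<le> C"
      then show "integrable lborel (\<lambda>q. K (s, q))" using K0[of s] by (cases "s \<in> {0<..<T}") auto
    qed
    show "integrable lborel (\<lambda>s. LINT q|lborel. norm (K (s, q)))"
    proof (rule Bochner_Integration.integrable_bound)
      have "integrable lborel (indicator {0<..<T} :: real \<Rightarrow> real)"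
        by (rule integrable_real_indicator) (use emeasure_lborel_box_finite[of 0 T] in simp_all)
      then show "integrable lborel (\<lambda>s. C * indicator {0<..<T} s)" by simp
      show "AE s in lborel. norm (LINT q|lborel. norm (K (s, q))) \<le> norm (C * indicator {0<..<T} s)"
        using i
      proof eventually_elim
        fix s assume s: "s \<in> {0<..<T} \<longrightarrow> integrable lborel (\<lambda>q. K (s, q)) \<and> (LINT q|lborel. K (s, q)) \<le> C"
        have "0 \<le> (LINT q|lborel. K (s, q))" using nn by (intro Bochner_Integration.integral_nonneg)
        then show "norm (LINT q|lborel. norm (K (s, q))) \<le> norm (C * indicator {0<..<T} s)"
          using s K0[of s] nn by (cases "s \<in> {0<..<T}") auto
      qed
    qed measurable
  qed measurable
  then show ?thesis by (simp add: lborel_prod)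
qed

lemma norm_L2_nonneg: "0 \<le> norm_L2 \<Omega> f"
  by (simp add: norm_L2_def set_lebesgue_integral_def Bochner_Integration.integral_nonneg)

lemma norm_L2_tendsto:
  assumes "\<Omega> \<in> sets borel" "\<And>t. 0 \<le> t \<Longrightarrow> L2_fun \<Omega> (u t)" "0 \<le> s"
    and lim: "((\<lambda>t. norm_L2 \<Omega> (\<lambda>p. u t p - u s p)) \<longlongrightarrow> 0) (at s within {0..})"
  shows "((\<lambda>t. norm_L2 \<Omega> (u t)) \<longlongrightarrow> norm_L2 \<Omega> (u s)) (at s within {0..})"
proof -
  have "eventually (\<lambda>t. norm (norm_L2 \<Omega> (u t) - norm_L2 \<Omega> (u s)) \<le> norm_L2 \<Omega> (\<lambda>p. u t p - u s p)) (at s within {0..})"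
    unfolding eventually_at_filter
    by (intro always_eventually) (use norm_L2_diff_le[OF assms(1)] assms(2,3) in auto)
  from Lim_null_comparison[OF this lim] show ?thesis by (simp add: LIM_zero_iff)
qed

lemma regular_solution_energy:
  fixes u v :: "real \<Rightarrow> real \<times> real \<Rightarrow> real"
  assumes B: "0 < B" and L: "0 < L" and \<gamma>: "0 < \<gamma>" "\<gamma> < a" and a: "a = pi\<^sup>2 / B\<^sup>2 + pi\<^sup>2 / L\<^sup>2" and T: "0 < T"
    and u2: "\<And>t. 0 \<le> t \<Longrightarrow> L2_fun (rect L B) (u t)"
    and cont: "\<And>s. 0 \<le> s \<Longrightarrow> ((\<lambda>t. norm_L2 (rect L B) (u t)) \<longlongrightarrow> norm_L2 (rect L B) (u s)) (at s within {0..})"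
    and wd: "has_weak_deriv [((0, 0), 1)] (rect L B \<times> {0<..}) (\<lambda>(p, t). u t p) (\<lambda>(p, t). v t p)"
    and u4: "AE t in lborel. t \<in> {0<..<T} \<longrightarrow> u t \<in> sobolev 4 (rect L B)"
    and u5: "AE t in lborel. t \<in> {0<..<T} \<longrightarrow> L2_weak_deriv 5 0 (rect L B) (u t)"
    and v0: "AE t in lborel. t \<in> {0<..<T} \<longrightarrow> v t \<in> sobolev 0 (rect L B)"
    and vC: "AE t in lborel. t \<in> {0<..<T} \<longrightarrow> sobolev_norm 0 (rect L B) (v t) \<le> C"
    and eq: "AE t in lborel. t \<in> {0<..<T} \<longrightarrow> (AE p in lborel. p \<in> rect L B \<longrightarrow>
      v t p + lap (rect L B) (lap (rect L B) (u t)) p + \<gamma> * lap (rect L B) (u t) p + lap (rect L B) (wd 1 0 (rect L B) (u t)) p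
        + u t p * wd 1 0 (rect L B) (u t) p - wd 5 0 (rect L B) (u t) p = 0)"
    and bc: "AE t in lborel. t \<in> {0<..<T} \<longrightarrow> boundary_conditions L B (u t)"
  shows "\<exists>\<alpha> h. integrable lborel h \<and> (\<forall>s. s \<notin> {0<..<T} \<longrightarrow> h s = 0) \<and>
    (AE s in lborel. s \<in> {0<..<T} \<longrightarrow> (norm_L2 (rect L B) (u s))\<^sup>2 = \<alpha> + prim h s \<and>
       h s \<le> - (2 * a\<^sup>2 * (1 - \<gamma> / a) * (norm_L2 (rect L B) (u s))\<^sup>2))"
proof -
  let ?D = "rect L B" and ?\<Omega> = "rect L B \<times> {0::real<..}"
  have D: "box (0, 0) (L, B) = ?D" by (rule rect_eq_box[symmetric])
  have \<Omega>: "open ?\<Omega>" by (intro open_Times open_rect open_greaterThan)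
  obtain U V where U: "borel_version ?\<Omega> (\<lambda>(p, t). u t p) U" and V: "borel_version ?\<Omega> (\<lambda>(p, t). v t p) V"
    using locally_integrable_borel_version[OF \<Omega>] has_weak_deriv_locally_integrable[OF wd] by metis
  define f where "f p = indicator {0<..<T} (fst p) * U (prod.swap p)" for p
  define g where "g p = indicator {0<..<T} (fst p) * V (prod.swap p)" for p
  have cut: "(\<lambda>p. indicator {0<..<T} (fst p) * W (prod.swap p)) \<in> borel_measurable borel"
      "p \<notin> {0<..<T} \<times> ?D \<Longrightarrow> indicator {0<..<T} (fst p) * W (prod.swap p) = 0"
      "AE s in lborel. s \<in> {0<..<T} \<longrightarrow> borel_version ?D (w s) (\<lambda>q. indicator {0<..<T} (fst (s, q)) * W (prod.swap (s, q)))"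
    if W: "borel_version ?\<Omega> (\<lambda>(p, t). w t p) W" for w W p
  proof -
    have [measurable]: "(\<lambda>p. W (prod.swap p)) \<in> borel_measurable borel"
      by (rule borel_measurable_swap[OF borel_version_borel_measurable[OF W]])
    show m: "(\<lambda>p. indicator {0<..<T} (fst p) * W (prod.swap p)) \<in> borel_measurable borel" by measurable
    show z: "indicator {0<..<T} (fst p) * W (prod.swap p) = 0" if "p \<notin> {0<..<T} \<times> ?D" for p
      using that borel_version_outside[OF W, of "prod.swap p"] by (cases p) (auto split: split_indicator)
    show "AE s in lborel. s \<in> {0<..<T} \<longrightarrow> borel_version ?D (w s) (\<lambda>q. indicator {0<..<T} (fst (s, q)) * W (prod.swap (s, q)))"
      using AE_snd_lborel[OF borel_version_AE[OF W]]
    proof (eventually_elim, intro impI)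
      fix s assume e: "AE q in lborel. (q, s) \<in> ?\<Omega> \<longrightarrow> W (q, s) = (case (q, s) of (p, t) \<Rightarrow> w t p)" and s: "s \<in> {0<..<T}"
      show "borel_version ?D (w s) (\<lambda>q. indicator {0<..<T} (fst (s, q)) * W (prod.swap (s, q)))"
        unfolding borel_version_def
      proof (intro conjI allI impI)
        show "(\<lambda>q. indicator {0<..<T} (fst (s, q)) * W (prod.swap (s, q))) \<in> borel_measurable borel"
          by (rule slice_borel_measurable_snd[OF m])
        show "indicator {0<..<T} (fst (s, q)) * W (prod.swap (s, q)) = 0" if "q \<notin> ?D" for q
          by (rule z) (use that in auto)
        show "AE q in lborel. q \<in> ?D \<longrightarrow> indicator {0<..<T} (fst (s, q)) * W (prod.swap (s, q)) = w s q"
          using e by eventually_elim (use s in auto)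
      qed
    qed
  qed
  have fm[measurable]: "f \<in> borel_measurable borel" and gm[measurable]: "g \<in> borel_measurable borel"
    unfolding f_def[abs_def] g_def[abs_def] by (rule cut(1)[OF U], rule cut(1)[OF V])
  have f0: "f p = 0" and g0: "g p = 0" if "p \<notin> {0<..<T} \<times> ?D" for p
    unfolding f_def g_def by (rule cut(2)[OF U that], rule cut(2)[OF V that])
  have fs: "AE s in lborel. s \<in> {0<..<T} \<longrightarrow> borel_version ?D (u s) (\<lambda>q. f (s, q))"
    unfolding f_def by (rule cut(3)[OF U])
  have gs: "AE s in lborel. s \<in> {0<..<T} \<longrightarrow> borel_version ?D (v s) (\<lambda>q. g (s, q))"
    unfolding g_def by (rule cut(3)[OF V])
  have "continuous_on {0..T} (\<lambda>t. norm_L2 ?D (u t))"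
    unfolding continuous_on_def
  proof
    fix s assume s: "s \<in> {0..T}"
    show "((\<lambda>t. norm_L2 ?D (u t)) \<longlongrightarrow> norm_L2 ?D (u s)) (at s within {0..T})"
      by (rule tendsto_within_subset[OF cont]) (use s in auto)
  qed
  then have "bounded ((\<lambda>t. norm_L2 ?D (u t)) ` {0..T})"
    by (intro compact_imp_bounded compact_continuous_image) auto
  then obtain M where "\<forall>x\<in>(\<lambda>t. norm_L2 ?D (u t)) ` {0..T}. norm x \<le> M" unfolding bounded_iff by blast
  then have M: "\<bar>norm_L2 ?D (u t)\<bar> \<le> M" if "t \<in> {0..T}" for t using that by auto
  have f2: "integrable lborel (\<lambda>p. (f p)\<^sup>2)"
  proof (rule integrable_if_slices_bounded[where T = T and C = "M\<^sup>2"])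
    have "f (s, q) = 0" if "s \<notin> {0<..<T}" for s q by (rule f0) (use that in auto)
    then show "(f (s, q))\<^sup>2 = 0" if "s \<notin> {0<..<T}" for s q using that by simp
    show "AE s in lborel. s \<in> {0<..<T} \<longrightarrow> integrable lborel (\<lambda>q. (f (s, q))\<^sup>2) \<and> (LINT q|lborel. (f (s, q))\<^sup>2) \<le> M\<^sup>2"
      using fs
    proof (eventually_elim, intro impI)
      fix s assume "s \<in> {0<..<T} \<longrightarrow> borel_version ?D (u s) (\<lambda>q. f (s, q))" and s: "s \<in> {0<..<T}"
      then have bv: "borel_version ?D (u s) (\<lambda>q. f (s, q))" by simp
      have "(norm_L2 ?D (u s))\<^sup>2 \<le> M\<^sup>2"
        using M[of s] s norm_L2_nonneg[of ?D "u s"] by (intro power_mono) auto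
      then show "integrable lborel (\<lambda>q. (f (s, q))\<^sup>2) \<and> (LINT q|lborel. (f (s, q))\<^sup>2) \<le> M\<^sup>2"
        using L2_fun_iff[OF bv] u2[of s] s norm_L2_square[OF bv] by auto
    qed
  qed auto
  have g2: "integrable lborel (\<lambda>p. (g p)\<^sup>2)"
  proof (rule integrable_if_slices_bounded[where T = T and C = "C\<^sup>2"])
    have "g (s, q) = 0" if "s \<notin> {0<..<T}" for s q by (rule g0) (use that in auto)
    then show "(g (s, q))\<^sup>2 = 0" if "s \<notin> {0<..<T}" for s q using that by simp
    show "AE s in lborel. s \<in> {0<..<T} \<longrightarrow> integrable lborel (\<lambda>q. (g (s, q))\<^sup>2) \<and> (LINT q|lborel. (g (s, q))\<^sup>2) \<le> C\<^sup>2"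
      using gs v0 vC
    proof (eventually_elim, intro impI)
      fix s assume "s \<in> {0<..<T} \<longrightarrow> borel_version ?D (v s) (\<lambda>q. g (s, q))" "s \<in> {0<..<T} \<longrightarrow> v s \<in> sobolev 0 ?D"
        "s \<in> {0<..<T} \<longrightarrow> sobolev_norm 0 ?D (v s) \<le> C" "s \<in> {0<..<T}"
      then have bv: "borel_version ?D (v s) (\<lambda>q. g (s, q))" and s0: "v s \<in> sobolev 0 ?D" and le: "sobolev_norm 0 ?D (v s) \<le> C"
        by auto
      have "sobolev_norm 0 ?D (v s) = sqrt (LINT q|lborel. (g (s, q))\<^sup>2)"
        using norm_L2_square[OF sobolev_borel_version_0[OF s0 bv]] by (simp add: sobolev_norm_def)
      then have "(LINT q|lborel. (g (s, q))\<^sup>2) \<le> C\<^sup>2" using le by (auto intro: sqrt_le_D)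
      then show "integrable lborel (\<lambda>q. (g (s, q))\<^sup>2) \<and> (LINT q|lborel. (g (s, q))\<^sup>2) \<le> C\<^sup>2"
        using L2_rectD(2)[OF sobolev_L2_rect[OF s0 bv]] by simp
    qed
  qed auto
  have test: "(LINT p|lborel. f p * (dir_deriv 1 \<phi> (fst p) * \<psi> (snd p))) = - (LINT p|lborel. g p * (\<phi> (fst p) * \<psi> (snd p)))"
    if \<phi>: "test_function {0<..<T} \<phi>" and \<psi>: "test_function ?D \<psi>" for \<phi> \<psi>
  proof -
    let ?t = "\<lambda>(q, s). \<psi> q * \<phi> s"
    have t: "test_function ?\<Omega> ?t"
      by (rule test_function_mono[OF test_function_tensor[OF \<psi> \<phi>]]) auto
    have s: "smooth \<phi>" "smooth \<psi>" using \<phi> \<psi> by (auto simp: test_function_def)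
    have dt: "dir_deriv ((0, 0), 1) ?t = (\<lambda>(q, s). \<psi> q * dir_deriv 1 \<phi> s)"
      using dir_deriv_tensor_fst(2)[OF s(2,1), of 1] by (simp add: zero_prod_def)
    note \<phi>' = test_function_dir_deriv[OF \<phi>, of 1]
    have sw: "(LINT x|lborel. W x * (\<psi> (fst x) * \<eta> (snd x))) = (LINT p|lborel. (indicator {0<..<T} (fst p) * W (prod.swap p)) * (\<eta> (fst p) * \<psi> (snd p)))"
      if W: "W \<in> borel_measurable borel" and \<eta>: "test_function {0<..<T} \<eta>" for W \<eta>
    proof -
      have [measurable]: "W \<in> borel_measurable borel" "\<psi> \<in> borel_measurable borel" "\<eta> \<in> borel_measurable borel"
        using W test_function_borel_measurable[OF \<psi>] test_function_borel_measurable[OF \<eta>] by auto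
      have "(LINT x|lborel. W x * (\<psi> (fst x) * \<eta> (snd x))) = (LINT p|lborel. W (prod.swap p) * (\<psi> (fst (prod.swap p)) * \<eta> (snd (prod.swap p))))"
        by (rule integral_swap_lborel[symmetric]) measurable
      also have "\<dots> = (LINT p|lborel. (indicator {0<..<T} (fst p) * W (prod.swap p)) * (\<eta> (fst p) * \<psi> (snd p)))"
        by (intro Bochner_Integration.integral_cong) (use test_function_outside[OF \<eta>] in \<open>auto split: split_indicator\<close>)
      finally show ?thesis .
    qed
    have "(LINT x|lborel. U x * (\<psi> (fst x) * dir_deriv 1 \<phi> (snd x))) = - (LINT x|lborel. V x * (\<psi> (fst x) * \<phi> (snd x)))"
      using has_weak_derivD[OF wd t] borel_version_integral_test_function[OF U test_function_dir_deriv[OF t, of "((0, 0), 1)"]]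
        borel_version_integral_test_function[OF V t] dt by (simp add: split_def)
    then show ?thesis
      unfolding sw[OF borel_version_borel_measurable[OF U] \<phi>'] sw[OF borel_version_borel_measurable[OF V] \<phi>] f_def g_def .
  qed
  define h where "h r = (LINT q|lborel. 2 * (f (r, q) * g (r, q)))" for r
  have "\<exists>\<alpha>. AE s in lborel. s \<in> {0<..<T} \<longrightarrow> (LINT q|lborel. (f (s, q))\<^sup>2) = \<alpha> + prim h s"
    unfolding h_def[abs_def]
    by (rule energy_identity[OF T fm gm f2 g2, of "(0, 0)" "(L, B)"]) (use f0 g0 test D in auto)
  then obtain \<alpha> where \<alpha>: "AE s in lborel. s \<in> {0<..<T} \<longrightarrow> (LINT q|lborel. (f (s, q))\<^sup>2) = \<alpha> + prim h s" by blast
  have hi: "integrable lborel h"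
    unfolding h_def[abs_def] using integrable_fst_lborel[of "\<lambda>p. 2 * (f p * g p)"] integrable_mult_L2[of f lborel g] f2 g2 by simp
  have h0: "h s = 0" if "s \<notin> {0<..<T}" for s
  proof -
    have "f (s, q) = 0" for q using that by (intro f0) auto
    then show ?thesis by (simp add: h_def)
  qed
  have "AE s in lborel. s \<in> {0<..<T} \<longrightarrow> (norm_L2 ?D (u s))\<^sup>2 = \<alpha> + prim h s \<and>
       h s \<le> - (2 * a\<^sup>2 * (1 - \<gamma> / a) * (norm_L2 ?D (u s))\<^sup>2)"
    using \<alpha> fs gs u4 u5 v0 eq bc
  proof (eventually_elim, intro impI)
    fix s
    assume "s \<in> {0<..<T} \<longrightarrow> (LINT q|lborel. (f (s, q))\<^sup>2) = \<alpha> + prim h s"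
      "s \<in> {0<..<T} \<longrightarrow> borel_version ?D (u s) (\<lambda>q. f (s, q))" "s \<in> {0<..<T} \<longrightarrow> borel_version ?D (v s) (\<lambda>q. g (s, q))"
      "s \<in> {0<..<T} \<longrightarrow> u s \<in> sobolev 4 ?D" "s \<in> {0<..<T} \<longrightarrow> L2_weak_deriv 5 0 ?D (u s)"
      "s \<in> {0<..<T} \<longrightarrow> v s \<in> sobolev 0 ?D"
      "s \<in> {0<..<T} \<longrightarrow> (AE p in lborel. p \<in> ?D \<longrightarrow>
        v s p + lap ?D (lap ?D (u s)) p + \<gamma> * lap ?D (u s) p + lap ?D (wd 1 0 ?D (u s)) p
          + u s p * wd 1 0 ?D (u s) p - wd 5 0 ?D (u s) p = 0)"
      "s \<in> {0<..<T} \<longrightarrow> boundary_conditions L B (u s)" "s \<in> {0<..<T}"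
    then have e: "(LINT q|lborel. (f (s, q))\<^sup>2) = \<alpha> + prim h s"
      and W: "borel_version ?D (u s) (\<lambda>q. f (s, q))" and V: "borel_version ?D (v s) (\<lambda>q. g (s, q))"
      and s4: "u s \<in> sobolev 4 ?D" and s5: "L2_weak_deriv 5 0 ?D (u s)" and s0: "v s \<in> sobolev 0 ?D"
      and pde: "AE p in lborel. p \<in> ?D \<longrightarrow>
        v s p + lap ?D (lap ?D (u s)) p + \<gamma> * lap ?D (u s) p + lap ?D (wd 1 0 ?D (u s)) p
          + u s p * wd 1 0 ?D (u s) p - wd 5 0 ?D (u s) p = 0"
      and b: "boundary_conditions L B (u s)" by blast+
    note le = energy_inequality[OF B L \<gamma> a s4 s5 b W V sobolev_L2_rect[OF s0 V] pde]
    have hs: "h s = 2 * (LINT q|lborel. g (s, q) * f (s, q))" by (simp add: h_def mult.commute)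
    note nE = norm_L2_square[OF W]
    have "h s \<le> 2 * (- (a\<^sup>2 * (1 - \<gamma> / a)) * (norm_L2 ?D (u s))\<^sup>2)"
      unfolding hs nE by (rule mult_left_mono[OF le]) simp
    also have "\<dots> = - (2 * a\<^sup>2 * (1 - \<gamma> / a) * (norm_L2 ?D (u s))\<^sup>2)"
      by (simp only: mult.assoc mult_minus_left mult_minus_right)
    finally show "(norm_L2 ?D (u s))\<^sup>2 = \<alpha> + prim h s \<and>
       h s \<le> - (2 * a\<^sup>2 * (1 - \<gamma> / a) * (norm_L2 ?D (u s))\<^sup>2)"
      using e nE by simp
  qed
  then show ?thesis using hi h0 by blast
qed

theorem theorem6p1:
  fixes L B a b \<gamma> \<theta> chi :: real
    and u0 :: "real \<times> real \<Rightarrow> real"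
    and u :: "real \<Rightarrow> real \<times> real \<Rightarrow> real"
  assumes "B > 0" and "L > 0"
    and "a = pi\<^sup>2 / B\<^sup>2 + pi\<^sup>2 / L\<^sup>2"
    and "\<gamma> > 0"
    and "b = \<gamma> * inverse (pi\<^sup>2 / B\<^sup>2 + pi\<^sup>2 / L\<^sup>2)" and "b < 1"
    and "\<theta> = 1 - b"
    and "u0 \<in> sobolev 4 (rect L B)"
    and "L2_weak_deriv 5 0 (rect L B) u0"
    and "boundary_conditions L B u0"
    and "J_w L B u0 < \<infinity>"
    and "regular_solution L B \<gamma> u0 u"
    and "chi = 2 * a\<^sup>2 * \<theta>"
  shows "\<forall>t\<ge>0. (norm_L2 (rect L B) (u t))\<^sup>2 \<le> (norm_L2 (rect L B) u0)\<^sup>2 * exp (- chi * t)"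
proof (intro allI impI)
  let ?D = "rect L B"
  fix t :: real assume t: "0 \<le> t"
  have a0: "0 < a" unfolding assms(3) using assms(1,2) by (intro add_pos_pos divide_pos_pos) auto
  have b: "b = \<gamma> / a" using assms(3,5) by (simp add: divide_inverse)
  then have \<gamma>: "\<gamma> < a" using assms(6) a0 by simp
  have chi: "chi = 2 * a\<^sup>2 * (1 - \<gamma> / a)" using assms(7,13) b by simp
  note reg = assms(12)[unfolded regular_solution_def Let_def]
  have u2: "\<And>t. 0 \<le> t \<Longrightarrow> L2_fun ?D (u t)"
    and cont: "\<And>s. 0 \<le> s \<Longrightarrow> ((\<lambda>t. norm_L2 ?D (\<lambda>p. u t p - u s p)) \<longlongrightarrow> 0) (at s within {0..})"
    and init: "AE p in lebesgue. p \<in> ?D \<longrightarrow> u 0 p = u0 p"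
    using reg by blast+
  obtain v where wd: "has_weak_deriv [((0, 0), 1)] (?D \<times> {0<..}) (\<lambda>(p, t). u t p) (\<lambda>(p, t). v t p)"
    and sol: "\<And>T. T > 0 \<Longrightarrow>
           u \<in> bochner_Linf 2 ?D T \<and> u \<in> bochner_L2 4 ?D T \<and>
           (AE t in lebesgue. t \<in> {0<..<T} \<longrightarrow> L2_weak_deriv 5 0 ?D (u t)) \<and>
           (\<lambda>t. wd 5 0 ?D (u t)) \<in> bochner_L2 0 ?D T \<and>
           v \<in> bochner_Linf 0 ?D T \<and> v \<in> bochner_L2 2 ?D T \<and>
           (AE t in lebesgue. t \<in> {0<..<T} \<longrightarrow>
              (AE p in lebesgue. p \<in> ?D \<longrightarrow>
                 v t p + lap ?D (lap ?D (u t)) p + \<gamma> * lap ?D (u t) p + lap ?D (wd 1 0 ?D (u t)) p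
                   + u t p * wd 1 0 ?D (u t) p - wd 5 0 ?D (u t) p = 0)) \<and>
           (AE t in lebesgue. t \<in> {0<..<T} \<longrightarrow> boundary_conditions L B (u t))"
    using reg by blast
  have nc: "((\<lambda>t. norm_L2 ?D (u t)) \<longlongrightarrow> norm_L2 ?D (u s)) (at s within {0..})" if "0 \<le> s" for s
    by (rule norm_L2_tendsto[OF rect_borel u2 that cont[OF that]])
  have "(norm_L2 ?D (u t))\<^sup>2 \<le> (norm_L2 ?D (u 0))\<^sup>2 * exp (- chi * t)"
  proof (rule energy_decay[where N = "\<lambda>t. (norm_L2 ?D (u t))\<^sup>2", OF _ _ t])
    show "((\<lambda>t. (norm_L2 ?D (u t))\<^sup>2) \<longlongrightarrow> (norm_L2 ?D (u s))\<^sup>2) (at s within {0..})" if "0 \<le> s" for s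
      by (intro tendsto_power nc that)
    fix T :: real assume T: "0 < T"
    note s = sol[OF T, unfolded AE_completion_iff]
    have s4: "AE t in lborel. t \<in> {0<..<T} \<longrightarrow> u t \<in> sobolev 4 ?D"
      using s unfolding bochner_L2_def strongly_measurable_def AE_completion_iff by blast
    have v0: "AE t in lborel. t \<in> {0<..<T} \<longrightarrow> v t \<in> sobolev 0 ?D"
      using s unfolding bochner_Linf_def strongly_measurable_def AE_completion_iff by blast
    obtain C where vC: "AE t in lborel. t \<in> {0<..<T} \<longrightarrow> sobolev_norm 0 ?D (v t) \<le> C"
      using s unfolding bochner_Linf_def AE_completion_iff by blast
    show "\<exists>\<alpha> h. integrable lborel h \<and> (\<forall>s. s \<notin> {0<..<T} \<longrightarrow> h s = 0) \<and>
      (AE s in lborel. s \<in> {0<..<T} \<longrightarrow> (norm_L2 ?D (u s))\<^sup>2 = \<alpha> + prim h s \<and> h s \<le> - (chi * (norm_L2 ?D (u s))\<^sup>2))"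
      unfolding chi
      by (rule regular_solution_energy[OF assms(1,2,4) \<gamma> assms(3) T u2 nc wd s4 _ v0 vC]) (use s in blast)+
  qed
  also have "(norm_L2 ?D (u 0))\<^sup>2 = (norm_L2 ?D u0)\<^sup>2"
  proof -
    obtain F where F: "borel_version ?D (u 0) F" using L2_fun_borel_version[OF rect_borel u2[of 0]] by auto
    have F0: "borel_version ?D u0 F" by (rule borel_version_cong_AE[OF F init[unfolded AE_completion_iff]])
    show ?thesis unfolding norm_L2_square[OF F] norm_L2_square[OF F0] ..
  qed
  finally show "(norm_L2 ?D (u t))\<^sup>2 \<le> (norm_L2 ?D u0)\<^sup>2 * exp (- chi * t)" .
qed

end
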